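(* Let $A$ be a unital separable simple $C^*$-algebra with ${\rm TR}(A)\le1$, and let $\alpha\in{\rm Aut}(A)$ be such that $\alpha^r$ is approximately inner for some integer $r\ge1$. If $\alpha$ has the tracial Rokhlin property, then $\alpha$ has the tracial cyclic Rokhlin property.
   Context: Let $\mathcal I^{(0)}$ denote the class of finite-dimensional $C^*$-algebras and, for $k\ge1$, let $\mathcal I^{(k)}$ denote the class of $C^*$-algebras of the form $pM_n(C(X))p$, where $X$ is a finite CW complex of dimension at most $k$ and $p\in M_n(C(X))$ is a projection. For positive elements $a,b$ of a $C^*$-algebra $A$, write $[a]\le[b]$ if there is $x\in A$ with $a=x^*x$ and $xx^*\in\overline{bAb}$. A unital simple $C^*$-algebra $A$ has ${\rm TR}(A)\le k$ if for every finite $\mathcal F\subset A$, every $\varepsilon>0$ and every nonzero positive $a\in A$ there is a $C^*$-subalgebra $B\subset A$ with $B\in\mathcal I^{(k)}$ and $1_B=p$ such that $\|xp-px\|<\varepsilon$ and ${\rm dist}(pxp,B)<\varepsilon$ for all $x\in\mathcal F$, and $[1-p]\le[a]$. An automorphism $\alpha$ of a simple unital $C^*$-algebra $A$ has the tracial Rokhlin property if for every finite $F\subset A$, $\varepsilon>0$, $n\in\mathbb N$ and nonzero positive $x\in A$ there are mutually orthogonal projections $e_0,\dots,e_n\in A$ with (1) $\|\alpha(e_j)-e_{j+1}\|<\varepsilon$ for $0\le j\le n-1$; (2) $\|e_ja-ae_j\|<\varepsilon$ for all $j$ and $a\in F$; (3) $[1-\sum_j e_j]\le[x]$. It has the tracial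 cyclic Rokhlin property if the same holds with (1) required for $0\le j\le n$, where $e_{n+1}=e_0$. An automorphism is approximately inner if it is a pointwise-norm limit of inner automorphisms ${\rm ad}\,u_n$. *)

theory Defs
  imports "HOL-Analysis.Analysis"
begin

class cstar_algebra = real_normed_algebra_1 + banach +
  fixes cs_star :: "'a \<Rightarrow> 'a"
    and cs_scale :: "complex \<Rightarrow> 'a \<Rightarrow> 'a"
  assumes cs_scale_of_real: "cs_scale (complex_of_real r) x = scaleR r x"
    and cs_scale_add_left: "cs_scale (a + b) x = cs_scale a x + cs_scale b x"
    and cs_scale_add_right: "cs_scale a (x + y) = cs_scale a x + cs_scale a y"
    and cs_scale_scale: "cs_scale a (cs_scale b x) = cs_scale (a * b) x"
    and cs_scale_one: "cs_scale 1 x = x"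
    and cs_norm_scale: "norm (cs_scale a x) = cmod a * norm x"
    and cs_scale_mult_left: "cs_scale a (x * y) = cs_scale a x * y"
    and cs_scale_mult_right: "cs_scale a (x * y) = x * cs_scale a y"
    and cs_star_star: "cs_star (cs_star x) = x"
    and cs_star_add: "cs_star (x + y) = cs_star x + cs_star y"
    and cs_star_mult: "cs_star (x * y) = cs_star y * cs_star x"
    and cs_star_scale: "cs_star (cs_scale a x) = cs_scale (cnj a) (cs_star x)"
    and cs_cstar_identity: "norm (cs_star x * x) = (norm x)\<^sup>2"

definition cs_positive :: "'a::cstar_algebra \<Rightarrow> bool" where
  "cs_positive a \<longleftrightarrow> (\<exists>x. a = cs_star x * x)"

definition cs_projection :: "'a::cstar_algebra \<Rightarrow> bool" where
  "cs_projection p \<longleftrightarrow> p = cs_star p \<and> p * p = p"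

definition cs_unitary :: "'a::cstar_algebra \<Rightarrow> bool" where
  "cs_unitary u \<longleftrightarrow> cs_star u * u = 1 \<and> u * cs_star u = 1"

definition cs_hered :: "'a::cstar_algebra \<Rightarrow> 'a set" where
  "cs_hered b = closure {b * y * b | y. True}"

definition cs_subeq :: "'a::cstar_algebra \<Rightarrow> 'a \<Rightarrow> bool" where
  "cs_subeq a b \<longleftrightarrow> (\<exists>x. a = cs_star x * x \<and> x * cs_star x \<in> cs_hered b)"

definition cs_separable :: "'a::cstar_algebra itself \<Rightarrow> bool" where
  "cs_separable _ \<longleftrightarrow> (\<exists>D::'a set. countable D \<and> closure D = UNIV)"

definition cs_ideal :: "'a::cstar_algebra set \<Rightarrow> bool" where
  "cs_ideal I \<longleftrightarrow> 0 \<in> I \<and> (\<forall>x\<in>I. \<forall>y\<in>I. x + y \<in> I)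
     \<and> (\<forall>c x. x \<in> I \<longrightarrow> cs_scale c x \<in> I)
     \<and> (\<forall>a x. x \<in> I \<longrightarrow> a * x \<in> I \<and> x * a \<in> I)"

definition cs_simple :: "'a::cstar_algebra itself \<Rightarrow> bool" where
  "cs_simple _ \<longleftrightarrow> (\<forall>I::'a set. cs_ideal I \<and> closed I \<longrightarrow> I = {0} \<or> I = UNIV)"

definition cs_subalgebra :: "'a::cstar_algebra set \<Rightarrow> bool" where
  "cs_subalgebra B \<longleftrightarrow> closed B \<and> 0 \<in> B \<and> (\<forall>x\<in>B. \<forall>y\<in>B. x + y \<in> B \<and> x * y \<in> B)
     \<and> (\<forall>c. \<forall>x\<in>B. cs_scale c x \<in> B) \<and> (\<forall>x\<in>B. cs_star x \<in> B)"

definition cs_unit_of :: "'a::cstar_algebra set \<Rightarrow> 'a \<Rightarrow> bool" where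
  "cs_unit_of B p \<longleftrightarrow> p \<in> B \<and> (\<forall>b\<in>B. p * b = b \<and> b * p = b)"

definition cs_automorphism :: "('a::cstar_algebra \<Rightarrow> 'a) \<Rightarrow> bool" where
  "cs_automorphism \<alpha> \<longleftrightarrow> bij \<alpha> \<and> (\<forall>x y. \<alpha> (x + y) = \<alpha> x + \<alpha> y \<and> \<alpha> (x * y) = \<alpha> x * \<alpha> y)
     \<and> (\<forall>c x. \<alpha> (cs_scale c x) = cs_scale c (\<alpha> x)) \<and> (\<forall>x. \<alpha> (cs_star x) = cs_star (\<alpha> x))"

definition cs_approx_inner :: "('a::cstar_algebra \<Rightarrow> 'a) \<Rightarrow> bool" where
  "cs_approx_inner \<alpha> \<longleftrightarrow> (\<exists>u::nat \<Rightarrow> 'a. (\<forall>n. cs_unitary (u n)) \<and>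
      (\<forall>x. (\<lambda>n. u n * x * cs_star (u n)) \<longlonglongrightarrow> \<alpha> x))"

text \<open>A finite CW complex of dimension \<open>\<le> 1\<close>: a Hausdorff space which is the union of a
  finite set of 0-cells and finitely many 1-cells, each given by a characteristic map
  from \<open>[0,1]\<close> mapping the boundary into the 0-cells and restricting to a homeomorphism
  of \<open>(0,1)\<close> onto the open cell; open cells are pairwise disjoint and disjoint from the
  0-skeleton.  (For finitely many cells the weak topology condition is automatic.)
  Points are taken in the type \<open>nat \<times> real\<close>, which is large enough to carry every such
  space up to homeomorphism.\<close>

definition cw1_complex :: "(nat \<times> real) topology \<Rightarrow> bool" where
  "cw1_complex X \<longleftrightarrow> Hausdorff_space X \<and>
     (\<exists>V m (\<phi> :: nat \<Rightarrow> real \<Rightarrow> nat \<times> real).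
        finite V \<and> V \<subseteq> topspace X \<and>
        (\<forall>i<m. continuous_map (top_of_set {0..1}) X (\<phi> i)
               \<and> \<phi> i 0 \<in> V \<and> \<phi> i 1 \<in> V
               \<and> homeomorphic_map (top_of_set {0<..<1}) (subtopology X (\<phi> i ` {0<..<1})) (\<phi> i)
               \<and> \<phi> i ` {0<..<1} \<inter> V = {}) \<and>
        (\<forall>i<m. \<forall>j<m. i \<noteq> j \<longrightarrow> \<phi> i ` {0<..<1} \<inter> \<phi> j ` {0<..<1} = {}) \<and>
        topspace X = V \<union> (\<Union>i<m. \<phi> i ` {0..1}))"

type_synonym mfun = "nat \<times> real \<Rightarrow> nat \<Rightarrow> nat \<Rightarrow> complex"

text \<open>\<open>M_n(C(X))\<close>: continuous matrix-valued functions on \<open>X\<close> (zero outside \<open>X\<close> and outside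
  the index range, for uniqueness of representation).\<close>
definition MCX :: "(nat \<times> real) topology \<Rightarrow> nat \<Rightarrow> mfun set" where
  "MCX X n = {f. (\<forall>i<n. \<forall>j<n. continuous_map X euclidean (\<lambda>x. f x i j)) \<and>
                 (\<forall>x i j. x \<notin> topspace X \<or> n \<le> i \<or> n \<le> j \<longrightarrow> f x i j = 0)}"

definition madd :: "mfun \<Rightarrow> mfun \<Rightarrow> mfun" where
  "madd f g = (\<lambda>x i j. f x i j + g x i j)"

definition mscale :: "complex \<Rightarrow> mfun \<Rightarrow> mfun" where
  "mscale c f = (\<lambda>x i j. c * f x i j)"

definition mmul :: "nat \<Rightarrow> mfun \<Rightarrow> mfun \<Rightarrow> mfun" where
  "mmul n f g = (\<lambda>x i j. \<Sum>k<n. f x i k * g x k j)"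

definition mstar :: "mfun \<Rightarrow> mfun" where
  "mstar f = (\<lambda>x i j. cnj (f x j i))"

definition corner :: "(nat \<times> real) topology \<Rightarrow> nat \<Rightarrow> mfun \<Rightarrow> mfun set" where
  "corner X n q = {f \<in> MCX X n. mmul n (mmul n q f) q = f}"

definition in_I1 :: "'a::cstar_algebra set \<Rightarrow> bool" where
  "in_I1 B \<longleftrightarrow> (\<exists>X n q (\<phi> :: mfun \<Rightarrow> 'a).
     cw1_complex X \<and> q \<in> MCX X n \<and> mstar q = q \<and> mmul n q q = q \<and>
     bij_betw \<phi> (corner X n q) B \<and>
     (\<forall>f\<in>corner X n q. \<forall>g\<in>corner X n q.
         \<phi> (madd f g) = \<phi> f + \<phi> g \<and> \<phi> (mmul n f g) = \<phi> f * \<phi> g) \<and>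
     (\<forall>c. \<forall>f\<in>corner X n q. \<phi> (mscale c f) = cs_scale c (\<phi> f)) \<and>
     (\<forall>f\<in>corner X n q. \<phi> (mstar f) = cs_star (\<phi> f)))"

definition TR_le_1 :: "'a::cstar_algebra itself \<Rightarrow> bool" where
  "TR_le_1 _ \<longleftrightarrow> (\<forall>(F::'a set) \<epsilon> a. finite F \<and> \<epsilon> > 0 \<and> cs_positive a \<and> a \<noteq> 0 \<longrightarrow>
     (\<exists>B p. cs_subalgebra B \<and> in_I1 B \<and> cs_unit_of B p \<and>
        (\<forall>x\<in>F. norm (x * p - p * x) < \<epsilon> \<and> infdist (p * x * p) B < \<epsilon>) \<and>
        cs_subeq (1 - p) a))"

definition tracial_rokhlin :: "('a::cstar_algebra \<Rightarrow> 'a) \<Rightarrow> bool" where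
  "tracial_rokhlin \<alpha> \<longleftrightarrow> (\<forall>(F::'a set) \<epsilon> (n::nat) x. finite F \<and> \<epsilon> > 0 \<and> cs_positive x \<and> x \<noteq> 0 \<longrightarrow>
     (\<exists>e::nat \<Rightarrow> 'a. (\<forall>j\<le>n. cs_projection (e j)) \<and>
        (\<forall>i\<le>n. \<forall>j\<le>n. i \<noteq> j \<longrightarrow> e i * e j = 0) \<and>
        (\<forall>j<n. norm (\<alpha> (e j) - e (Suc j)) < \<epsilon>) \<and>
        (\<forall>j\<le>n. \<forall>a\<in>F. norm (e j * a - a * e j) < \<epsilon>) \<and>
        cs_subeq (1 - (\<Sum>j\<le>n. e j)) x))"

definition tracial_cyclic_rokhlin :: "('a::cstar_algebra \<Rightarrow> 'a) \<Rightarrow> bool" where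
  "tracial_cyclic_rokhlin \<alpha> \<longleftrightarrow> (\<forall>(F::'a set) \<epsilon> (n::nat) x. finite F \<and> \<epsilon> > 0 \<and> cs_positive x \<and> x \<noteq> 0 \<longrightarrow>
     (\<exists>e::nat \<Rightarrow> 'a. (\<forall>j\<le>n. cs_projection (e j)) \<and>
        (\<forall>i\<le>n. \<forall>j\<le>n. i \<noteq> j \<longrightarrow> e i * e j = 0) \<and>
        (\<forall>j\<le>n. norm (\<alpha> (e j) - e (if j = n then 0 else Suc j)) < \<epsilon>) \<and>
        (\<forall>j\<le>n. \<forall>a\<in>F. norm (e j * a - a * e j) < \<epsilon>) \<and>
        cs_subeq (1 - (\<Sum>j\<le>n. e j)) x))"

end

(*
Let R = r (n + 1); alpha^R is a limit of inner automorphisms Ad u_k. Choosing first u_m, then a long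
Rokhlin tower e_0, e_1, ... commuting approximately with u_m, and then u_k with k large, we obtain a
unitary w = u_m^* u_k which is approximately central and carries e_0 approximately to e_R. In the
algebra of bounded sequences modulo null sequences this yields matrix units E_kl on the rungs e_(R k)
which commute with the given finite set and on which alpha^R acts as the shift. Rotating the first H
rungs slowly into the last H ones turns the shift into an approximately cyclic one, at the cost of a remainder of
boundedly many rungs, however long the tower is; the alpha-translates of the resulting projection are
added up according to their index modulo n + 1.

For the remainder, choose orthogonal nonzero elements x', y below x. Rokhlin's property absorbs
1 - sum e_j in x'. By simplicity 1 = sum_i s_i y^2 s_i^*, and moving one rung to M different rungs
by matrix units W_i commuting with s_i and y shows that sum_i y W_i s_i^* is a partial isometry from
this rung into the right ideal of y, so a long tower has enough room for the whole remainder.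
*)

theory Submission
  imports Defs
begin

text \<open>The tower supplied by the Rokhlin property is open: nothing relates its last projection
  to its first. Approximate innerness of a power of \<alpha> gives what is needed to bend it, a
  nearly central unitary between rungs R apart; the factor n + 1 in R keeps classes modulo n + 1
  fixed under a shift by R.

  The order of choices matters: the number H of rotated rungs depends only on \<epsilon>, the number
  M of terms in the decomposition of 1 only on y. Hence the number T = 2 H + H M of rungs is fixed
  before the long tower is taken.

  If [1] <= [x], zero projections suffice. Otherwise the Rokhlin projections used to split x are
  forced to be nonzero, and this is what produces the two orthogonal elements below x.

  In the sequence algebra all relations are exact except one: the rotation leaves a small defect.
  Its size is recorded as an identity with a sum of squares, because such an identity lifts back to
  a norm bound in A.\<close>

notation cs_star (\<open>_\<^sup>\<star>\<close> [1000] 999)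

declare cs_star_star [simp] cs_star_mult [simp] cs_star_add [simp] cs_scale_one [simp]

section \<open>Rules for the involution, the scalar \<i> and the norm\<close>

lemma cs_star_scaleR [simp]: "(r *\<^sub>R x)\<^sup>\<star> = r *\<^sub>R x\<^sup>\<star>" for x :: "'a::cstar_algebra"
  by (simp flip: cs_scale_of_real add: cs_star_scale)

lemma cs_star_zero [simp]: "0\<^sup>\<star> = (0 :: 'a::cstar_algebra)"
  using cs_star_scaleR[of 0 0] by simp

lemma cs_star_minus [simp]: "(- x)\<^sup>\<star> = - (x\<^sup>\<star>)" for x :: "'a::cstar_algebra"
  using cs_star_scaleR[of "-1" x] by simp

lemma cs_star_diff [simp]: "(x - y)\<^sup>\<star> = x\<^sup>\<star> - y\<^sup>\<star>" for x y :: "'a::cstar_algebra"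
  using cs_star_add[of x "- y"] by simp

lemma cs_star_one [simp]: "1\<^sup>\<star> = (1 :: 'a::cstar_algebra)"
  by (metis cs_star_mult cs_star_star mult.right_neutral)

lemma cs_star_of_real [simp]: "(of_real r)\<^sup>\<star> = (of_real r :: 'a::cstar_algebra)"
  by (simp add: of_real_def)

lemma cs_star_numeral [simp]: "(numeral n)\<^sup>\<star> = (numeral n :: 'a::cstar_algebra)"
  using cs_star_of_real[of "numeral n"] by simp

lemma cs_star_sum [simp]: "(\<Sum>i\<in>I. f i)\<^sup>\<star> = (\<Sum>i\<in>I. (f i)\<^sup>\<star>)" for f :: "'b \<Rightarrow> 'a::cstar_algebra"
  by (induction I rule: infinite_finite_induct) auto

lemma cs_scale_minus_one: "cs_scale (- 1) x = - x" for x :: "'a::cstar_algebra"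
  using cs_scale_of_real[of "-1" x] by simp

lemma cs_scale_i_mult: "cs_scale \<i> x * cs_scale \<i> y = - (x * y)" for x :: "'a::cstar_algebra"
  by (simp flip: cs_scale_mult_left cs_scale_mult_right add: cs_scale_scale cs_scale_minus_one)

lemma cs_star_scale_i: "(cs_scale \<i> x)\<^sup>\<star> = - cs_scale \<i> (x\<^sup>\<star>)" for x :: "'a::cstar_algebra"
proof -
  have "cs_scale (- \<i>) y = - cs_scale \<i> y" for y :: 'a
    by (metis cs_scale_minus_one cs_scale_scale mult_minus1)
  then show ?thesis by (simp add: cs_star_scale)
qed

lemma cs_scale_i_commute: "x * y = y * x \<Longrightarrow> x * cs_scale \<i> y = cs_scale \<i> y * x"
  for x :: "'a::cstar_algebra"
  by (metis cs_scale_mult_left cs_scale_mult_right)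

lemma norm_cs_star [simp]: "norm (x\<^sup>\<star>) = norm x" for x :: "'a::cstar_algebra"
proof -
  have le: "norm y \<le> norm (y\<^sup>\<star>)" for y :: 'a
  proof (cases "y = 0")
    case False
    have "norm y * norm y \<le> norm (y\<^sup>\<star>) * norm y"
      using cs_cstar_identity[of y] norm_mult_ineq[of "y\<^sup>\<star>" y] by (simp add: power2_eq_square)
    with False show ?thesis by simp
  qed simp
  show ?thesis using le[of x] le[of "x\<^sup>\<star>"] by simp
qed

lemma tendsto_cs_star [tendsto_intros]:
  "(f \<longlongrightarrow> l) F \<Longrightarrow> ((\<lambda>x. (f x)\<^sup>\<star>) \<longlongrightarrow> l\<^sup>\<star>) F" for l :: "'a::cstar_algebra"
  unfolding tendsto_iff dist_norm by (simp flip: cs_star_diff)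

lemma cs_star_mult_eq_0: "x\<^sup>\<star> * x = 0 \<longleftrightarrow> x = 0" for x :: "'a::cstar_algebra"
  using cs_cstar_identity[of x] by auto

subsection \<open>Positive elements\<close>

lemma norm_selfadjoint_square:
  fixes x :: "'a::cstar_algebra"
  assumes "x\<^sup>\<star> = x"
  shows "norm (x * x) = (norm x)\<^sup>2"
  using cs_cstar_identity[of x] assms by simp

text \<open>The element \<open>1 - s\<close> is a square root of \<open>1 - b\<close>; \<open>s\<close> is the limit of the iteration
  \<open>s \<mapsto> (b + s\<^sup>2) / 2\<close>, which is dominated by the same iteration started with the number \<open>norm b\<close>.\<close>

lemma sqrt_one_minus:
  fixes b :: "'a::cstar_algebra"
  assumes "norm b \<le> 1"
  obtains s where "norm s \<le> norm b" "s + s = b + s * s" "b\<^sup>\<star> = b \<Longrightarrow> s\<^sup>\<star> = s"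
    "\<And>z. z * b = b * z \<Longrightarrow> z * s = s * z"
proof -
  define S where "S = rec_nat (0::'a) (\<lambda>_ s. (1/2) *\<^sub>R (b + s * s))"
  define t where "t = rec_nat (0::real) (\<lambda>_ s. (norm b + s * s) / 2)"
  have S0: "S 0 = 0" and SS: "S (Suc n) = (1/2) *\<^sub>R (b + S n * S n)" for n
    by (auto simp: S_def)
  have t0: "t 0 = 0" and tS: "t (Suc n) = (norm b + t n * t n) / 2" for n
    by (auto simp: t_def)
  have t_pos: "0 \<le> t n" for n by (induction n) (auto simp: t0 tS)
  have t_le: "t n \<le> norm b" for n
  proof (induction n)
    case (Suc n)
    have "t n * t n \<le> norm b * 1"
      using Suc assms t_pos[of n] by (intro mult_mono) auto
    then show ?case by (simp add: tS)
  qed (simp add: t0)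
  have t_mono: "t n \<le> t (Suc n)" for n
  proof (induction n)
    case (Suc n)
    have "t n * t n \<le> t (Suc n) * t (Suc n)" using Suc t_pos by (intro mult_mono) auto
    then show ?case unfolding tS[of "Suc n"] tS[of n] by (simp add: tS)
  qed (simp add: t0 tS)
  have comm: "z * S n = S n * z" if "z * b = b * z" for z n
  proof (induction n)
    case (Suc n)
    have "z * (S n * S n) = S n * S n * z" by (metis Suc mult.assoc)
    then show ?case using that by (simp add: SS distrib_left distrib_right)
  qed (simp add: S0)
  have comm': "S m * S n = S n * S m" for m n
    using comm[of "S m" n] comm[of b m] by simp
  have S_le: "norm (S n) \<le> t n" for n
  proof (induction n)
    case (Suc n)
    have "norm (b + S n * S n) \<le> norm b + norm (S n) * norm (S n)"
      by (rule norm_triangle_le) (simp add: norm_mult_ineq)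
    also have "\<dots> \<le> norm b + t n * t n" using Suc t_pos[of n] by (intro add_left_mono mult_mono) auto
    finally show ?case by (simp add: SS tS)
  qed (simp add: S0 t0)
  \<comment> \<open>The iterates commute, so the difference of two squares factors; the increments
    of \<open>t\<close> then dominate those of \<open>S\<close>, and telescoping makes the latter
    summable.\<close>
  have diff: "norm (S (Suc n) - S n) \<le> t (Suc n) - t n" for n
  proof (induction n)
    case (Suc n)
    have "S (Suc (Suc n)) - S (Suc n) = (1/2) *\<^sub>R (S (Suc n) * S (Suc n) - S n * S n)"
      unfolding SS[of "Suc n"] by (subst (3) SS) (simp add: algebra_simps)
    also have "\<dots> = (1/2) *\<^sub>R ((S (Suc n) - S n) * (S (Suc n) + S n))"
      using comm'[of n "Suc n"] by (simp add: algebra_simps)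
    finally have "norm (S (Suc (Suc n)) - S (Suc n))
        \<le> norm (S (Suc n) - S n) * norm (S (Suc n) + S n) / 2"
      using norm_mult_ineq[of "S (Suc n) - S n" "S (Suc n) + S n"] by simp
    also have "\<dots> \<le> (t (Suc n) - t n) * (t (Suc n) + t n) / 2"
      using Suc S_le[of n] S_le[of "Suc n"] t_mono[of n] norm_triangle_ineq[of "S (Suc n)" "S n"]
      by (intro divide_right_mono mult_mono) auto
    also have "\<dots> = (t (Suc n) * t (Suc n) - t n * t n) / 2" by (simp add: algebra_simps)
    also have "\<dots> = t (Suc (Suc n)) - t (Suc n)"
      unfolding tS[of "Suc n"] by (subst (5) tS) (simp add: field_simps)
    finally show ?case .
  qed (simp add: S0 t0 SS tS)
  have "incseq t" using t_mono by (rule incseq_SucI)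
  then obtain l where "t \<longlonglongrightarrow> l" using incseq_convergent[of t "norm b"] t_le by blast
  then have "summable (\<lambda>n. t (Suc n) - t n)" using telescope_sums sums_summable by blast
  then have "summable (\<lambda>n. S (Suc n) - S n)"
    by (rule summable_comparison_test'[of _ 0]) (rule diff)
  then have "(\<lambda>n. \<Sum>i<n. S (Suc i) - S i) \<longlonglongrightarrow> (\<Sum>i. S (Suc i) - S i)"
    by (rule summable_LIMSEQ)
  then obtain s where s: "S \<longlonglongrightarrow> s" by (simp add: sum_lessThan_telescope S0)
  have "(\<lambda>n. S (Suc n)) \<longlonglongrightarrow> (1/2) *\<^sub>R (b + s * s)"
    unfolding SS by (intro tendsto_intros s)
  then have "s = (1/2) *\<^sub>R (b + s * s)"
    using LIMSEQ_Suc[OF s] LIMSEQ_unique by blast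
  then have "s + s = (1/2) *\<^sub>R (b + s * s) + (1/2) *\<^sub>R (b + s * s)" by simp
  also have "\<dots> = b + s * s" by (simp flip: scaleR_add_left)
  finally have eq: "s + s = b + s * s" .
  have le: "norm s \<le> norm b"
    using LIMSEQ_le_const2[OF tendsto_norm[OF s], of "norm b"] S_le t_le by (meson order_trans)
  have sa: "s\<^sup>\<star> = s" if "b\<^sup>\<star> = b"
  proof -
    have "(S n)\<^sup>\<star> = S n" for n by (induction n) (simp_all add: S0 SS that)
    then show ?thesis using tendsto_cs_star[OF s] s LIMSEQ_unique by simp
  qed
  have "z * s = s * z" if "z * b = b * z" for z
  proof -
    have "(\<lambda>n. z * S n) \<longlonglongrightarrow> z * s" "(\<lambda>n. S n * z) \<longlonglongrightarrow> s * z" by (intro tendsto_intros s)+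
    then show ?thesis using comm[OF that] LIMSEQ_unique by simp
  qed
  with le eq sa show ?thesis by (rule that)
qed

lemma neumann_series:
  fixes d :: "'a::{real_normed_algebra_1, banach}"
  assumes "norm d < 1"
  shows "summable (\<lambda>n. d ^ n)" and "(1 - d) * (\<Sum>n. d ^ n) = 1"
proof -
  show sm: "summable (\<lambda>n. d ^ n)"
    by (rule summable_comparison_test'[of "\<lambda>n. norm d ^ n" 0])
      (use assms in \<open>simp_all add: summable_geometric norm_power_ineq\<close>)
  have "(\<lambda>n. 1 - d ^ n) \<longlonglongrightarrow> 1 - 0" by (intro tendsto_intros summable_LIMSEQ_zero sm)
  moreover have "(1 - d) * (\<Sum>i<n. d ^ i) + d ^ n = 1" for n
    by (induction n) (simp_all add: distrib_left left_diff_distrib)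
  then have "1 - d ^ n = (1 - d) * (\<Sum>i<n. d ^ i)" for n
    by (metis add_diff_cancel_right')
  ultimately have "(1 - d) * (\<Sum>n. d ^ n) = 1 - 0"
    using tendsto_mult_left[OF summable_LIMSEQ[OF sm], of "1 - d"] LIMSEQ_unique by force
  then show "(1 - d) * (\<Sum>n. d ^ n) = 1" by simp
qed

text \<open>The root \<open>1 - s\<close> of \<open>1 - b\<close> is inverted by the Neumann series
  in \<open>s\<close>, since \<open>norm s \<le> norm b < 1\<close>. The distance from 1 comes from
  \<open>c - 1 = s * c\<close>; commutation passes to the limit of the partial sums.\<close>

lemma inverse_sqrt_one_minus:
  fixes b :: "'a::cstar_algebra"
  assumes "norm b < 1" "b\<^sup>\<star> = b"
  obtains c where "c\<^sup>\<star> = c" "c * (1 - b) * c = 1" "norm (c - 1) \<le> norm b / (1 - norm b)"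
    "\<And>z. z * b = b * z \<Longrightarrow> z * c = c * z"
proof -
  obtain s where s: "norm s \<le> norm b" "s + s = b + s * s" "b\<^sup>\<star> = b \<Longrightarrow> s\<^sup>\<star> = s"
    "\<And>z. z * b = b * z \<Longrightarrow> z * s = s * z"
    using sqrt_one_minus[OF less_imp_le[OF assms(1)]] by blast
  have ss: "s\<^sup>\<star> = s" using s(3) assms(2) .
  have s1: "norm s < 1" using s(1) assms(1) by simp
  define c where "c = (\<Sum>n. s ^ n)"
  have c_lim: "(\<lambda>n. \<Sum>i<n. s ^ i) \<longlonglongrightarrow> c"
    unfolding c_def by (rule summable_LIMSEQ[OF neumann_series(1)[OF s1]])
  have inv1: "(1 - s) * c = 1" unfolding c_def by (rule neumann_series(2)[OF s1])
  have comm: "z * c = c * z" if "z * b = b * z" for z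
  proof -
    have zs: "z * s ^ n = s ^ n * z" for n
      by (induction n) (simp_all add: mult.assoc, metis mult.assoc s(4) that)
    have "(\<lambda>n. \<Sum>i<n. s ^ i * z) \<longlonglongrightarrow> c * z" "(\<lambda>n. \<Sum>i<n. s ^ i * z) \<longlonglongrightarrow> z * c"
      using tendsto_mult_right[OF c_lim, of z] tendsto_mult_left[OF c_lim, of z]
      by (simp_all add: sum_distrib_right sum_distrib_left zs)
    then show ?thesis using LIMSEQ_unique by blast
  qed
  have "b * s = s * b" using s(4) by simp
  then have "s * c = c * s" using comm[of s] by simp
  then have inv2: "c * (1 - s) = 1" using inv1 by (simp add: algebra_simps)
  have sa: "c\<^sup>\<star> = c"
  proof -
    have "c\<^sup>\<star> * (1 - s) = 1" using arg_cong[OF inv1, of cs_star] ss by simp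
    then show ?thesis using inv1 by (metis mult.assoc mult_1_left mult.right_neutral)
  qed
  have "1 - b = (1 - s) * (1 - s)" using s(2) by (simp add: algebra_simps)
  then have eq: "c * (1 - b) * c = 1"
    using inv1 inv2 by (metis mult.assoc mult_1_left)
  have "c - 1 = s * c" using inv1 by (simp add: algebra_simps)
  have "norm c \<le> 1 / (1 - norm s)"
  proof -
    have "norm c \<le> norm (s * c) + 1"
      using norm_triangle_ineq[of "s * c" "1"] \<open>c - 1 = s * c\<close> by (simp add: algebra_simps)
    then have "norm c \<le> norm s * norm c + 1" using norm_mult_ineq[of s c] by linarith
    then show ?thesis using s1 by (simp add: field_simps)
  qed
  then have "norm (c - 1) \<le> norm s * (1 / (1 - norm s))"
    unfolding \<open>c - 1 = s * c\<close>
    using norm_mult_ineq[of s c] mult_left_mono[of "norm c" "1 / (1 - norm s)" "norm s"] by simp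
  also have "\<dots> \<le> norm b * (1 / (1 - norm b))"
    using s(1) assms(1) by (intro mult_mono frac_le) auto
  finally have "norm (c - 1) \<le> norm b / (1 - norm b)" by simp
  with sa eq show ?thesis using comm by (rule that)
qed

text \<open>Positivity without spectra: the ball of radius \<open>t\<close> around \<open>t\<close>
  meets the self-adjoint elements in positive ones. In this form sums are covered by the triangle
  inequality. Agreement with the form \<open>x\<^sup>\<star> * x\<close> is the content of
  \<open>pos_sqrt\<close> and \<open>pos_star_mult\<close>.\<close>

definition pos :: "'a::cstar_algebra \<Rightarrow> bool" where
  "pos a \<longleftrightarrow> a\<^sup>\<star> = a \<and> (\<exists>t. norm (of_real t - a) \<le> t)"

lemma pos_zero: "pos 0"
  by (auto simp: pos_def intro: exI[of _ 0])

lemma pos_add: "pos a \<Longrightarrow> pos b \<Longrightarrow> pos (a + b)"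
proof -
  assume "pos a" "pos b"
  then obtain t u where *: "norm (of_real t - a) \<le> t" "norm (of_real u - b) \<le> u"
    and sa: "a\<^sup>\<star> = a" "b\<^sup>\<star> = b" by (auto simp: pos_def)
  have "norm ((of_real t - a) + (of_real u - b)) \<le> t + u" using * by (rule norm_triangle_mono)
  then have "norm (of_real (t + u) - (a + b)) \<le> t + u" by (simp add: algebra_simps)
  then show ?thesis using sa unfolding pos_def by (metis cs_star_add)
qed

lemma pos_scaleR: 
  assumes "pos a" "r \<ge> 0" 
  shows "pos (r *\<^sub>R a)"
proof -
  from assms(1) obtain t where *: "norm (of_real t - a) \<le> t" and sa: "a\<^sup>\<star> = a" by (auto simp: pos_def)
  have "norm (r *\<^sub>R (of_real t - a)) \<le> r * t" using * assms(2) by (simp add: mult_left_mono)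
  moreover have "r *\<^sub>R (of_real t - a) = of_real (r * t) - r *\<^sub>R a"
    by (simp add: of_real_def scaleR_diff_right)
  ultimately have "norm (of_real (r * t) - r *\<^sub>R a) \<le> r * t" by simp
  then show ?thesis unfolding pos_def using sa cs_star_scaleR by metis
qed

lemma pos_sum: "(\<And>i. i \<in> I \<Longrightarrow> pos (f i)) \<Longrightarrow> pos (\<Sum>i\<in>I. f i)"
  by (induction I rule: infinite_finite_induct) (auto simp: pos_zero pos_add)

lemma norm_two_mult: "norm (2 * x) = 2 * norm x" for x :: "'a::real_normed_algebra_1"
  using norm_scaleR[of 2 x] by (simp add: scaleR_conv_of_real)

text \<open>The double angle formula: with h as a cosine, h + \<i> sqrt(1 - h^2) has norm 1, and 2
  h^2 - 1 is the mean of its square and the square of its adjoint.\<close>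

lemma norm_two_square_minus_one:
  fixes h :: "'a::cstar_algebra"
  assumes h: "h\<^sup>\<star> = h" and le: "norm h \<le> 1"
  shows "norm (2 * (h * h) - 1) \<le> 1"
proof -
  have "norm (h * h) \<le> 1"
    using le by (simp add: norm_selfadjoint_square[OF h] power_le_one)
  then obtain s where s: "s + s = h * h + s * s" "(h * h)\<^sup>\<star> = h * h \<Longrightarrow> s\<^sup>\<star> = s"
    "\<And>z. z * (h * h) = h * h * z \<Longrightarrow> z * s = s * z"
    using sqrt_one_minus[of "h * h"] by blast
  define k where "k = 1 - s"
  have k: "k\<^sup>\<star> = k" "h * k = k * h" "k * k = 1 - h * h"
    using s(1,2) s(3)[of h] h by (auto simp: k_def algebra_simps)
  define J where "J = cs_scale \<i> k"
  have J: "J\<^sup>\<star> = - J" "h * J = J * h" "J * J = h * h - 1"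
    unfolding J_def by (simp_all add: cs_star_scale_i cs_scale_i_mult k cs_scale_i_commute)
  have "(h + J)\<^sup>\<star> * (h + J) = 1" using h J by (simp add: algebra_simps)
  then have n1: "norm (h + J) = 1" using cs_cstar_identity[of "h + J"]
    by (simp add: power2_eq_1_iff) (smt (verit) norm_ge_zero)
  then have n2: "norm (h - J) = 1" using norm_cs_star[of "h + J"] h J by simp
  have "(h + J) * (h + J) + (h - J) * (h - J) = 2 * (2 * (h * h) - 1)"
    using J(2,3) unfolding mult_2 by (simp add: distrib_left distrib_right left_diff_distrib right_diff_distrib)
  moreover have "norm ((h + J) * (h + J) + (h - J) * (h - J)) \<le> 1 + 1"
    by (rule norm_triangle_mono) (metis n1 n2 norm_mult_ineq mult_1_left)+
  ultimately have "norm (2 * (2 * (h * h) - 1)) \<le> 1 + 1" by metis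
  then show ?thesis unfolding norm_two_mult by simp
qed

text \<open>The preceding bound rescaled: h^2 lies between 0 and its norm, so its distance from the
  midpoint is at most half the norm.\<close>

lemma norm_square_minus_half:
  fixes h :: "'a::cstar_algebra"
  assumes h: "h\<^sup>\<star> = h"
  shows "norm (2 * (h * h) - of_real ((norm h)\<^sup>2)) \<le> (norm h)\<^sup>2"
proof (cases "h = 0")
  case False
  define g where "g = (1 / norm h) *\<^sub>R h"
  have "norm (2 * (g * g) - 1) \<le> 1"
    by (rule norm_two_square_minus_one) (use h False in \<open>auto simp: g_def\<close>)
  then have "(norm h)\<^sup>2 * norm (2 * (g * g) - 1) \<le> (norm h)\<^sup>2 * 1" by (intro mult_left_mono) auto
  then have "norm ((norm h)\<^sup>2 *\<^sub>R (2 * (g * g) - 1)) \<le> (norm h)\<^sup>2" by simp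
  also have "(norm h)\<^sup>2 *\<^sub>R (2 * (g * g) - 1) = 2 * (h * h) - of_real ((norm h)\<^sup>2)"
    using False by (simp add: g_def scaleR_diff_right of_real_def power2_eq_square field_simps)
  finally show ?thesis .
qed simp

lemma pos_square:
  fixes h :: "'a::cstar_algebra"
  assumes h: "h\<^sup>\<star> = h"
  shows "pos (h * h)"
proof -
  have "norm (of_real ((norm h)\<^sup>2) - 2 * (h * h)) \<le> (norm h)\<^sup>2"
    using norm_square_minus_half[OF h] by (simp add: norm_minus_commute)
  moreover have "(2 * (h * h))\<^sup>\<star> = 2 * (h * h)" using h by (simp add: mult_2)
  ultimately have "pos (2 * (h * h))" unfolding pos_def by blast
  then have "pos ((1/2) *\<^sub>R (2 * (h * h)))" by (rule pos_scaleR) simp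
  then show ?thesis by (simp add: mult_2 flip: scaleR_add_left scaleR_add_right)
qed

text \<open>Dividing by the witness \<open>t\<close> turns \<open>a\<close> into
  \<open>1 - b\<close> with \<open>norm b \<le> 1\<close>, which is where the root iteration
  applies; \<open>t = 0\<close> forces \<open>a = 0\<close>.\<close>

lemma pos_sqrt:
  fixes a :: "'a::cstar_algebra"
  assumes "pos a"
  obtains k where "pos k" "k\<^sup>\<star> = k" "k * k = a" "\<And>z. z * a = a * z \<Longrightarrow> z * k = k * z"
proof -
  from assms obtain t where t: "norm (of_real t - a) \<le> t" and sa: "a\<^sup>\<star> = a" by (auto simp: pos_def)
  show ?thesis
  proof (cases "t = 0")
    case True
    with t have "a = 0" by simp
    then show ?thesis using that[of 0] pos_zero by simp
  next
    case False
    with t have tpos: "t > 0" by (smt (verit) norm_ge_zero)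
    define b where "b = 1 - (1 / t) *\<^sub>R a"
    have "of_real t - a = t *\<^sub>R b" using tpos by (simp add: b_def scaleR_diff_right of_real_def)
    then have "norm b \<le> 1" using t tpos by simp
    then obtain s where s: "norm s \<le> norm b" "s + s = b + s * s" "b\<^sup>\<star> = b \<Longrightarrow> s\<^sup>\<star> = s"
      "\<And>z. z * b = b * z \<Longrightarrow> z * s = s * z"
      using sqrt_one_minus[of b] by blast
    have "b\<^sup>\<star> = b" using sa by (simp add: b_def)
    define k where "k = sqrt t *\<^sub>R (1 - s)"
    have "pos (1 - s)" unfolding pos_def using s(1) s(3)[OF \<open>b\<^sup>\<star> = b\<close>] \<open>norm b \<le> 1\<close>
      by (auto intro: exI[of _ 1])
    then have "pos k" unfolding k_def using tpos by (intro pos_scaleR) auto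
    moreover have "k\<^sup>\<star> = k" using s(3)[OF \<open>b\<^sup>\<star> = b\<close>] by (simp add: k_def)
    moreover have "(1 - s) * (1 - s) = 1 - b" using s(2) by (simp add: algebra_simps)
    then have "k * k = a" using tpos by (simp add: k_def b_def)
    moreover have "z * k = k * z" if "z * a = a * z" for z
      using s(4)[of z] that by (simp add: k_def b_def algebra_simps)
    ultimately show ?thesis by (rule that)
  qed
qed

lemma pos_norm_half:
  fixes a :: "'a::cstar_algebra"
  assumes "pos a"
  shows "norm (2 * a - of_real (norm a)) \<le> norm a"
proof -
  obtain k where k: "k\<^sup>\<star> = k" "k * k = a" using pos_sqrt[OF assms] by blast
  show ?thesis using norm_square_minus_half[OF k(1)] norm_selfadjoint_square[OF k(1)] k(2) by simp
qed

lemma pos_norm: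
  fixes a :: "'a::cstar_algebra"
  assumes "pos a"
  shows "norm (of_real (norm a) - a) \<le> norm a"
proof -
  have "norm (2 * (of_real (norm a) - a)) = norm (of_real (norm a) - (2 * a - of_real (norm a)))"
    unfolding mult_2 by (simp add: algebra_simps)
  also have "\<dots> \<le> norm a + norm a"
    by (rule norm_triangle_le_diff) (use pos_norm_half[OF assms] in simp)
  finally show ?thesis unfolding norm_two_mult by simp
qed

text \<open>The roots l of a and k of T - a commute, so l + \<i> k has squared norm T. Since l is
  the mean of this element and its adjoint, the norm of l is at most sqrt T.\<close>

lemma norm_le_of_pos:
  fixes a :: "'a::cstar_algebra"
  assumes "pos a" "pos (of_real T - a)" "T \<ge> 0"
  shows "norm a \<le> T"
proof -
  obtain l where l: "l\<^sup>\<star> = l" "l * l = a" using pos_sqrt[OF assms(1)] by blast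
  obtain k where k: "k\<^sup>\<star> = k" "k * k = of_real T - a"
    "\<And>z. z * (of_real T - a) = (of_real T - a) * z \<Longrightarrow> z * k = k * z"
    using pos_sqrt[OF assms(2)] by blast
  have lk: "l * k = k * l"
    by (rule k(3)) (simp add: l(2)[symmetric] algebra_simps of_real_def)
  define J where "J = cs_scale \<i> k"
  have J: "J\<^sup>\<star> = - J" "l * J = J * l" "J * J = - (k * k)"
    unfolding J_def using k(1) lk by (simp_all add: cs_star_scale_i cs_scale_i_mult cs_scale_i_commute)
  have "(l + J)\<^sup>\<star> * (l + J) = of_real T" using l k(1,2) J by (simp add: algebra_simps)
  then have n1: "(norm (l + J))\<^sup>2 = T" using cs_cstar_identity[of "l + J"] assms(3) by simp
  have "norm (l - J) = norm (l + J)" using norm_cs_star[of "l + J"] l J by simp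
  then have "norm ((l + J) + (l - J)) \<le> norm (l + J) + norm (l + J)"
    using norm_triangle_ineq by metis
  moreover have "(l + J) + (l - J) = 2 * l" unfolding mult_2 by simp
  ultimately have "norm l \<le> norm (l + J)" using norm_two_mult[of l] by simp
  then have "(norm l)\<^sup>2 \<le> T" using n1 by (metis norm_ge_zero power_mono)
  then show ?thesis using norm_selfadjoint_square[OF l(1)] l(2) by simp
qed

lemma pos_norm_diff:
  fixes a :: "'a::cstar_algebra"
  assumes "pos a"
  shows "pos (of_real (norm a) - a)"
proof -
  have "norm (of_real (norm a) - 2 * (of_real (norm a) - a)) \<le> norm a"
    using pos_norm_half[OF assms] unfolding mult_2 by (simp add: algebra_simps)
  moreover have "(2 * (of_real (norm a) - a))\<^sup>\<star> = 2 * (of_real (norm a) - a)"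
    using assms by (simp add: pos_def mult_2)
  ultimately have "pos (2 * (of_real (norm a) - a))" unfolding pos_def by blast
  then have "pos ((1/2) *\<^sub>R (2 * (of_real (norm a) - a)))" by (rule pos_scaleR) simp
  moreover have "(1/2) *\<^sub>R (2 * x) = x" for x :: 'a
    by (simp add: mult_2 flip: scaleR_add_left scaleR_add_right)
  ultimately show ?thesis by (simp only:)
qed

lemma norm_le_add_pos:
  fixes a b :: "'a::cstar_algebra"
  assumes "pos a" "pos b"
  shows "norm a \<le> norm (a + b)"
proof (rule norm_le_of_pos[OF assms(1)])
  have "pos (of_real (norm (a + b)) - (a + b) + b)"
    using assms by (intro pos_add pos_norm_diff) auto
  then show "pos (of_real (norm (a + b)) - a)" by simp
qed simp

text \<open>\<open>r\<close> is the absolute value of \<open>h\<close> and \<open>q\<close> its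
  root; \<open>r + h\<close> and \<open>r - h\<close> are twice the positive and negative
  parts.\<close>

lemma absolute_value:
  fixes h :: "'a::cstar_algebra"
  assumes h: "h\<^sup>\<star> = h"
  obtains r q where "pos r" "r\<^sup>\<star> = r" "r * r = h * h" "r * h = h * r"
    "q\<^sup>\<star> = q" "q * q = r" "q * h = h * q" "\<And>z. z * h = h * z \<Longrightarrow> z * r = r * z"
proof -
  obtain r where r: "pos r" "r\<^sup>\<star> = r" "r * r = h * h" "\<And>z. z * (h * h) = h * h * z \<Longrightarrow> z * r = r * z"
    using pos_sqrt[OF pos_square[OF h]] by blast
  obtain q where q: "q\<^sup>\<star> = q" "q * q = r" "\<And>z. z * r = r * z \<Longrightarrow> z * q = q * z"
    using pos_sqrt[OF r(1)] by blast
  have zr: "z * r = r * z" if "z * h = h * z" for z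
    by (rule r(4)) (metis mult.assoc that)
  then have "h * r = r * h" by simp
  show ?thesis
  proof (rule that[of r q])
    show "q * h = h * q" using q(3)[of h] \<open>h * r = r * h\<close> by simp
  qed (fact r(1) r(2) r(3) q(1) q(2) zr \<open>h * r = r * h\<close>[symmetric])+
qed

text \<open>If \<open>a = x\<^sup>\<star> x\<close> had a nonzero negative part, then for \<open>y = x a\<^sub>-\<close> both \<open>- y\<^sup>\<star> y\<close> and \<open>g = y y\<^sup>\<star>\<close>
  would be positive of norm \<open>t > 0\<close>; but \<open>g (t + g) = y (t + y\<^sup>\<star> y) y\<^sup>\<star>\<close> has norm at most \<open>t\<^sup>2\<close>,
  whereas it should have norm \<open>2 t\<^sup>2\<close>.\<close>

lemma pos_star_mult:
  fixes x :: "'a::cstar_algebra"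
  shows "pos (x\<^sup>\<star> * x)"
proof -
  define a where "a = x\<^sup>\<star> * x"
  have a: "a\<^sup>\<star> = a" by (simp add: a_def)
  obtain r q where r: "pos r" "r\<^sup>\<star> = r" "r * r = a * a" "r * a = a * r"
    "q\<^sup>\<star> = q" "q * q = r" "q * a = a * q"
    using absolute_value[OF a] by blast
  \<comment> \<open>Twice the negative part of \<open>a\<close>. The product \<open>q * m\<close>
    will be a self-adjoint root of \<open>- (y\<^sup>\<star> * y)\<close>.\<close>
  define m where "m = r - a"
  define y where "y = x * m"
  have m: "m\<^sup>\<star> = m" using r a by (simp add: m_def)
  have qr: "q * r = r * q" using r(6) by (metis mult.assoc)
  have qm: "q * m = m * q" using r qr by (simp add: m_def algebra_simps)
  have rm: "r * m = m * r" using r by (simp add: m_def algebra_simps)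
  have "m * m = 2 * (r * m)" using r unfolding mult_2 by (simp add: m_def algebra_simps)
  have am: "a * m + r * m = 0" using r by (simp add: m_def algebra_simps)
  have yy: "y\<^sup>\<star> * y = - ((q * m) * (q * m))"
  proof -
    have "y\<^sup>\<star> * y = m * (a * m)" by (simp add: y_def a_def m mult.assoc)
    also have "\<dots> = - (m * (r * m))" using am by (metis add_eq_0_iff2 mult_minus_right)
    also have "m * (r * m) = (q * m) * (q * m)" by (metis mult.assoc qm r(6))
    finally show ?thesis .
  qed
  have "pos ((q * m) * (q * m))" by (rule pos_square) (simp add: r m qm)
  then have neg: "pos (- (y\<^sup>\<star> * y))" by (simp add: yy)
  \<comment> \<open>Up to sign, \<open>b\<close> and \<open>c\<close> are twice the real and
    imaginary parts of \<open>y\<close>. Their squares add up to twice the sum of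
    \<open>y * y\<^sup>\<star>\<close> and \<open>y\<^sup>\<star> * y\<close>, so positivity of
    \<open>- (y\<^sup>\<star> * y)\<close> yields that of
    \<open>y * y\<^sup>\<star>\<close>.\<close>
  define b where "b = y + y\<^sup>\<star>"
  define c where "c = cs_scale \<i> (y - y\<^sup>\<star>)"
  have b: "b\<^sup>\<star> = b" by (simp add: b_def add.commute)
  have sc_diff: "cs_scale u (z - w) = cs_scale u z - cs_scale u w" for u and z w :: 'a
    by (metis add_diff_cancel cs_scale_add_right diff_add_cancel)
  have c: "c\<^sup>\<star> = c" by (simp add: c_def cs_star_scale_i sc_diff)
  have cc: "c * c = - ((y - y\<^sup>\<star>) * (y - y\<^sup>\<star>))"
    by (simp add: c_def cs_scale_i_mult)
  have "pos (b * b + c * c + 2 *\<^sub>R (- (y\<^sup>\<star> * y)))"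
    by (intro pos_add pos_square b c pos_scaleR neg) simp
  also have "b * b + c * c + 2 *\<^sub>R (- (y\<^sup>\<star> * y)) = 2 *\<^sub>R (y * y\<^sup>\<star>)"
    by (simp add: cc b_def scaleR_2 algebra_simps)
  finally have "pos ((1/2) *\<^sub>R (2 *\<^sub>R (y * y\<^sup>\<star>)))" by (rule pos_scaleR) simp
  then have posg: "pos (y * y\<^sup>\<star>)" by simp
  define t where "t = (norm y)\<^sup>2"
  define g where "g = y * y\<^sup>\<star>"
  have ng: "norm g = t" using cs_cstar_identity[of "y\<^sup>\<star>"] by (simp add: g_def t_def)
  have "norm (of_real t - (- (y\<^sup>\<star> * y))) \<le> t"
    using pos_norm[OF neg] by (simp add: cs_cstar_identity t_def)
  then have n1: "norm (of_real t + y\<^sup>\<star> * y) \<le> t" by simp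
  have "g * (of_real t + g) = y * (of_real t + y\<^sup>\<star> * y) * y\<^sup>\<star>"
    by (simp add: g_def algebra_simps of_real_def)
  then have "norm (g * (of_real t + g)) \<le> norm (y * (of_real t + y\<^sup>\<star> * y)) * norm y"
    by (metis norm_mult_ineq norm_cs_star)
  also have "\<dots> \<le> (norm y * norm (of_real t + y\<^sup>\<star> * y)) * norm y"
    by (intro mult_right_mono norm_mult_ineq) auto
  also have "\<dots> \<le> (norm y * t) * norm y"
    using n1 by (intro mult_right_mono mult_left_mono) auto
  finally have n2: "norm (g * (of_real t + g)) \<le> t * t" by (simp add: t_def power2_eq_square mult_ac)
  \<comment> \<open>Completing the square: f^2 = 4 g (t + g) + t^2 has norm at most 5 t^2, while f
    has norm at least 3 t.\<close>
  define f where "f = 2 * g + of_real t"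
  have f: "f\<^sup>\<star> = f" by (simp add: f_def g_def mult_2)
  have four: "4 *\<^sub>R z = z + z + z + z" for z :: 'a
    using scaleR_left_distrib[of 2 2 z] by (simp add: scaleR_2 add.assoc)
  have "f * f = 4 *\<^sub>R (g * (of_real t + g)) + of_real (t * t)"
    unfolding four f_def mult_2 by (simp add: algebra_simps of_real_def)
  then have "norm (f * f) \<le> norm (4 *\<^sub>R (g * (of_real t + g))) + norm (of_real (t * t) :: 'a)"
    using norm_triangle_ineq by metis
  also have "\<dots> \<le> 4 * (t * t) + t * t"
    using n2 unfolding norm_scaleR norm_of_real by simp
  finally have "(norm f)\<^sup>2 \<le> 5 * (t * t)" using norm_selfadjoint_square[OF f] by simp
  moreover have "3 * t \<le> norm f"
  proof -
    have "f - (of_real t - 2 * g) = 4 *\<^sub>R g" unfolding four f_def mult_2 by (simp add: algebra_simps)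
    then have "norm (4 *\<^sub>R g) \<le> norm f + norm (of_real t - 2 * g)" by (metis norm_triangle_ineq4)
    moreover have "norm (of_real t - 2 * g) \<le> t"
      using pos_norm_half[OF posg] ng by (simp add: g_def norm_minus_commute)
    moreover have "norm (4 *\<^sub>R g) = 4 * t" using ng by simp
    ultimately show ?thesis by simp
  qed
  moreover have "t \<ge> 0" by (simp add: t_def)
  ultimately have "t = 0"
    using power_mono[of "3 * t" "norm f" 2] by (simp add: power2_eq_square) (smt (verit) mult_nonneg_nonneg mult_eq_0_iff)
  then have "y = 0" by (simp add: t_def)
  then have "(q * m)\<^sup>\<star> * (q * m) = 0" using yy r m qm by simp
  then have "q * m = 0" unfolding cs_star_mult_eq_0 .
  then have "r * m = 0" by (metis mult.assoc mult_zero_right r(6))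
  then have "m\<^sup>\<star> * m = 0" using \<open>m * m = 2 * (r * m)\<close> m by simp
  then have "a = r" unfolding cs_star_mult_eq_0 by (simp add: m_def)
  then show ?thesis using r(1) by (simp add: a_def)
qed

lemma pos_norm_diff_star_mult:
  fixes x :: "'a::cstar_algebra"
  obtains k where "k\<^sup>\<star> = k" "k * k = of_real ((norm x)\<^sup>2) - x\<^sup>\<star> * x"
  using pos_sqrt[OF pos_norm_diff[OF pos_star_mult[of x]]] that unfolding cs_cstar_identity by blast

text \<open>A norm bound expressed by an algebraic identity is preserved by every unital map
  respecting sums, products and adjoints. \<open>pos_norm_diff_star_mult\<close> supplies such an
  identity for every element, with a single square.\<close>

lemma norm_square_le_certificate:
  fixes x :: "'a::cstar_algebra"
  assumes "of_real T - x\<^sup>\<star> * x = (\<Sum>i\<in>I. (z i)\<^sup>\<star> * z i)" "T \<ge> 0"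
  shows "(norm x)\<^sup>2 \<le> T"
proof -
  have "norm (x\<^sup>\<star> * x) \<le> T"
    by (rule norm_le_of_pos) (auto simp: assms intro!: pos_star_mult pos_sum)
  then show ?thesis by (simp add: cs_cstar_identity)
qed

subsection \<open>Automorphisms\<close>

context
  fixes \<alpha> :: "'a::cstar_algebra \<Rightarrow> 'a"
  assumes \<alpha>: "cs_automorphism \<alpha>"
begin

lemma cs_automorphism_add: "\<alpha> (x + y) = \<alpha> x + \<alpha> y"
  and cs_automorphism_mult: "\<alpha> (x * y) = \<alpha> x * \<alpha> y"
  and cs_automorphism_star: "\<alpha> (x\<^sup>\<star>) = (\<alpha> x)\<^sup>\<star>"
  and cs_automorphism_bij: "bij \<alpha>"
  using \<alpha> by (auto simp: cs_automorphism_def)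

lemma cs_automorphism_scaleR: "\<alpha> (r *\<^sub>R x) = r *\<^sub>R \<alpha> x"
  using \<alpha> by (simp add: cs_automorphism_def flip: cs_scale_of_real)

lemma cs_automorphism_zero: "\<alpha> 0 = 0"
  using cs_automorphism_scaleR[of 0 0] by simp

lemma cs_automorphism_diff: "\<alpha> (x - y) = \<alpha> x - \<alpha> y"
  using cs_automorphism_add[of "x - y" y] by simp

lemma cs_automorphism_one: "\<alpha> 1 = 1"
proof -
  obtain y where "\<alpha> y = 1" using cs_automorphism_bij by (metis bij_pointE)
  then show ?thesis using cs_automorphism_mult[of 1 y] by simp
qed

lemma cs_automorphism_inv: "cs_automorphism (inv \<alpha>)"
proof -
  have "inj \<alpha>" "surj \<alpha>" using cs_automorphism_bij by (auto simp: bij_def)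
  note iv = surj_f_inv_f[OF \<open>surj \<alpha>\<close>] inv_f_f[OF \<open>inj \<alpha>\<close>]
  have "\<alpha> (cs_scale c x) = cs_scale c (\<alpha> x)" for c x using \<alpha> by (simp add: cs_automorphism_def)
  then show ?thesis unfolding cs_automorphism_def
    using bij_imp_bij_inv[OF cs_automorphism_bij]
    by (metis iv cs_automorphism_add cs_automorphism_mult cs_automorphism_star)
qed

text \<open>Continuity is not part of the definition of an automorphism; it follows by applying
  \<alpha> to the identity that certifies the norm of \<open>x\<close>.\<close>

lemma cs_automorphism_norm_le: "norm (\<alpha> x) \<le> norm x"
proof -
  obtain k where k: "k\<^sup>\<star> = k" "k * k = of_real ((norm x)\<^sup>2) - x\<^sup>\<star> * x"
    by (rule pos_norm_diff_star_mult)
  have "\<alpha> (k * k) = \<alpha> (of_real ((norm x)\<^sup>2) - x\<^sup>\<star> * x)" by (simp only: k(2))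
  then have "of_real ((norm x)\<^sup>2) - (\<alpha> x)\<^sup>\<star> * \<alpha> x = (\<Sum>i\<in>{()}. (\<alpha> k)\<^sup>\<star> * \<alpha> k)"
    using k(1) by (simp add: cs_automorphism_diff cs_automorphism_mult of_real_def
        cs_automorphism_scaleR cs_automorphism_one flip: cs_automorphism_star)
  then have "(norm (\<alpha> x))\<^sup>2 \<le> (norm x)\<^sup>2" by (rule norm_square_le_certificate) simp
  then show ?thesis by (simp add: power2_le_iff_abs_le)
qed

end

lemma cs_automorphism_norm:
  assumes "cs_automorphism \<alpha>"
  shows "norm (\<alpha> x) = norm x"
proof (rule antisym)
  have "inv \<alpha> (\<alpha> x) = x" using cs_automorphism_bij[OF assms] by (simp add: bij_def)
  then show "norm x \<le> norm (\<alpha> x)"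
    using cs_automorphism_norm_le[OF cs_automorphism_inv[OF assms], of "\<alpha> x"] by simp
qed (rule cs_automorphism_norm_le[OF assms])

lemma cs_automorphism_comp:
  "cs_automorphism \<alpha> \<Longrightarrow> cs_automorphism \<beta> \<Longrightarrow> cs_automorphism (\<alpha> \<circ> \<beta>)"
  by (auto simp: cs_automorphism_def bij_comp)

lemma cs_automorphism_id: "cs_automorphism id"
  by (auto simp: cs_automorphism_def)

lemma cs_automorphism_funpow: "cs_automorphism \<alpha> \<Longrightarrow> cs_automorphism (\<alpha> ^^ n)"
  by (induction n) (auto intro: cs_automorphism_comp cs_automorphism_id simp flip: id_def)

lemma norm_cs_unitary_mult [simp]:
  fixes x :: "'a::cstar_algebra"
  assumes "cs_unitary u"
  shows "norm (u * x) = norm x" "norm (x * u) = norm x"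
proof -
  have "(norm (u * x))\<^sup>2 = (norm x)\<^sup>2" if "u\<^sup>\<star> * u = 1" for u x :: 'a
  proof -
    have "(u * x)\<^sup>\<star> * (u * x) = x\<^sup>\<star> * (u\<^sup>\<star> * u) * x" by (simp add: mult.assoc)
    then show ?thesis by (simp only: that flip: cs_cstar_identity) simp
  qed
  then have *: "norm (u * x) = norm x" if "u\<^sup>\<star> * u = 1" for u x :: 'a
    using that by (simp add: power2_eq_iff_nonneg)
  show "norm (u * x) = norm x" using assms by (intro *) (simp add: cs_unitary_def)
  have "norm (u\<^sup>\<star> * x\<^sup>\<star>) = norm (x\<^sup>\<star>)" using assms by (intro *) (simp add: cs_unitary_def)
  then show "norm (x * u) = norm x" by (simp flip: cs_star_mult)
qed

lemma cs_unitary_star: "cs_unitary u \<Longrightarrow> cs_unitary (u\<^sup>\<star>)"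
  by (simp add: cs_unitary_def)

lemma cs_unitary_mult: "cs_unitary u \<Longrightarrow> cs_unitary v \<Longrightarrow> cs_unitary (u * v)"
proof -
  assume uv: "cs_unitary u" "cs_unitary v"
  have "(u * v)\<^sup>\<star> * (u * v) = v\<^sup>\<star> * (u\<^sup>\<star> * u) * v" "(u * v) * (u * v)\<^sup>\<star> = u * (v * v\<^sup>\<star>) * u\<^sup>\<star>"
    by (simp_all add: mult.assoc)
  then show ?thesis using uv by (simp only: cs_unitary_def) simp
qed

text \<open>The products \<open>u n * v n\<close> with equal indices already work, because
  conjugation by \<open>u n\<close> is isometric and does not enlarge the error made by
  \<open>v n\<close>.\<close>

lemma cs_approx_inner_comp:
  assumes "cs_approx_inner \<alpha>" "cs_approx_inner \<beta>"
  shows "cs_approx_inner (\<alpha> \<circ> \<beta>)"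
proof -
  from assms obtain u v where u: "\<And>n. cs_unitary (u n)" "\<And>x. (\<lambda>n. u n * x * (u n)\<^sup>\<star>) \<longlonglongrightarrow> \<alpha> x"
    and v: "\<And>n. cs_unitary (v n)" "\<And>x. (\<lambda>n. v n * x * (v n)\<^sup>\<star>) \<longlonglongrightarrow> \<beta> x"
    unfolding cs_approx_inner_def by metis
  have "(\<lambda>n. (u n * v n) * x * (u n * v n)\<^sup>\<star>) \<longlonglongrightarrow> \<alpha> (\<beta> x)" for x
  proof -
    have "(\<lambda>n. norm (v n * x * (v n)\<^sup>\<star> - \<beta> x)) \<longlonglongrightarrow> 0"
      using v(2) LIM_zero tendsto_norm_zero by blast
    moreover have "norm (u n * (v n * x * (v n)\<^sup>\<star> - \<beta> x) * (u n)\<^sup>\<star>) = norm (v n * x * (v n)\<^sup>\<star> - \<beta> x)" for n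
      using u(1)[of n] cs_unitary_star[OF u(1)[of n]] by simp
    ultimately have "(\<lambda>n. norm (u n * (v n * x * (v n)\<^sup>\<star> - \<beta> x) * (u n)\<^sup>\<star>)) \<longlonglongrightarrow> 0"
      by (simp only:)
    then have "(\<lambda>n. u n * (v n * x * (v n)\<^sup>\<star> - \<beta> x) * (u n)\<^sup>\<star>) \<longlonglongrightarrow> 0"
      by (rule tendsto_norm_zero_cancel)
    from tendsto_add[OF this u(2)[of "\<beta> x"]] show ?thesis by (simp add: algebra_simps)
  qed
  then show ?thesis unfolding cs_approx_inner_def using u(1) v(1)
    by (intro exI[of _ "\<lambda>n. u n * v n"]) (auto intro: cs_unitary_mult)
qed

lemma cs_approx_inner_funpow:
  assumes "cs_approx_inner \<alpha>"
  shows "cs_approx_inner (\<alpha> ^^ Suc n)"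
proof (induction n)
  case (Suc n)
  then show ?case using cs_approx_inner_comp[OF assms] by (subst funpow.simps(2)) blast
qed (simp add: assms)

subsection \<open>Projections and comparison\<close>

lemma cs_projection_zero [simp]: "cs_projection 0"
  by (simp add: cs_projection_def)

lemma cs_projection_complement: "cs_projection p \<Longrightarrow> cs_projection (1 - p)"
  by (simp add: cs_projection_def algebra_simps)

lemma cs_projection_add:
  "cs_projection p \<Longrightarrow> cs_projection q \<Longrightarrow> p * q = 0 \<Longrightarrow> q * p = 0 \<Longrightarrow> cs_projection (p + q)"
  by (simp add: cs_projection_def algebra_simps)

lemma cs_projection_sum:
  assumes "finite I" "\<And>i. i \<in> I \<Longrightarrow> cs_projection (p i)"
    "\<And>i j. i \<in> I \<Longrightarrow> j \<in> I \<Longrightarrow> i \<noteq> j \<Longrightarrow> p i * p j = 0"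
  shows "cs_projection (\<Sum>i\<in>I. p i)"
  using assms
proof (induction I)
  case (insert i I)
  have "p i * (\<Sum>i\<in>I. p i) = 0" "(\<Sum>i\<in>I. p i) * p i = 0"
    using insert by (auto simp: sum_distrib_left sum_distrib_right intro!: sum.neutral)
  with insert show ?case by (auto intro!: cs_projection_add)
qed simp

lemma norm_cs_projection:
  assumes "cs_projection p" 
  shows "norm p = 0 \<or> norm p = 1"
proof -
  have "norm p = norm p * norm p"
    using assms cs_cstar_identity[of p] by (simp add: cs_projection_def power2_eq_square)
  then show ?thesis by (metis mult_cancel_right1)
qed

lemma norm_cs_projection_le: "cs_projection p \<Longrightarrow> norm p \<le> 1"
  using norm_cs_projection[of p] by auto

lemma cs_projection_eq_0: "cs_projection p \<Longrightarrow> norm p < 1 \<Longrightarrow> p = 0"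
  using norm_cs_projection[of p] by auto

text \<open>The projection is \<open>(1 + g) / 2\<close> for the self-adjoint unitary \<open>g\<close> in the polar decomposition of
  \<open>v = 2 A - 1\<close>, and \<open>v\<^sup>2 = 1 - 4 (A - A\<^sup>2)\<close> is close to \<open>1\<close>.\<close>

lemma exists_projection_near:
  fixes A q :: "'a::cstar_algebra"
  assumes q: "cs_projection q" and A: "A\<^sup>\<star> = A" "q * A = A" "A * q = A"
    and le: "norm (A * A - A) \<le> 1 / 8"
  shows "\<exists>f. cs_projection f \<and> q * f = f \<and> f * q = f \<and> norm (f - A) \<le> 8 * norm (A * A - A)"
proof -
  define v where "v = A + A - 1"
  define b where "b = 4 *\<^sub>R (A - A * A)"
  have four: "4 *\<^sub>R z = z + z + z + z" for z :: 'a
    using scaleR_left_distrib[of 2 2 z] by (simp add: scaleR_2 add.assoc)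
  have v: "v\<^sup>\<star> = v" "v * v = 1 - b"
    unfolding v_def b_def four using A by (simp_all add: algebra_simps)
  have bA: "A * b = b * A" "q * b = b * q" unfolding b_def using A
    by (simp_all add: algebra_simps) (metis mult.assoc)
  have nb: "norm b = 4 * norm (A * A - A)" by (simp add: b_def norm_minus_commute)
  then have nb2: "norm b \<le> 1 / 2" using le by simp
  then have nb1: "norm b < 1" by simp
  have "b\<^sup>\<star> = b" using A by (simp add: b_def)
  then obtain c where c: "c\<^sup>\<star> = c" "c * (1 - b) * c = 1" "norm (c - 1) \<le> norm b / (1 - norm b)"
    "\<And>z. z * b = b * z \<Longrightarrow> z * c = c * z"
    using inverse_sqrt_one_minus[OF nb1] by blast
  have vc: "v * c = c * v" by (rule c(4)) (simp add: v_def algebra_simps bA)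
  have qc: "q * c = c * q" by (rule c(4)) (rule bA)
  define g where "g = v * c"
  have g: "g\<^sup>\<star> = g" "g * g = 1" "q * g = g * q"
  proof -
    show "g\<^sup>\<star> = g" by (simp add: g_def c v vc)
    show "g * g = 1" by (metis g_def c(2) mult.assoc v(2) vc)
    have "q * v = v * q" using A by (simp add: v_def algebra_simps)
    then show "q * g = g * q" by (metis g_def mult.assoc qc)
  qed
  define f where "f = (1/2) *\<^sub>R (1 + g)"
  have half: "(1/2) *\<^sub>R (z + z) = z" for z :: 'a by (simp flip: scaleR_2)
  have f: "f\<^sup>\<star> = f" "f * f = f" "q * f = f * q"
  proof -
    show "f\<^sup>\<star> = f" using g by (simp add: f_def)
    show "q * f = f * q" using g by (simp add: f_def algebra_simps)
    have "f * f = (1/2) *\<^sub>R ((1/2) *\<^sub>R ((1 + g) + (1 + g)))"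
      using g(2) by (simp add: f_def algebra_simps)
    then show "f * f = f" unfolding half f_def .
  qed
  have "norm (v * v) \<le> norm (1 :: 'a) + norm b" unfolding v(2) by (rule norm_triangle_ineq4)
  then have "(norm v)\<^sup>2 \<le> 2\<^sup>2" using nb2 norm_selfadjoint_square[OF v(1)] by simp
  then have nv: "norm v \<le> 2" by (rule power2_le_imp_le) simp
  have "norm b / (1 - norm b) \<le> norm b / (1/2)" using nb2 by (intro divide_left_mono) auto
  then have nc: "norm (c - 1) \<le> 8 * norm (A * A - A)" using c(3) nb by simp
  have "A = (1/2) *\<^sub>R (1 + v)" using half[of A] by (simp add: v_def)
  then have fA: "f - A = (1/2) *\<^sub>R (v * (c - 1))"
    unfolding f_def g_def by (simp add: algebra_simps)
  have "norm (f - A) \<le> 1/2 * (norm v * norm (c - 1))"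
    unfolding fA using norm_mult_ineq[of v "c - 1"] by simp
  also have "\<dots> \<le> 1/2 * (2 * norm (c - 1))"
    using nv by (intro mult_left_mono mult_right_mono) auto
  finally have fA_le: "norm (f - A) \<le> 8 * norm (A * A - A)" using nc by simp
  \<comment> \<open>The symmetry was formed in the whole algebra. Cutting by \<open>q\<close>, which
    commutes with \<open>f\<close>, places the projection under \<open>q\<close> at no cost in
    distance from \<open>A\<close>.\<close>
  have "f * q - A = (f - A) * q" using A by (simp add: algebra_simps)
  then have "norm (f * q - A) \<le> norm (f - A) * 1"
    using norm_mult_ineq[of "f - A" q] norm_cs_projection_le[OF q]
      mult_left_mono[of "norm q" 1 "norm (f - A)"] by simp
  then have "norm (f * q - A) \<le> 8 * norm (A * A - A)" using fA_le by simp
  moreover have q': "q\<^sup>\<star> = q" "q * q = q" using q by (simp_all add: cs_projection_def)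
  have "(f * q) * (f * q) = f * (q * f) * q" "q * (f * q) = (q * f) * q"
    by (simp_all only: mult.assoc)
  then have "(f * q) * (f * q) = (f * f) * (q * q)" "q * (f * q) = f * (q * q)"
    unfolding f(3) by (simp_all only: mult.assoc)
  then have "(f * q) * (f * q) = f * q" "q * (f * q) = f * q" by (simp_all only: f(2) q'(2))
  moreover from this have "cs_projection (f * q)" using f(1,3) q'(1) by (simp add: cs_projection_def)
  moreover have "f * q * q = f * q" by (simp add: mult.assoc q')
  ultimately show ?thesis by blast
qed

lemma tendsto_in_closure:
  "f \<longlonglongrightarrow> l \<Longrightarrow> (\<And>n::nat. f n \<in> S) \<Longrightarrow> l \<in> closure S" for l :: "'b::first_countable_topology"
  unfolding closure_sequential by blast

text \<open>This allows the hereditary subalgebra of x to be replaced by the closed right ideal of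
  x, in which the two parts of the remainder can simply be added.\<close>

lemma hered_of_right_ideal:
  fixes x :: "'a::cstar_algebra"
  assumes x: "x\<^sup>\<star> = x" and Y: "Y \<in> closure (range ((*) x))"
  shows "Y * d * Y\<^sup>\<star> \<in> cs_hered x"
proof -
  obtain c where c: "\<And>n::nat. c n \<in> range ((*) x)" "c \<longlonglongrightarrow> Y"
    using Y by (auto simp: closure_sequential)
  have "\<exists>b. \<forall>n. c n = x * b n" using c(1) by (intro choice) blast
  then obtain b where b: "\<And>n. c n = x * b n" by blast
  have "(\<lambda>n. c n * d * (c n)\<^sup>\<star>) \<longlonglongrightarrow> Y * d * Y\<^sup>\<star>" by (intro tendsto_intros c(2))
  moreover have "c n * d * (c n)\<^sup>\<star> \<in> {x * y * x | y. True}" for n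
    by (auto simp: b x mult.assoc intro!: exI[of _ "b n * (d * (b n)\<^sup>\<star>)"])
  ultimately show ?thesis unfolding cs_hered_def by (rule tendsto_in_closure)
qed

text \<open>The compression of \<open>Y\<^sup>\<star> * Y\<close> by \<open>q\<close> is invertible
  in the corner of \<open>q\<close>. Multiplying \<open>Y\<close> on the right by \<open>q\<close>
  and the inverse square root turns approximate equality into an exact one, within the right ideal
  of x.\<close>

lemma cs_subeq_of_near:
  fixes x q Y :: "'a::cstar_algebra"
  assumes x: "x\<^sup>\<star> = x" and q: "cs_projection q" and Y: "Y \<in> closure (range ((*) x))"
    and near: "norm (Y\<^sup>\<star> * Y - q) < 1"
  shows "cs_subeq q x"
proof -
  have q': "q\<^sup>\<star> = q" "q * q = q" using q by (simp_all add: cs_projection_def)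
  define b where "b = q - q * (Y\<^sup>\<star> * Y) * q"
  have "b = - (q * (Y\<^sup>\<star> * Y - q) * q)" using q' by (simp add: b_def algebra_simps)
  then have "norm b \<le> norm (q * (Y\<^sup>\<star> * Y - q)) * norm q" by (simp add: norm_mult_ineq)
  also have "\<dots> \<le> (norm q * norm (Y\<^sup>\<star> * Y - q)) * norm q"
    by (intro mult_right_mono norm_mult_ineq) auto
  also have "\<dots> \<le> (1 * norm (Y\<^sup>\<star> * Y - q)) * 1"
    using norm_cs_projection_le[OF q] by (intro mult_mono) auto
  finally have nb: "norm b < 1" using near by simp
  have "b\<^sup>\<star> = b" by (simp add: b_def q' mult.assoc)
  then obtain c where c: "c\<^sup>\<star> = c" "c * (1 - b) * c = 1" "\<And>z. z * b = b * z \<Longrightarrow> z * c = c * z"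
    using inverse_sqrt_one_minus[OF nb] by blast
  have qb: "q * b = b" "b * q = b"
    by (simp_all add: b_def right_diff_distrib left_diff_distrib q' mult.assoc)
       (simp_all add: q' flip: mult.assoc)
  then have qc: "q * c = c * q" by (intro c(3)) simp
  define Z where "Z = Y * (q * c)"
  have "q * (Y\<^sup>\<star> * Y) * q = q * (1 - b)" by (simp add: b_def q' algebra_simps) (simp add: q' flip: mult.assoc)
  moreover have "Z\<^sup>\<star> * Z = c * (q * (Y\<^sup>\<star> * Y) * q) * c" by (simp add: Z_def c q' mult.assoc)
  ultimately have "Z\<^sup>\<star> * Z = c * (q * (1 - b)) * c" by simp
  also have "\<dots> = q * (c * (1 - b) * c)" using qc by (simp add: mult.assoc) (simp flip: mult.assoc)
  finally have "q = Z\<^sup>\<star> * Z" by (simp add: c)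
  moreover have "Z * Z\<^sup>\<star> = Y * (q * c * (q * c)\<^sup>\<star>) * Y\<^sup>\<star>" by (simp add: Z_def mult.assoc)
  then have "Z * Z\<^sup>\<star> \<in> cs_hered x" using hered_of_right_ideal[OF x Y] by simp
  ultimately show ?thesis unfolding cs_subeq_def by blast
qed

lemma closure_right_ideal:
  fixes x :: "'a::cstar_algebra"
  assumes "z \<in> closure (range ((*) x))"
  shows "z * b \<in> closure (range ((*) x))"
proof -
  obtain c where c: "\<And>n::nat. c n \<in> range ((*) x)" "c \<longlonglongrightarrow> z"
    using assms by (auto simp: closure_sequential)
  have "(\<lambda>n. c n * b) \<longlonglongrightarrow> z * b" by (intro tendsto_intros c(2))
  moreover have "c n * b \<in> range ((*) x)" for n using c(1)[of n] by (auto simp: mult.assoc)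
  ultimately show ?thesis by (rule tendsto_in_closure)
qed

lemma closure_right_ideal_add:
  fixes x :: "'a::cstar_algebra"
  assumes "z \<in> closure (range ((*) x))"
  shows "z + x * b \<in> closure (range ((*) x))"
proof -
  obtain c where c: "\<And>n::nat. c n \<in> range ((*) x)" "c \<longlonglongrightarrow> z"
    using assms by (auto simp: closure_sequential)
  have "(\<lambda>n. c n + x * b) \<longlonglongrightarrow> z + x * b" by (intro tendsto_intros c(2))
  moreover have "c n + x * b \<in> range ((*) x)" for n
    using c(1)[of n] by (auto simp flip: distrib_left)
  ultimately show ?thesis by (rule tendsto_in_closure)
qed

subsection \<open>Simplicity\<close>

lemma sum_lessThan_append:
  "(\<Sum>i<m. f i) + (\<Sum>i<n. g i) = (\<Sum>i<m + n. if i < m then f i else g (i - m))"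
  for f :: "nat \<Rightarrow> 'b::ab_group_add"
proof (induction n)
  case (Suc n)
  then show ?case by (simp add: add.assoc[symmetric])
qed (auto intro: sum.cong)

text \<open>By simplicity the algebraic ideal generated by y is dense, so it contains an element at
  distance less than 1 from 1. That element is invertible, which puts 1 into the ideal itself and
  not merely its closure.\<close>

lemma simple_one_eq_sum:
  fixes y :: "'a::cstar_algebra"
  assumes "cs_simple TYPE('a)" "y \<noteq> 0"
  obtains m and a b :: "nat \<Rightarrow> 'a" where "1 = (\<Sum>i<m. a i * y * b i)"
proof -
  define I where "I = {z. \<exists>m a b. z = (\<Sum>i<(m::nat). a i * y * b i)}"
  have I0: "0 \<in> I" unfolding I_def by (auto intro!: exI[of _ "0::nat"])
  have Iy: "y \<in> I" unfolding I_def
    by (auto intro!: exI[of _ "1::nat"] exI[of _ "\<lambda>_. 1"])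
  have Iadd: "z + w \<in> I" if "z \<in> I" "w \<in> I" for z w
  proof -
    from that obtain m a b n c d where "z = (\<Sum>i<(m::nat). a i * y * b i)"
      and "w = (\<Sum>i<(n::nat). c i * y * d i)" unfolding I_def by blast
    then have "z + w = (\<Sum>i<m + n. (if i < m then a i else c (i - m)) * y * (if i < m then b i else d (i - m)))"
      by (simp only: sum_lessThan_append) (auto intro: sum.cong)
    then show ?thesis unfolding I_def mem_Collect_eq by (intro exI)
  qed
  have Imult: "a * z * b \<in> I" if "z \<in> I" for a z b
  proof -
    from that obtain m c d where "z = (\<Sum>i<(m::nat). c i * y * d i)" unfolding I_def by blast
    then have "a * z * b = (\<Sum>i<m. (a * c i) * y * (d i * b))"
      by (simp add: sum_distrib_left sum_distrib_right mult.assoc)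
    then show ?thesis unfolding I_def mem_Collect_eq by (intro exI)
  qed
  have scale: "cs_scale c z = cs_scale c 1 * z" for c and z :: 'a
    by (simp flip: cs_scale_mult_left)
  have "cs_ideal (closure I)"
    unfolding cs_ideal_def
  proof (intro conjI ballI allI impI)
    show "0 \<in> closure I" using I0 closure_subset by blast
    show "z + w \<in> closure I" if zw: "z \<in> closure I" "w \<in> closure I" for z w
    proof -
      obtain f g where "\<And>n::nat. f n \<in> I" "f \<longlonglongrightarrow> z" "\<And>n::nat. g n \<in> I" "g \<longlonglongrightarrow> w"
        using zw unfolding closure_sequential by blast
      then have "(\<lambda>n. f n + g n) \<longlonglongrightarrow> z + w" "\<And>n. f n + g n \<in> I" by (auto intro: tendsto_add Iadd)
      then show ?thesis by (rule tendsto_in_closure)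
    qed
    have mult: "a * z * b \<in> closure I" if "z \<in> closure I" for a z b
    proof -
      obtain f where "\<And>n::nat. f n \<in> I" "f \<longlonglongrightarrow> z" using \<open>z \<in> closure I\<close> unfolding closure_sequential by blast
      then have "(\<lambda>n. a * f n * b) \<longlonglongrightarrow> a * z * b" "\<And>n. a * f n * b \<in> I"
        by (auto intro!: tendsto_intros Imult)
      then show ?thesis by (rule tendsto_in_closure)
    qed
    show "a * z \<in> closure I" "z * a \<in> closure I" if "z \<in> closure I" for a z
      using mult[OF that, of a 1] mult[OF that, of 1 a] by auto
    then show "cs_scale c z \<in> closure I" if "z \<in> closure I" for c z
      using that by (subst scale) blast
  qed
  then have "closure I = {0} \<or> closure I = UNIV" using assms(1) unfolding cs_simple_def by blast
  then have "1 \<in> closure I" using Iy assms(2) closure_subset[of I] by auto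
  then obtain z where z: "z \<in> I" "dist z 1 < 1"
    unfolding closure_approachable using zero_less_one by blast
  define d where "d = 1 - z"
  have d: "norm d < 1" using z(2) by (simp add: d_def dist_norm norm_minus_commute)
  have "(1 - d) * (\<Sum>n. d ^ n) = 1" by (rule neumann_series(2)[OF d])
  then have "z * (\<Sum>n. d ^ n) = 1" by (simp add: d_def)
  then have "1 \<in> I" using Imult[OF z(1), of 1 "\<Sum>n. d ^ n"] by simp
  then show ?thesis unfolding I_def using that by blast
qed

text \<open>Positivity of the squares of \<open>y * ((a i)\<^sup>\<star> - b i)\<close> gives G >= 2
  for the symmetrised sum G of the two families; conjugating by the inverse square root of G
  normalises it to 1.\<close>

lemma simple_one_eq_sum_conj:
  fixes y :: "'a::cstar_algebra"
  assumes "cs_simple TYPE('a)" "y \<noteq> 0" "y\<^sup>\<star> = y"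
  obtains m and s :: "nat \<Rightarrow> 'a" where "1 = (\<Sum>i<m. s i * (y * y) * (s i)\<^sup>\<star>)"
proof -
  have "y * y \<noteq> 0" using assms cs_star_mult_eq_0[of y] by simp
  then obtain m and a b :: "nat \<Rightarrow> 'a" where ab: "1 = (\<Sum>i<m. a i * (y * y) * b i)"
    using simple_one_eq_sum[OF assms(1)] by blast
  define s where "s i = (if i < m then a i else (b (i - m))\<^sup>\<star>)" for i
  define G where "G = (\<Sum>i<m + m. s i * (y * y) * (s i)\<^sup>\<star>)"
  have G: "G = (\<Sum>i<m. a i * (y * y) * (a i)\<^sup>\<star>) + (\<Sum>i<m. (b i)\<^sup>\<star> * (y * y) * b i)"
    unfolding G_def sum_lessThan_append by (auto intro!: sum.cong simp: s_def)
  have ab': "1 = (\<Sum>i<m. (b i)\<^sup>\<star> * (y * y) * (a i)\<^sup>\<star>)"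
    using arg_cong[OF ab, of cs_star] assms(3) by (simp add: mult.assoc)
  have "(\<Sum>i<m. (y * ((a i)\<^sup>\<star> - b i))\<^sup>\<star> * (y * ((a i)\<^sup>\<star> - b i)))
      = G - (\<Sum>i<m. a i * (y * y) * b i) - (\<Sum>i<m. (b i)\<^sup>\<star> * (y * y) * (a i)\<^sup>\<star>)"
    unfolding G by (simp add: assms(3) algebra_simps sum.distrib sum_subtractf)
  also have "\<dots> = G - 1 - 1" by (simp only: ab[symmetric] ab'[symmetric])
  finally have "pos (G - 1 - 1)" by (metis (no_types, lifting) pos_star_mult pos_sum)
  then obtain t where t: "norm (of_real t - (G - 1 - 1)) \<le> t" by (auto simp: pos_def)
  then have t0: "t \<ge> 0" using norm_ge_zero order_trans by blast
  \<comment> \<open>The scaling t + 2 makes the norm of \<open>b'\<close> at most t / (t + 2) < 1,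
    which is the room gained by G >= 2 over mere positivity.\<close>
  define b' where "b' = 1 - (1 / (t + 2)) *\<^sub>R G"
  have "of_real t - (G - 1 - 1) = (t + 2) *\<^sub>R b'"
    using t0 by (simp add: b'_def of_real_def scaleR_diff_right scaleR_add_left scaleR_2)
  then have "(t + 2) * norm b' \<le> t" using t t0 by simp
  then have nb: "norm b' < 1" using t0 by (smt (verit) mult_le_cancel_left1 norm_ge_zero)
  have "G\<^sup>\<star> = G" by (simp add: G_def assms(3) mult.assoc)
  then have "b'\<^sup>\<star> = b'" by (simp add: b'_def)
  then obtain c where c: "c\<^sup>\<star> = c" "c * (1 - b') * c = 1"
    using inverse_sqrt_one_minus[OF nb] by blast
  define s' where "s' i = (1 / sqrt (t + 2)) *\<^sub>R (c * s i)" for i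
  have "(\<Sum>i<m + m. s' i * (y * y) * (s' i)\<^sup>\<star>) = (1 / (t + 2)) *\<^sub>R (c * G * c)"
    using t0 by (simp add: s'_def G_def sum_distrib_left sum_distrib_right scaleR_sum_right c mult.assoc)
  also have "\<dots> = 1" using c by (simp add: b'_def)
  finally show ?thesis using that by metis
qed

subsection \<open>The sequence algebra\<close>

\<comment> \<open>Bounded sequences modulo null sequences, used as a real algebra with involution.
  No quotient norm is introduced; norm bounds return to representatives through
  \<open>asq_norm_le\<close>.\<close>
quotient_type (overloaded) 'a asq = "nat \<Rightarrow> 'a::cstar_algebra" / partial:
  "\<lambda>X Y. Bseq X \<and> Bseq Y \<and> (\<lambda>n. X n - Y n) \<longlonglongrightarrow> 0"
proof (rule part_equivpI)
  show "\<exists>X :: nat \<Rightarrow> 'a. Bseq X \<and> Bseq X \<and> (\<lambda>n. X n - X n) \<longlonglongrightarrow> 0"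
    by (intro exI[of _ "\<lambda>_. 0"]) simp
  show "symp (\<lambda>X Y :: nat \<Rightarrow> 'a. Bseq X \<and> Bseq Y \<and> (\<lambda>n. X n - Y n) \<longlonglongrightarrow> 0)"
    by (auto intro!: sympI dest: tendsto_minus)
  show "transp (\<lambda>X Y :: nat \<Rightarrow> 'a. Bseq X \<and> Bseq Y \<and> (\<lambda>n. X n - Y n) \<longlonglongrightarrow> 0)"
  proof (rule transpI, safe)
    fix X Y Z :: "nat \<Rightarrow> 'a"
    assume "(\<lambda>n. X n - Y n) \<longlonglongrightarrow> 0" "(\<lambda>n. Y n - Z n) \<longlonglongrightarrow> 0"
    from tendsto_add[OF this] show "(\<lambda>n. X n - Z n) \<longlonglongrightarrow> 0" by simp
  qed
qed

lemma Bseq_iff_norm_le: "Bseq X \<longleftrightarrow> (\<exists>K. \<forall>n. norm (X n) \<le> K)"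
  by (metis Bseq_def BseqI')

lemma Bseq_cs_star: "Bseq X \<Longrightarrow> Bseq (\<lambda>n. (X n)\<^sup>\<star>)" for X :: "nat \<Rightarrow> 'a::cstar_algebra"
  by (simp add: Bseq_def)

lemma Bseq_uminus: "Bseq X \<Longrightarrow> Bseq (\<lambda>n. - X n)" for X :: "nat \<Rightarrow> 'a::real_normed_vector"
  by (simp add: Bseq_def)

lemma Bseq_plus: "Bseq X \<Longrightarrow> Bseq Y \<Longrightarrow> Bseq (\<lambda>n. X n + Y n)"
  for X Y :: "nat \<Rightarrow> 'a::real_normed_vector"
  unfolding Bseq_iff_norm_le by (meson norm_triangle_mono)

lemma Bseq_minus: "Bseq X \<Longrightarrow> Bseq Y \<Longrightarrow> Bseq (\<lambda>n. X n - Y n)"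
  for X Y :: "nat \<Rightarrow> 'a::real_normed_vector"
  using Bseq_plus[of X "\<lambda>n. - Y n"] Bseq_uminus[of Y] by simp

lemma Bseq_times: "Bseq X \<Longrightarrow> Bseq Y \<Longrightarrow> Bseq (\<lambda>n. X n * Y n)"
  for X Y :: "nat \<Rightarrow> 'a::real_normed_algebra"
proof -
  assume "Bseq X" "Bseq Y"
  then obtain K L where KL: "\<And>n. norm (X n) \<le> K" "\<And>n. norm (Y n) \<le> L"
    unfolding Bseq_iff_norm_le by blast
  have "norm (X n * Y n) \<le> K * L" for n
    using KL[of n] order_trans[OF norm_ge_zero KL(1)[of n]]
    by (intro order_trans[OF norm_mult_ineq] mult_mono) auto
  then show ?thesis unfolding Bseq_iff_norm_le by blast
qed

lemma Bseq_scale: "Bseq X \<Longrightarrow> Bseq (\<lambda>n. r *\<^sub>R X n)" for X :: "nat \<Rightarrow> 'a::real_normed_vector"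
  unfolding Bseq_iff_norm_le norm_scaleR by (meson abs_ge_zero mult_left_mono)

lemma Bseq_times_tendsto_0:
  fixes X Y :: "nat \<Rightarrow> 'a::real_normed_algebra"
  assumes "Bseq X" "Y \<longlonglongrightarrow> 0"
  shows "(\<lambda>n. X n * Y n) \<longlonglongrightarrow> 0" "(\<lambda>n. Y n * X n) \<longlonglongrightarrow> 0"
proof -
  obtain K where K: "\<And>n. norm (X n) \<le> K" using assms(1) unfolding Bseq_iff_norm_le by blast
  have lim: "(\<lambda>n. K * norm (Y n)) \<longlonglongrightarrow> 0"
    using tendsto_mult_left[OF tendsto_norm_zero[OF assms(2)], of K] by simp
  have "norm (X n * Y n) \<le> K * norm (Y n)" for n
    using K by (intro order_trans[OF norm_mult_ineq] mult_right_mono) auto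
  then show "(\<lambda>n. X n * Y n) \<longlonglongrightarrow> 0" by (intro Lim_null_comparison[OF _ lim]) auto
  have "norm (Y n * X n) \<le> K * norm (Y n)" for n
    using K by (subst mult.commute) (intro order_trans[OF norm_mult_ineq] mult_left_mono; auto)
  then show "(\<lambda>n. Y n * X n) \<longlonglongrightarrow> 0" by (intro Lim_null_comparison[OF _ lim]) auto
qed

lemma Bseq_mult_diff_tendsto_0:
  fixes X :: "nat \<Rightarrow> 'a::real_normed_algebra"
  assumes "Bseq X" "Bseq Y'" "(\<lambda>n. X n - X' n) \<longlonglongrightarrow> 0" "(\<lambda>n. Y n - Y' n) \<longlonglongrightarrow> 0"
  shows "(\<lambda>n. X n * Y n - X' n * Y' n) \<longlonglongrightarrow> 0"
  using tendsto_add[OF Bseq_times_tendsto_0(1)[OF assms(1,4)] Bseq_times_tendsto_0(2)[OF assms(2,3)]]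
  by (simp add: algebra_simps)

instantiation asq :: (cstar_algebra) real_algebra_1
begin

lift_definition zero_asq :: "'a asq" is "\<lambda>_. 0" by simp
lift_definition one_asq :: "'a asq" is "\<lambda>_. 1" by simp
lift_definition plus_asq :: "'a asq \<Rightarrow> 'a asq \<Rightarrow> 'a asq" is "\<lambda>X Y n. X n + Y n"
proof (intro conjI)
  fix X X' Y Y' :: "nat \<Rightarrow> 'a"
  assume *: "Bseq X \<and> Bseq X' \<and> (\<lambda>n. X n - X' n) \<longlonglongrightarrow> 0" "Bseq Y \<and> Bseq Y' \<and> (\<lambda>n. Y n - Y' n) \<longlonglongrightarrow> 0"
  then show "Bseq (\<lambda>n. X n + Y n)" "Bseq (\<lambda>n. X' n + Y' n)" by (auto intro: Bseq_plus)
  show "(\<lambda>n. X n + Y n - (X' n + Y' n)) \<longlonglongrightarrow> 0"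
    using * tendsto_add[of "\<lambda>n. X n - X' n" 0 sequentially "\<lambda>n. Y n - Y' n" 0] by (simp add: algebra_simps)
qed
lift_definition minus_asq :: "'a asq \<Rightarrow> 'a asq \<Rightarrow> 'a asq" is "\<lambda>X Y n. X n - Y n"
proof (intro conjI)
  fix X X' Y Y' :: "nat \<Rightarrow> 'a"
  assume *: "Bseq X \<and> Bseq X' \<and> (\<lambda>n. X n - X' n) \<longlonglongrightarrow> 0" "Bseq Y \<and> Bseq Y' \<and> (\<lambda>n. Y n - Y' n) \<longlonglongrightarrow> 0"
  then show "Bseq (\<lambda>n. X n - Y n)" "Bseq (\<lambda>n. X' n - Y' n)" by (auto intro: Bseq_minus)
  show "(\<lambda>n. X n - Y n - (X' n - Y' n)) \<longlonglongrightarrow> 0"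
    using * tendsto_diff[of "\<lambda>n. X n - X' n" 0 sequentially "\<lambda>n. Y n - Y' n" 0] by (simp add: algebra_simps)
qed
lift_definition uminus_asq :: "'a asq \<Rightarrow> 'a asq" is "\<lambda>X n. - X n"
proof (intro conjI)
  fix X X' :: "nat \<Rightarrow> 'a"
  assume *: "Bseq X \<and> Bseq X' \<and> (\<lambda>n. X n - X' n) \<longlonglongrightarrow> 0"
  then show "Bseq (\<lambda>n. - X n)" "Bseq (\<lambda>n. - X' n)" by (auto intro: Bseq_uminus)
  show "(\<lambda>n. - X n - - X' n) \<longlonglongrightarrow> 0"
    using * tendsto_minus[of "\<lambda>n. X n - X' n" 0] by (simp add: algebra_simps)
qed
lift_definition times_asq :: "'a asq \<Rightarrow> 'a asq \<Rightarrow> 'a asq" is "\<lambda>X Y n. X n * Y n"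
  by (auto intro: Bseq_times Bseq_mult_diff_tendsto_0)
lift_definition scaleR_asq :: "real \<Rightarrow> 'a asq \<Rightarrow> 'a asq" is "\<lambda>r X n. r *\<^sub>R X n"
proof (intro conjI)
  fix r and X X' :: "nat \<Rightarrow> 'a"
  assume *: "Bseq X \<and> Bseq X' \<and> (\<lambda>n. X n - X' n) \<longlonglongrightarrow> 0"
  then show "Bseq (\<lambda>n. r *\<^sub>R X n)" "Bseq (\<lambda>n. r *\<^sub>R X' n)" by (auto intro: Bseq_scale)
  show "(\<lambda>n. r *\<^sub>R X n - r *\<^sub>R X' n) \<longlonglongrightarrow> 0"
    using * tendsto_scaleR[OF tendsto_const, of "\<lambda>n. X n - X' n" 0 sequentially r] by (simp add: algebra_simps)
qed

instance
proof
  show "(0 :: 'a asq) \<noteq> 1" by transfer (simp add: tendsto_const_iff LIMSEQ_const_iff)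
qed (transfer; simp add: algebra_simps Bseq_plus Bseq_minus Bseq_uminus Bseq_times Bseq_scale)+

end

lift_definition asq_star :: "'a::cstar_algebra asq \<Rightarrow> 'a asq" (\<open>_\<^sup>\<bullet>\<close> [1000] 999) is "\<lambda>X n. (X n)\<^sup>\<star>"
  using tendsto_cs_star[where l = 0] by (fastforce intro: Bseq_cs_star)

lift_definition asq_const :: "'a::cstar_algebra \<Rightarrow> 'a asq" is "\<lambda>x _. x"
  by simp

text \<open>The identity serves as default because an arbitrary map need not respect bounded or null
  sequences; an automorphism does, being additive and isometric.\<close>

lift_definition asq_map :: "('a::cstar_algebra \<Rightarrow> 'a) \<Rightarrow> 'a asq \<Rightarrow> 'a asq"
  is "\<lambda>\<alpha> X n. if cs_automorphism \<alpha> then \<alpha> (X n) else X n"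
proof (intro conjI)
  fix \<alpha> and X X' :: "nat \<Rightarrow> 'a"
  assume *: "Bseq X \<and> Bseq X' \<and> (\<lambda>n. X n - X' n) \<longlonglongrightarrow> 0"
  then show "Bseq (\<lambda>n. if cs_automorphism \<alpha> then \<alpha> (X n) else X n)"
    "Bseq (\<lambda>n. if cs_automorphism \<alpha> then \<alpha> (X' n) else X' n)"
    by (auto simp: Bseq_def cs_automorphism_norm)
  show "(\<lambda>n. (if cs_automorphism \<alpha> then \<alpha> (X n) else X n) - (if cs_automorphism \<alpha> then \<alpha> (X' n) else X' n)) \<longlonglongrightarrow> 0"
  proof (cases "cs_automorphism \<alpha>")
    case True
    then have "norm (\<alpha> (X n) - \<alpha> (X' n)) = norm (X n - X' n)" for n
      by (metis cs_automorphism_diff cs_automorphism_norm)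
    then have "(\<lambda>n. norm (\<alpha> (X n) - \<alpha> (X' n))) \<longlonglongrightarrow> 0" using * tendsto_norm_zero by auto
    then show ?thesis using True by (simp add: tendsto_norm_zero_cancel)
  qed (use * in simp)
qed

text \<open>The class of a sequence, with the class of 0 as default for unbounded ones; hence the
  boundedness premises in the rules below.\<close>

lift_definition asq_of :: "(nat \<Rightarrow> 'a::cstar_algebra) \<Rightarrow> 'a asq"
  is "\<lambda>X. if Bseq X then X else (\<lambda>_. 0)"
  by auto

lemma asq_of_eq_iff:
  "Bseq X \<Longrightarrow> Bseq Y \<Longrightarrow> asq_of X = asq_of Y \<longleftrightarrow> (\<lambda>n. X n - Y n) \<longlonglongrightarrow> 0"
  by transfer simp

lemma asq_exhaust:
  obtains X where "Bseq X" "q = asq_of X"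
proof -
  have "\<exists>X. Bseq X \<and> q = asq_of X" by transfer (rule exI, auto)
  then show ?thesis using that by blast
qed

lemma asq_of_add: "Bseq X \<Longrightarrow> Bseq Y \<Longrightarrow> asq_of X + asq_of Y = asq_of (\<lambda>n. X n + Y n)"
  by transfer (simp add: Bseq_plus)

lemma asq_of_diff: "Bseq X \<Longrightarrow> Bseq Y \<Longrightarrow> asq_of X - asq_of Y = asq_of (\<lambda>n. X n - Y n)"
  by transfer (simp add: Bseq_minus)

lemma asq_of_mult: "Bseq X \<Longrightarrow> Bseq Y \<Longrightarrow> asq_of X * asq_of Y = asq_of (\<lambda>n. X n * Y n)"
  by transfer (simp add: Bseq_times)

lemma asq_of_scaleR: "Bseq X \<Longrightarrow> r *\<^sub>R asq_of X = asq_of (\<lambda>n. r *\<^sub>R X n)"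
  by transfer (simp add: Bseq_scale)

lemma asq_of_star: "Bseq X \<Longrightarrow> (asq_of X)\<^sup>\<bullet> = asq_of (\<lambda>n. (X n)\<^sup>\<star>)"
  by transfer (simp add: Bseq_cs_star)

lemma Bseq_cs_automorphism: "cs_automorphism \<alpha> \<Longrightarrow> Bseq X \<Longrightarrow> Bseq (\<lambda>n. \<alpha> (X n))"
  by (simp add: Bseq_def cs_automorphism_norm)

lemma asq_of_map: "cs_automorphism \<alpha> \<Longrightarrow> Bseq X \<Longrightarrow> asq_map \<alpha> (asq_of X) = asq_of (\<lambda>n. \<alpha> (X n))"
  by transfer (simp add: Bseq_cs_automorphism)

lemma asq_const_eq: "asq_const x = asq_of (\<lambda>_. x)"
  by transfer simp

lemma asq_zero_eq: "0 = asq_of (\<lambda>_. 0)" and asq_one_eq: "1 = asq_of (\<lambda>_. 1)"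
  by (transfer, simp)+

lemma Bseq_sum: "(\<And>i. i \<in> I \<Longrightarrow> Bseq (X i)) \<Longrightarrow> Bseq (\<lambda>n. \<Sum>i\<in>I. X i n)"
  for X :: "'b \<Rightarrow> nat \<Rightarrow> 'a::real_normed_vector"
  by (induction I rule: infinite_finite_induct) (auto intro: Bseq_plus)

lemma asq_of_sum:
  "(\<And>i. i \<in> I \<Longrightarrow> Bseq (X i)) \<Longrightarrow> (\<Sum>i\<in>I. asq_of (X i)) = asq_of (\<lambda>n. \<Sum>i\<in>I. X i n)"
  by (induction I rule: infinite_finite_induct) (auto simp: asq_zero_eq asq_of_add Bseq_sum)

lemma asq_star_add [simp]: "(x + y)\<^sup>\<bullet> = x\<^sup>\<bullet> + y\<^sup>\<bullet>"
  and asq_star_diff [simp]: "(x - y)\<^sup>\<bullet> = x\<^sup>\<bullet> - y\<^sup>\<bullet>"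
  and asq_star_mult [simp]: "(x * y)\<^sup>\<bullet> = y\<^sup>\<bullet> * x\<^sup>\<bullet>"
  and asq_star_star [simp]: "(x\<^sup>\<bullet>)\<^sup>\<bullet> = x"
  and asq_star_scaleR [simp]: "(r *\<^sub>R x)\<^sup>\<bullet> = r *\<^sub>R x\<^sup>\<bullet>"
  and asq_star_zero [simp]: "0\<^sup>\<bullet> = (0 :: 'a::cstar_algebra asq)"
  and asq_star_one [simp]: "1\<^sup>\<bullet> = (1 :: 'a::cstar_algebra asq)"
  by (transfer; simp add: Bseq_plus Bseq_minus Bseq_uminus Bseq_times Bseq_scale Bseq_cs_star)+

lemma asq_star_sum [simp]: "(\<Sum>i\<in>I. f i)\<^sup>\<bullet> = (\<Sum>i\<in>I. (f i)\<^sup>\<bullet>)"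
  by (induction I rule: infinite_finite_induct) auto

lemma asq_const_add [simp]: "asq_const (x + y) = asq_const x + asq_const y"
  and asq_const_mult [simp]: "asq_const (x * y) = asq_const x * asq_const y"
  and asq_const_star [simp]: "asq_const (x\<^sup>\<star>) = (asq_const x)\<^sup>\<bullet>"
  and asq_const_zero [simp]: "asq_const 0 = 0"
  and asq_const_one [simp]: "asq_const 1 = 1"
  by (transfer; simp)+

lemma asq_const_sum [simp]: "asq_const (\<Sum>i\<in>I. f i) = (\<Sum>i\<in>I. asq_const (f i))"
  by (induction I rule: infinite_finite_induct) auto

context
  fixes \<alpha> :: "'a::cstar_algebra \<Rightarrow> 'a"
  assumes \<alpha>: "cs_automorphism \<alpha>"
begin

lemma asq_map_add: "asq_map \<alpha> (x + y) = asq_map \<alpha> x + asq_map \<alpha> y"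
  and asq_map_diff: "asq_map \<alpha> (x - y) = asq_map \<alpha> x - asq_map \<alpha> y"
  and asq_map_mult: "asq_map \<alpha> (x * y) = asq_map \<alpha> x * asq_map \<alpha> y"
  and asq_map_star: "asq_map \<alpha> (x\<^sup>\<bullet>) = (asq_map \<alpha> x)\<^sup>\<bullet>"
  and asq_map_scaleR: "asq_map \<alpha> (r *\<^sub>R x) = r *\<^sub>R asq_map \<alpha> x"
  and asq_map_zero: "asq_map \<alpha> 0 = 0"
  and asq_map_one: "asq_map \<alpha> 1 = 1"
  using \<alpha> by - (transfer; simp add: Bseq_plus Bseq_minus Bseq_times Bseq_scale Bseq_cs_star
    Bseq_cs_automorphism cs_automorphism_add cs_automorphism_diff cs_automorphism_mult cs_automorphism_star
    cs_automorphism_scaleR cs_automorphism_zero cs_automorphism_one)+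

lemma asq_map_sum: "asq_map \<alpha> (\<Sum>i\<in>I. f i) = (\<Sum>i\<in>I. asq_map \<alpha> (f i))"
  by (induction I rule: infinite_finite_induct) (auto simp: asq_map_add asq_map_zero)

lemma asq_map_comp:
  assumes \<beta>: "cs_automorphism \<beta>"
  shows "asq_map (\<alpha> \<circ> \<beta>) x = asq_map \<alpha> (asq_map \<beta> x)"
  by (rule asq_exhaust[of x])
    (simp add: asq_of_map \<alpha> \<beta> cs_automorphism_comp Bseq_cs_automorphism)

end

lemma asq_map_id: "asq_map id x = x"
  by (rule asq_exhaust[of x]) (simp add: asq_of_map cs_automorphism_id)

text \<open>An identity in the quotient holds for representatives up to a null sequence
  \<open>r\<close>. Since \<open>r n\<close> is self-adjoint, it is absorbed by adding its norm to
  T, and positivity in A gives the bound.\<close>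

lemma asq_norm_le:
  assumes T: "of_real T - (asq_of X)\<^sup>\<bullet> * asq_of X = (\<Sum>i\<in>I. (z i)\<^sup>\<bullet> * z i)"
    and X: "Bseq X" and "T \<ge> 0" "\<delta> > 0"
  shows "eventually (\<lambda>n. (norm (X n))\<^sup>2 \<le> T + \<delta>) sequentially"
proof -
  have "\<forall>i. \<exists>Z. Bseq Z \<and> z i = asq_of Z" using asq_exhaust by metis
  then obtain Z where Z: "\<And>i. Bseq (Z i)" "\<And>i. z i = asq_of (Z i)" by metis
  define r where "r n = of_real T - (X n)\<^sup>\<star> * X n - (\<Sum>i\<in>I. (Z i n)\<^sup>\<star> * Z i n)" for n
  have B: "Bseq (\<lambda>n. (X n)\<^sup>\<star> * X n)" "Bseq (\<lambda>n. (Z i n)\<^sup>\<star> * Z i n)" for i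
    using X Z by (auto intro!: Bseq_times Bseq_cs_star)
  have "of_real T = asq_of (\<lambda>_. of_real T :: 'a)" by (simp add: of_real_def asq_one_eq asq_of_scaleR)
  then have "asq_of (\<lambda>n. of_real T - (X n)\<^sup>\<star> * X n) = asq_of (\<lambda>n. \<Sum>i\<in>I. (Z i n)\<^sup>\<star> * Z i n)"
    using T X Z B by (simp add: asq_of_star asq_of_mult asq_of_diff Bseq_cs_star asq_of_sum)
  then have "r \<longlonglongrightarrow> 0" unfolding r_def using B
    by (subst (asm) asq_of_eq_iff) (auto intro!: Bseq_minus Bseq_sum)
  then have "eventually (\<lambda>n. norm (r n) < \<delta>) sequentially"
    using assms(4) by (metis order_tendstoD(2) tendsto_norm_zero)
  then show ?thesis
  proof (rule eventually_mono)
    fix n assume n: "norm (r n) < \<delta>"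
    have "norm ((X n)\<^sup>\<star> * X n) \<le> T + norm (r n)"
    proof (rule norm_le_of_pos)
      have "(r n)\<^sup>\<star> = r n" by (simp add: r_def)
      then have "pos (of_real (norm (r n)) + r n)" unfolding pos_def
        by (auto intro!: exI[of _ "norm (r n)"])
      then have "pos (of_real (norm (r n)) + r n + (\<Sum>i\<in>I. (Z i n)\<^sup>\<star> * Z i n))"
        by (rule pos_add[OF _ pos_sum[OF pos_star_mult]])
      then show "pos (of_real (T + norm (r n)) - (X n)\<^sup>\<star> * X n)"
        by (simp add: r_def algebra_simps)
    qed (auto intro: pos_star_mult simp: assms)
    then show "(norm (X n))\<^sup>2 \<le> T + \<delta>" using n unfolding cs_cstar_identity by linarith
  qed
qed

subsection \<open>Cyclic projections in the sequence algebra\<close>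

text \<open>The tower has R T projections with bottom \<open>e\<close>; the rungs are those at
  multiples of R. \<open>C\<close> is the length of the cycle to be formed, \<open>H\<close> the
  number of rungs at either end that are rotated into each other, and \<open>c\<close>,
  \<open>s\<close> are the cosine and sine of the rotation angle, which reaches pi / 2 at index H -
  1.\<close>

locale matrix_tower =
  fixes \<alpha> :: "'a::cstar_algebra \<Rightarrow> 'a" and R T H C :: nat and e w :: "'a asq" and c s :: "nat \<Rightarrow> real"
  assumes \<alpha>: "cs_automorphism \<alpha>"
    and R_pos: "R > 0" and H_pos: "H > 0" and H_le: "H \<le> C" and T_eq: "T = C + H"
    and e_star: "e\<^sup>\<bullet> = e" and e_idem: "e * e = e"
    and e_orth: "\<And>i j. i < R * T \<Longrightarrow> j < R * T \<Longrightarrow> i \<noteq> j \<Longrightarrow>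
        asq_map (\<alpha> ^^ i) e * asq_map (\<alpha> ^^ j) e = 0"
    and w_unitary: "w\<^sup>\<bullet> * w = 1" "w * w\<^sup>\<bullet> = 1"
    and w_e: "w * e * w\<^sup>\<bullet> = asq_map (\<alpha> ^^ R) e"
    and cs: "\<And>k. (c k)\<^sup>2 + (s k)\<^sup>2 = 1"
    and cs_0: "c 0 = 1" "s 0 = 0"
    and cs_ge: "\<And>k. H \<le> Suc k \<Longrightarrow> c k = 0" "\<And>k. H \<le> Suc k \<Longrightarrow> s k = 1"
begin

section \<open>Powers of \<alpha> and matrix units on the rungs\<close>

definition \<sigma> :: "nat \<Rightarrow> 'a asq \<Rightarrow> 'a asq" where
  "\<sigma> i = asq_map (\<alpha> ^^ i)"

lemma sigma_add: "\<sigma> i (x + y) = \<sigma> i x + \<sigma> i y"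
  and sigma_diff: "\<sigma> i (x - y) = \<sigma> i x - \<sigma> i y"
  and sigma_mult: "\<sigma> i (x * y) = \<sigma> i x * \<sigma> i y"
  and sigma_star: "\<sigma> i (x\<^sup>\<bullet>) = (\<sigma> i x)\<^sup>\<bullet>"
  and sigma_scaleR: "\<sigma> i (r *\<^sub>R x) = r *\<^sub>R \<sigma> i x"
  and sigma_zero: "\<sigma> i 0 = 0"
  and sigma_one: "\<sigma> i 1 = 1"
  using cs_automorphism_funpow[OF \<alpha>, of i] unfolding \<sigma>_def
  by (simp_all add: asq_map_add asq_map_diff asq_map_mult asq_map_star asq_map_scaleR
      asq_map_zero asq_map_one)

lemma sigma_sum: "\<sigma> i (\<Sum>j\<in>I. f j) = (\<Sum>j\<in>I. \<sigma> i (f j))"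
  unfolding \<sigma>_def by (rule asq_map_sum[OF cs_automorphism_funpow[OF \<alpha>]])

lemma sigma_sigma: "\<sigma> i (\<sigma> j x) = \<sigma> (i + j) x"
  using asq_map_comp[OF cs_automorphism_funpow[OF \<alpha>, of i] cs_automorphism_funpow[OF \<alpha>, of j]]
  by (simp add: \<sigma>_def funpow_add)

lemma sigma_0: "\<sigma> 0 x = x"
  by (simp add: \<sigma>_def asq_map_id)

lemmas sigma_simps = sigma_add sigma_diff sigma_mult sigma_star sigma_scaleR sigma_zero sigma_one sigma_sum

text \<open>The cocycle generated by \<open>w\<close> under \<alpha>^R, for instance
  \<open>\<omega> 2 = \<sigma> R w * w\<close>. Conjugation by \<open>\<omega> k\<close> carries the
  bottom to rung k.\<close>

primrec \<omega> :: "nat \<Rightarrow> 'a asq" where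
  "\<omega> 0 = 1"
| "\<omega> (Suc k) = \<sigma> R (\<omega> k) * w"

lemma omega_unitary: "(\<omega> k)\<^sup>\<bullet> * \<omega> k = 1"
proof (induction k)
  case (Suc k)
  have "(\<omega> (Suc k))\<^sup>\<bullet> * \<omega> (Suc k) = w\<^sup>\<bullet> * \<sigma> R ((\<omega> k)\<^sup>\<bullet> * \<omega> k) * w"
    by (simp add: sigma_simps mult.assoc)
  also have "\<dots> = 1" by (simp add: Suc sigma_one w_unitary)
  finally show ?case .
qed simp

definition E :: "nat \<Rightarrow> nat \<Rightarrow> 'a asq" where
  "E k l = \<omega> k * e * (\<omega> l)\<^sup>\<bullet>"

lemma E_star: "(E k l)\<^sup>\<bullet> = E l k"
  by (simp add: E_def e_star mult.assoc)

lemma E_mult_same: "E k l * E l m = E k m"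
proof -
  have "E k l * E l m = \<omega> k * e * ((\<omega> l)\<^sup>\<bullet> * \<omega> l) * e * (\<omega> m)\<^sup>\<bullet>" by (simp add: E_def mult.assoc)
  also have "\<dots> = \<omega> k * (e * e) * (\<omega> m)\<^sup>\<bullet>" by (simp add: omega_unitary mult.assoc)
  finally show ?thesis by (simp add: e_idem E_def)
qed

text \<open>Since \<open>\<sigma> R e\<close> is the conjugate of \<open>e\<close> by
  \<open>w\<close>, each \<open>\<sigma> R (\<omega> k)\<close> acquires precisely the factor
  \<open>w\<close> that completes it to \<open>\<omega> (Suc k)\<close>.\<close>

lemma sigma_R_E: "\<sigma> R (E k l) = E (Suc k) (Suc l)"
proof -
  have "\<sigma> R (E k l) = \<sigma> R (\<omega> k) * (w * e * w\<^sup>\<bullet>) * (\<sigma> R (\<omega> l))\<^sup>\<bullet>"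
    by (simp only: E_def sigma_simps w_e) (simp add: \<sigma>_def)
  then show ?thesis by (simp add: E_def mult.assoc)
qed

lemma E_diag: "E k k = \<sigma> (R * k) e"
proof (induction k)
  case (Suc k)
  then have "E (Suc k) (Suc k) = \<sigma> R (\<sigma> (R * k) e)" by (simp flip: sigma_R_E)
  then show ?case by (simp add: sigma_sigma)
qed (simp add: E_def sigma_0)

text \<open>Division by R shows that i and l are determined by the position i + R l in the tower.
  Distinct positions are orthogonal, and the diagonal units \<open>E l l\<close> and
  \<open>E l' l'\<close> can be inserted between the factors.\<close>

lemma sigma_E_mult:
  assumes "i < R" "j < R" "l < T" "l' < T"
  shows "\<sigma> i (E k l) * \<sigma> j (E l' m) = (if i = j \<and> l = l' then \<sigma> i (E k m) else 0)"
proof (cases "i = j \<and> l = l'")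
  case True
  then show ?thesis by (auto simp: E_mult_same simp flip: sigma_mult)
next
  case False
  have "i + R * l \<noteq> j + R * l'"
  proof
    assume eq: "i + R * l = j + R * l'"
    then have "(i + R * l) mod R = (j + R * l') mod R" "(i + R * l) div R = (j + R * l') div R"
      by simp_all
    then show False using False assms R_pos by simp
  qed
  moreover have "i + R * l < R * T" if "i < R" "l < T" for i l
  proof -
    have "i + R * l < R * Suc l" using that by simp
    also have "\<dots> \<le> R * T" using that by (intro mult_le_mono2) simp
    finally show ?thesis .
  qed
  ultimately have "\<sigma> (i + R * l) e * \<sigma> (j + R * l') e = 0"
    using assms e_orth unfolding \<sigma>_def by blast
  then have "\<sigma> i (E l l) * \<sigma> j (E l' l') = 0" by (simp add: E_diag sigma_sigma)
  then have "\<sigma> i (E k l) * (\<sigma> i (E l l) * \<sigma> j (E l' l')) * \<sigma> j (E l' m) = 0" by simp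
  moreover have "\<sigma> i (E k l) * (\<sigma> i (E l l) * \<sigma> j (E l' l')) * \<sigma> j (E l' m)
      = \<sigma> i (E k l * E l l) * \<sigma> j (E l' l' * E l' m)" by (simp add: sigma_mult mult.assoc)
  ultimately have "\<sigma> i (E k l) * \<sigma> j (E l' m) = 0" by (simp add: E_mult_same)
  then show ?thesis by (simp only: if_not_P[OF False])
qed

lemma E_mult: "l < T \<Longrightarrow> l' < T \<Longrightarrow> E k l * E l' m = (if l = l' then E k m else 0)"
  using sigma_E_mult[of 0 0 l l' k m] R_pos by (simp add: sigma_0)

text \<open>Think of \<open>E k l\<close> as the matrix unit from a vector \<open>v\<^sub>l\<close> to \<open>v\<^sub>k\<close>. Then \<open>p k\<close> projects onto
  \<open>s k v\<^sub>k + c k v\<^sub>k\<^sub>+\<^sub>C\<close>, which moves slowly from \<open>v\<^sub>C\<close> to \<open>v\<^sub>H\<^sub>-\<^sub>1\<close>, so the shift closes up to a cycle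
  of length \<open>C\<close>. The orthogonal vectors \<open>c k v\<^sub>k - s k v\<^sub>k\<^sub>+\<^sub>C\<close> give \<open>u k\<close>, and \<open>B \<kappa> k\<close> maps
  them to \<open>v\<^sub>\<kappa>\<close>.\<close>

definition p :: "nat \<Rightarrow> 'a asq" where
  "p k = (if k < H then (s k)\<^sup>2 *\<^sub>R E k k + (s k * c k) *\<^sub>R (E k (k + C) + E (k + C) k) + (c k)\<^sup>2 *\<^sub>R E (k + C) (k + C)
     else E k k)"

definition u :: "nat \<Rightarrow> 'a asq" where
  "u k = (c k)\<^sup>2 *\<^sub>R E k k - (s k * c k) *\<^sub>R (E k (k + C) + E (k + C) k) + (s k)\<^sup>2 *\<^sub>R E (k + C) (k + C)"

definition B :: "nat \<Rightarrow> nat \<Rightarrow> 'a asq" where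
  "B \<kappa> k = c k *\<^sub>R E \<kappa> k - s k *\<^sub>R E \<kappa> (k + C)"

definition P :: "'a asq" where
  "P = (\<Sum>k<C. p k)"

lemma p_plus_u: "k < H \<Longrightarrow> p k + u k = E k k + E (k + C) (k + C)"
proof -
  assume "k < H"
  then have "p k + u k = ((c k)\<^sup>2 + (s k)\<^sup>2) *\<^sub>R E k k + ((c k)\<^sup>2 + (s k)\<^sup>2) *\<^sub>R E (k + C) (k + C)"
    by (simp add: p_def u_def algebra_simps)
  then show ?thesis by (simp add: cs)
qed

lemma p_star: "(p k)\<^sup>\<bullet> = p k"
  by (simp add: p_def E_star add_ac)

lemma P_star: "P\<^sup>\<bullet> = P"
  by (simp add: P_def p_star)

lemma c_square: "(c k)\<^sup>2 = 1 - (s k)\<^sup>2"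
  using cs[of k] by simp

lemma p_eq: 
  assumes "k < H"
  shows "p k = (s k *\<^sub>R E k k + c k *\<^sub>R E (k + C) k) * (s k *\<^sub>R E k k + c k *\<^sub>R E k (k + C))"
  using assms H_le T_eq
  by (simp add: p_def algebra_simps E_mult_same power2_eq_square)

text \<open>For k < H, \<open>p k\<close> is the range projection of the partial isometry
  \<open>a k\<close> sending the k-th vector to its rotated position. The index pairs {k, k + C} are
  disjoint, so these images are orthogonal for distinct k.\<close>

lemma p_mult:
  assumes "k < C" "l < C"
  shows "p k * p l = (if k = l then p k else 0)"
proof -
  have kT: "k < T" "l < T" using assms T_eq by auto
  consider "k < H" "l < H" | "k < H" "\<not> l < H" | "\<not> k < H" "l < H" | "\<not> k < H" "\<not> l < H" by blast
  then show ?thesis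
  proof cases
    case 1
    define a where "a k = s k *\<^sub>R E k k + c k *\<^sub>R E (k + C) k" for k
    have a': "(a k)\<^sup>\<bullet> = s k *\<^sub>R E k k + c k *\<^sub>R E k (k + C)" for k by (simp add: a_def E_star)
    have pa: "p k = a k * (a k)\<^sup>\<bullet>" if "k < H" for k
      unfolding p_eq[OF that] a' by (simp only: a_def)
    have "(a k)\<^sup>\<bullet> * a l = (if k = l then E k k else 0)"
    proof -
      have "(a k)\<^sup>\<bullet> * a l = (s k * s l) *\<^sub>R (E k k * E l l) + (s k * c l) *\<^sub>R (E k k * E (l + C) l)
         + (c k * s l) *\<^sub>R (E k (k + C) * E l l) + (c k * c l) *\<^sub>R (E k (k + C) * E (l + C) l)"
        unfolding a' by (simp add: a_def algebra_simps)
      also have "\<dots> = (if k = l then ((c k)\<^sup>2 + (s k)\<^sup>2) *\<^sub>R E k k else 0)"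
        using 1 assms T_eq by (simp add: E_mult power2_eq_square algebra_simps)
      finally show ?thesis by (simp add: cs)
    qed
    moreover have "p k * p l = a k * ((a k)\<^sup>\<bullet> * a l) * (a l)\<^sup>\<bullet>" using 1 by (simp add: pa mult.assoc)
    moreover have "a k * E k k = a k" for k by (simp add: a_def distrib_right E_mult_same)
    ultimately show ?thesis using 1 by (simp add: pa)
  qed (use assms T_eq in \<open>simp_all add: p_def distrib_left distrib_right E_mult\<close>)
qed

lemma P_idem: "P * P = P"
proof -
  have "P * P = (\<Sum>k<C. \<Sum>l<C. p k * p l)" by (simp add: P_def sum_product)
  also have "\<dots> = (\<Sum>k<C. \<Sum>l<C. if k = l then p k else 0)"
    by (intro sum.cong) (simp_all add: p_mult)
  finally show ?thesis by (simp add: P_def)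
qed

lemma sigma_p_orth:
  assumes "i < R" "j < R" "i \<noteq> j" "k < C" "l < C"
  shows "\<sigma> i (p k) * \<sigma> j (p l) = 0"
proof -
  have "k < T" "l < T" "k < H \<Longrightarrow> k + C < T" "l < H \<Longrightarrow> l + C < T" using assms T_eq by auto
  then show ?thesis using assms 
    by (simp add: p_def sigma_simps distrib_left distrib_right sigma_E_mult)
qed

lemma sigma_P_orth: "i < R \<Longrightarrow> j < R \<Longrightarrow> i \<noteq> j \<Longrightarrow> \<sigma> i P * \<sigma> j P = 0"
  by (simp add: P_def sigma_sum sum_product sigma_p_orth)

lemma sum_E_diag: "(\<Sum>k<T. E k k) = P + (\<Sum>k<H. u k)"
proof -
  have split: "(\<Sum>k<C. f k) = (\<Sum>k<H. f k) + (\<Sum>k=H..<C. f k)" for f :: "nat \<Rightarrow> 'a asq"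
    using sum.atLeastLessThan_concat[of 0 H C f] H_le by (simp add: lessThan_atLeast0)
  have "(\<Sum>k<T. E k k) = (\<Sum>k<C. E k k) + (\<Sum>k=C..<C + H. E k k)"
    using sum.atLeastLessThan_concat[of 0 C T "\<lambda>k. E k k"] T_eq by (simp add: lessThan_atLeast0)
  also have "(\<Sum>k=C..<C + H. E k k) = (\<Sum>k<H. E (k + C) (k + C))"
    using sum.shift_bounds_nat_ivl[of "\<lambda>k. E k k" 0 C H] by (simp add: lessThan_atLeast0 add.commute)
  also have "(\<Sum>k<C. E k k) + (\<Sum>k<H. E (k + C) (k + C)) = (\<Sum>k<H. p k + u k) + (\<Sum>k=H..<C. p k)"
  proof -
    have "(\<Sum>k<H. p k + u k) = (\<Sum>k<H. E k k + E (k + C) (k + C))"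
      by (intro sum.cong) (simp_all add: p_plus_u)
    moreover have "(\<Sum>k=H..<C. p k) = (\<Sum>k=H..<C. E k k)"
      by (intro sum.cong) (simp_all add: p_def)
    ultimately show ?thesis unfolding split by (simp add: sum.distrib)
  qed
  also have "\<dots> = P + (\<Sum>k<H. u k)" by (simp add: P_def split sum.distrib)
  finally show ?thesis .
qed

lemma u_star: "(u k)\<^sup>\<bullet> = u k"
  by (simp add: u_def E_star add_ac)

text \<open>\<open>B \<kappa> k\<close> is a partial isometry from \<open>u k\<close> onto rung
  \<kappa>. Different target rungs suffice for orthogonality, so the second part permits different
  sources \<open>k\<close> and \<open>k'\<close>.\<close>

lemma B_star_mult:
  assumes "i < R" "j < R" "\<kappa> < T" "\<kappa>' < T"
  shows "(\<sigma> i (B \<kappa> k))\<^sup>\<bullet> * \<sigma> j (B \<kappa>' k) = (if i = j \<and> \<kappa> = \<kappa>' then \<sigma> i (u k) else 0)"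
    and "\<not> (i = j \<and> \<kappa> = \<kappa>') \<Longrightarrow> (\<sigma> i (B \<kappa> k))\<^sup>\<bullet> * \<sigma> j (B \<kappa>' k') = 0"
proof -
  have "(\<sigma> i (B \<kappa> k))\<^sup>\<bullet> * \<sigma> j (B \<kappa>' k') = (c k * c k') *\<^sub>R (\<sigma> i (E k \<kappa>) * \<sigma> j (E \<kappa>' k'))
     - (c k * s k') *\<^sub>R (\<sigma> i (E k \<kappa>) * \<sigma> j (E \<kappa>' (k' + C)))
     - (s k * c k') *\<^sub>R (\<sigma> i (E (k + C) \<kappa>) * \<sigma> j (E \<kappa>' k'))
     + (s k * s k') *\<^sub>R (\<sigma> i (E (k + C) \<kappa>) * \<sigma> j (E \<kappa>' (k' + C)))" for k'
    by (simp add: B_def E_star algebra_simps sigma_diff sigma_scaleR flip: sigma_star)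
  note eq = this
  show "(\<sigma> i (B \<kappa> k))\<^sup>\<bullet> * \<sigma> j (B \<kappa>' k) = (if i = j \<and> \<kappa> = \<kappa>' then \<sigma> i (u k) else 0)"
    unfolding eq using assms
    by (simp add: sigma_E_mult u_def sigma_simps algebra_simps power2_eq_square)
  show "\<not> (i = j \<and> \<kappa> = \<kappa>') \<Longrightarrow> (\<sigma> i (B \<kappa> k))\<^sup>\<bullet> * \<sigma> j (B \<kappa>' k') = 0"
    unfolding eq using assms by (auto simp: sigma_E_mult)
qed

section \<open>Commutation of the matrix units with given elements\<close>

lemma commute_sigma_omega:
  assumes "\<And>i. i < R * T \<Longrightarrow> x * \<sigma> i w = \<sigma> i w * x" "i + R * k \<le> R * T"
  shows "x * \<sigma> i (\<omega> k) = \<sigma> i (\<omega> k) * x"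
  using assms(2)
proof (induction k arbitrary: i)
  case (Suc k)
  have IH: "x * \<sigma> (i + R) (\<omega> k) = \<sigma> (i + R) (\<omega> k) * x" using Suc by (intro Suc.IH) (simp add: algebra_simps)
  have xw: "x * \<sigma> i w = \<sigma> i w * x" using Suc.prems R_pos by (intro assms(1)) simp
  have eq: "\<sigma> i (\<omega> (Suc k)) = \<sigma> (i + R) (\<omega> k) * \<sigma> i w" by (simp add: sigma_mult sigma_sigma)
  have "x * \<sigma> i (\<omega> (Suc k)) = (x * \<sigma> (i + R) (\<omega> k)) * \<sigma> i w" by (simp only: eq mult.assoc)
  also have "\<dots> = \<sigma> (i + R) (\<omega> k) * (x * \<sigma> i w)" by (simp add: IH mult.assoc)
  also have "\<dots> = \<sigma> i (\<omega> (Suc k)) * x" by (simp only: eq xw mult.assoc)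
  finally show ?case .
qed (simp add: sigma_one)

text \<open>The unit contains both \<omega> and an adjoint of \<omega>. Commutation with the latter
  is the adjoint of a relation for \<open>x\<^sup>\<bullet>\<close>, hence the assumption on
  \<open>x\<^sup>\<bullet>\<close>.\<close>

lemma commute_sigma_E:
  assumes "\<And>i. i < R * T \<Longrightarrow> x * \<sigma> i w = \<sigma> i w * x"
    and "\<And>i. i < R * T \<Longrightarrow> x\<^sup>\<bullet> * \<sigma> i w = \<sigma> i w * x\<^sup>\<bullet>"
    and "\<And>i. i < R * T \<Longrightarrow> x * \<sigma> i e = \<sigma> i e * x"
    and "i < R" "k < T" "l < T"
  shows "x * \<sigma> i (E k l) = \<sigma> i (E k l) * x"
proof -
  have le: "i + R * k \<le> R * T" if "k < T" for k
  proof -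
    have "i + R * k \<le> R * Suc k" using assms(4) by simp
    also have "\<dots> \<le> R * T" using that by (intro mult_le_mono2) simp
    finally show ?thesis .
  qed
  have 1: "x * \<sigma> i (\<omega> k) = \<sigma> i (\<omega> k) * x" using commute_sigma_omega[OF assms(1) le[OF assms(5)]] .
  have "x\<^sup>\<bullet> * \<sigma> i (\<omega> l) = \<sigma> i (\<omega> l) * x\<^sup>\<bullet>" using commute_sigma_omega[OF assms(2) le[OF assms(6)]] .
  from arg_cong[OF this, of asq_star] have 2: "x * (\<sigma> i (\<omega> l))\<^sup>\<bullet> = (\<sigma> i (\<omega> l))\<^sup>\<bullet> * x" by simp
  have "i < R * T" using assms(4,5) by (cases T) auto
  then have 3: "x * \<sigma> i e = \<sigma> i e * x" by (rule assms(3))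
  have "x * \<sigma> i (E k l) = (x * \<sigma> i (\<omega> k)) * \<sigma> i e * (\<sigma> i (\<omega> l))\<^sup>\<bullet>"
    by (simp add: E_def sigma_simps mult.assoc)
  also have "\<dots> = \<sigma> i (\<omega> k) * (x * \<sigma> i e) * (\<sigma> i (\<omega> l))\<^sup>\<bullet>" by (simp add: 1 mult.assoc)
  also have "\<dots> = \<sigma> i (\<omega> k) * \<sigma> i e * (x * (\<sigma> i (\<omega> l))\<^sup>\<bullet>)" by (simp add: 3 mult.assoc)
  also have "\<dots> = \<sigma> i (E k l) * x" by (simp add: 2 E_def sigma_simps mult.assoc)
  finally show ?thesis .
qed

subsection \<open>The defect of cyclicity\<close>

text \<open>The difference between \<open>\<sigma> R (p k)\<close> and \<open>p (Suc k)\<close>: two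
  rank one projections in the same 2 by 2 block, at consecutive angles. The block is symmetric of
  trace zero, so its square is a multiple of the block unit.\<close>

definition D :: "nat \<Rightarrow> 'a asq" where
  "D k = ((s k)\<^sup>2 - (s (Suc k))\<^sup>2) *\<^sub>R (E (Suc k) (Suc k) - E (Suc k + C) (Suc k + C))
     + (s k * c k - s (Suc k) * c (Suc k)) *\<^sub>R (E (Suc k) (Suc k + C) + E (Suc k + C) (Suc k))"

lemma sigma_R_P_diff: "\<sigma> R P - P = (\<Sum>k<H - 1. D k)"
proof -
  obtain C' where C': "C = Suc C'" using H_le H_pos by (cases C) auto
  have "P = p 0 + (\<Sum>k<C'. p (Suc k))" 
    using sum.lessThan_Suc_shift[of p C'] by (simp only: P_def C'[symmetric])
  moreover have "\<sigma> R P = (\<Sum>k<C'. \<sigma> R (p k)) + \<sigma> R (p C')"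
    using sum.lessThan_Suc[of "\<lambda>k. \<sigma> R (p k)" C'] by (simp only: P_def C'[symmetric] sigma_sum)
  \<comment> \<open>Here the cycle closes: the rotation is complete at C' = C - 1, so this
    projection is the plain rung C - 1, which moves to rung C, where \<open>p 0\<close> sits because
    the angle starts at 0.\<close>
  moreover have "\<sigma> R (p C') = p 0"
  proof -
    have "H \<le> Suc C'" using H_le by (simp only: C')
    then have "p C' = E C' C'" using cs_ge[of C'] by (simp add: p_def)
    moreover have "p 0 = E C C" using H_pos by (simp add: p_def cs_0)
    ultimately show ?thesis by (simp add: sigma_R_E C')
  qed
  ultimately have "\<sigma> R P - P = (\<Sum>k<C'. \<sigma> R (p k) - p (Suc k))" by (simp add: sum_subtractf)
  also have "\<dots> = (\<Sum>k<C'. if k < H - 1 then D k else 0)"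
  proof (rule sum.cong)
    fix k
    show "\<sigma> R (p k) - p (Suc k) = (if k < H - 1 then D k else 0)"
    proof (cases "k < H - 1")
      case True
      then have "k < H" "Suc k < H" by auto
      then have "\<sigma> R (p k) - p (Suc k) = D k"
        by (simp add: p_def D_def sigma_simps sigma_R_E c_square algebra_simps)
      with True show ?thesis by simp
    next
      case False
      then have "H \<le> Suc k" by simp
      then have "p k = E k k" "p (Suc k) = E (Suc k) (Suc k)"
        using cs_ge[of k] by (simp_all add: p_def)
      with False show ?thesis by (simp add: sigma_R_E)
    qed
  qed simp
  also have "\<dots> = (\<Sum>k\<in>{..<C'} \<inter> {k. k < H - 1}. D k)" by (simp add: sum.inter_restrict)
  also have "{..<C'} \<inter> {k. k < H - 1} = {..<H - 1}" using H_le unfolding C' by auto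
  finally show ?thesis .
qed

text \<open>The blocks of the \<open>D k\<close> are mutually orthogonal and each square is
  \<open>l k *\<^sub>R q k\<close>, so only the largest \<open>l k\<close> counts, not their sum.
  This is why many small rotation steps give a small total defect.\<close>

lemma defect_certificate:
  assumes "\<And>k. ((s k)\<^sup>2 - (s (Suc k))\<^sup>2)\<^sup>2 + (s k * c k - s (Suc k) * c (Suc k))\<^sup>2 \<le> \<eta>"
  shows "\<exists>z. of_real \<eta> - (\<sigma> R P - P)\<^sup>\<bullet> * (\<sigma> R P - P) = (\<Sum>k<H. (z k)\<^sup>\<bullet> * z k)"
proof -
  define l where "l k = ((s k)\<^sup>2 - (s (Suc k))\<^sup>2)\<^sup>2 + (s k * c k - s (Suc k) * c (Suc k))\<^sup>2" for k
  define q where "q k = E (Suc k) (Suc k) + E (Suc k + C) (Suc k + C)" for k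
  have l0: "0 \<le> l k" "l k \<le> \<eta>" for k using assms[of k] by (auto simp: l_def)
  have eta: "\<eta> \<ge> 0" using l0[of 0] by simp
  have idx: "Suc k < T" "Suc k + C < T" "k + C < T" if "k < H - 1" for k using that T_eq by auto
  have neq: "Suc k \<noteq> Suc l + C" "Suc k + C \<noteq> Suc l" "l + C \<noteq> k" "k \<noteq> l + C" if "k < H - 1" "l < H - 1" for k l
    using that H_le by auto
  have D_star: "(D k)\<^sup>\<bullet> = D k" for k by (simp add: D_def E_star add.commute)
  have q_star: "(q k)\<^sup>\<bullet> = q k" for k by (simp add: q_def E_star)
  have D_mult: "D k * D m = (if k = m then l k *\<^sub>R q k else 0)" if "k < H - 1" "m < H - 1" for k m
  proof -
    define x where "x k = (s k)\<^sup>2 - (s (Suc k))\<^sup>2" for k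
    define y where "y k = s k * c k - s (Suc k) * c (Suc k)" for k
    have D': "D k = x k *\<^sub>R (E (Suc k) (Suc k) - E (Suc k + C) (Suc k + C))
     + y k *\<^sub>R (E (Suc k) (Suc k + C) + E (Suc k + C) (Suc k))" for k by (simp add: D_def x_def y_def)
    have "D k * D m = (if k = m then (x k * x k + y k * y k) *\<^sub>R q k else 0)"
      unfolding D' using idx[OF that(1)] idx[OF that(2)] neq[OF that]
      by (simp add: distrib_left distrib_right left_diff_distrib right_diff_distrib E_mult)
        (simp add: q_def algebra_simps)
    then show ?thesis by (simp add: l_def x_def y_def power2_eq_square)
  qed
  have q_mult: "q k * q m = (if k = m then q k else 0)" if "k < H - 1" "m < H - 1" for k m
    using idx[OF that(1)] idx[OF that(2)] neq[OF that]
    by (simp add: q_def distrib_left distrib_right E_mult)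
  define S where "S = (\<Sum>k<H - 1. q k)"
  have S_star: "S\<^sup>\<bullet> = S" by (simp add: S_def q_star)
  have "S * S = (\<Sum>k<H - 1. \<Sum>m<H - 1. if k = m then q k else 0)"
    unfolding S_def sum_product by (intro sum.cong) (simp_all add: q_mult)
  then have S_idem: "S * S = S" by (simp add: S_def)
  have "(\<Sum>k<H - 1. D k) * (\<Sum>k<H - 1. D k) = (\<Sum>k<H - 1. \<Sum>m<H - 1. if k = m then l k *\<^sub>R q k else 0)"
    unfolding sum_product by (intro sum.cong) (simp_all add: D_mult)
  then have DD: "(\<sigma> R P - P)\<^sup>\<bullet> * (\<sigma> R P - P) = (\<Sum>k<H - 1. l k *\<^sub>R q k)"
    by (simp add: sigma_R_P_diff D_star)
  \<comment> \<open>One square for each of the H - 1 blocks fills the gap between \<open>l k\<close>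
    and \<eta>; the last one covers the complement of all blocks.\<close>
  define z where "z k = (if k < H - 1 then sqrt (\<eta> - l k) *\<^sub>R q k else sqrt \<eta> *\<^sub>R (1 - S))" for k
  have H: "H = Suc (H - 1)" using H_pos by simp
  have "(\<Sum>k<H. (z k)\<^sup>\<bullet> * z k) = (\<Sum>k<H - 1. (\<eta> - l k) *\<^sub>R q k) + \<eta> *\<^sub>R ((1 - S) * (1 - S))"
  proof -
    have "(\<Sum>k<H. (z k)\<^sup>\<bullet> * z k) = (\<Sum>k<H - 1. (z k)\<^sup>\<bullet> * z k) + (z (H - 1))\<^sup>\<bullet> * z (H - 1)"
      by (subst H) (rule sum.lessThan_Suc)
    moreover have "(\<Sum>k<H - 1. (z k)\<^sup>\<bullet> * z k) = (\<Sum>k<H - 1. (\<eta> - l k) *\<^sub>R q k)"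
      using l0 by (intro sum.cong) (simp_all add: z_def q_star q_mult)
    moreover have "(z (H - 1))\<^sup>\<bullet> * z (H - 1) = \<eta> *\<^sub>R ((1 - S) * (1 - S))"
      using eta by (simp add: z_def S_star)
    ultimately show ?thesis by simp
  qed
  also have "(1 - S) * (1 - S) = 1 - S" by (simp add: algebra_simps S_idem)
  also have "(\<Sum>k<H - 1. (\<eta> - l k) *\<^sub>R q k) = \<eta> *\<^sub>R S - (\<Sum>k<H - 1. l k *\<^sub>R q k)"
    by (simp add: S_def scaleR_sum_right sum_subtractf algebra_simps)
  finally show ?thesis using DD by (auto simp: algebra_simps of_real_def intro!: exI[of _ z])
qed

subsection \<open>The remainder\<close>

lemma sum_sigma_e: "(\<Sum>i<R * T. \<sigma> i e) = (\<Sum>j<R. \<sigma> j P) + (\<Sum>j<R. \<Sum>k<H. \<sigma> j (u k))"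
proof -
  have "(\<Sum>i<R * T. \<sigma> i e) = (\<Sum>k<T. \<Sum>i=k * R..<k * R + R. \<sigma> i e)"
    using sum.nat_group[of "\<lambda>i. \<sigma> i e" R T] by (simp add: mult.commute)
  also have "\<dots> = (\<Sum>k<T. \<Sum>j<R. \<sigma> j (E k k))"
  proof (rule sum.cong)
    fix k
    have "(\<Sum>i=k * R..<k * R + R. \<sigma> i e) = (\<Sum>j<R. \<sigma> (j + k * R) e)"
      using sum.shift_bounds_nat_ivl[of "\<lambda>i. \<sigma> i e" 0 "k * R" R] by (simp add: lessThan_atLeast0 add.commute)
    then show "(\<Sum>i=k * R..<k * R + R. \<sigma> i e) = (\<Sum>j<R. \<sigma> j (E k k))"
      by (simp add: E_diag sigma_sigma mult.commute)
  qed simp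
  also have "\<dots> = (\<Sum>j<R. \<Sum>k<T. \<sigma> j (E k k))" by (rule sum.swap)
  also have "\<dots> = (\<Sum>j<R. \<sigma> j P + (\<Sum>k<H. \<sigma> j (u k)))"
    by (simp add: sum_E_diag sigma_add flip: sigma_sum)
  finally show ?thesis by (simp add: sum.distrib)
qed

text \<open>Each piece \<open>\<sigma> j (u k)\<close> of the remainder is moved to \<open>M\<close> different rungs, so the sum
  \<open>1 = \<Sum> x\<^sub>i y\<^sup>2 x\<^sub>i\<^sup>\<bullet>\<close> is realised inside the right ideal of \<open>y\<close>.\<close>

lemma remainder:
  fixes x :: "nat \<Rightarrow> 'a asq" and y z :: "'a asq"
  assumes y: "y\<^sup>\<bullet> = y" and yz: "y * z = 0" and z: "z\<^sup>\<bullet> * z = 1 - (\<Sum>i<R * T. \<sigma> i e)"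
    and one: "(\<Sum>i<M. x i * (y * y) * (x i)\<^sup>\<bullet>) = 1" and le: "H * M \<le> T"
    and y_E: "\<And>i k l. i < R \<Longrightarrow> k < T \<Longrightarrow> l < T \<Longrightarrow> y * \<sigma> i (E k l) = \<sigma> i (E k l) * y"
    and x_E: "\<And>i k l m. i < R \<Longrightarrow> k < T \<Longrightarrow> l < T \<Longrightarrow> m < M \<Longrightarrow> x m * \<sigma> i (E k l) = \<sigma> i (E k l) * x m"
  shows "\<exists>b. (z + y * b)\<^sup>\<bullet> * (z + y * b) = 1 - (\<Sum>j<R. \<sigma> j P)"
proof -
  define I where "I = {..<R} \<times> {..<H} \<times> {..<M}"
  \<comment> \<open>The triple (j, k, i) sends the piece \<open>\<sigma> j (u k)\<close> to rung k M
    + i in residue class j. Distinct triples have distinct targets, so all cross terms vanish; for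
    fixed (j, k) the sum over i reproduces the piece.\<close>
  define g where "g = (\<lambda>(j, k, i). \<sigma> j (B (k * M + i) k) * (x i)\<^sup>\<bullet>)"
  define b where "b = (\<Sum>\<iota>\<in>I. g \<iota>)"
  have kap: "k * M + i < T" if "k < H" "i < M" for k i
  proof -
    have "k * M + i < Suc k * M" using that by simp
    also have "\<dots> \<le> H * M" using that by (intro mult_le_mono1) simp
    finally show ?thesis using le by simp
  qed
  have kT: "k < T" "k + C < T" if "k < H" for k using that T_eq H_le by auto
  have yB: "y * \<sigma> j (B \<kappa> k) = \<sigma> j (B \<kappa> k) * y" if "j < R" "\<kappa> < T" "k < H" for j \<kappa> k
    using y_E that kT[OF that(3)] by (simp add: B_def sigma_simps algebra_simps)
  have xu: "\<sigma> j (u k) * (x m)\<^sup>\<bullet> = (x m)\<^sup>\<bullet> * \<sigma> j (u k)" if "j < R" "k < H" "m < M" for j k m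
  proof -
    have "x m * \<sigma> j (u k) = \<sigma> j (u k) * x m"
      using x_E that kT[OF that(2)] by (simp add: u_def sigma_simps algebra_simps)
    from arg_cong[OF this, of asq_star] show ?thesis by (simp add: u_star flip: sigma_star)
  qed
  have prod: "(y * g \<iota>)\<^sup>\<bullet> * (y * g \<iota>') =
      (if \<iota> = \<iota>' then (case \<iota> of (j, k, i) \<Rightarrow> (x i * (y * y) * (x i)\<^sup>\<bullet>) * \<sigma> j (u k)) else 0)"
    if I: "\<iota> \<in> I" "\<iota>' \<in> I" for \<iota> \<iota>'
  proof -
    obtain j k i j' k' i' where \<iota>: "\<iota> = (j, k, i)" "\<iota>' = (j', k', i')" by (metis prod_cases3)
    then have lt: "j < R" "k < H" "i < M" "j' < R" "k' < H" "i' < M" using I by (auto simp: I_def)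
    define b1 where "b1 = \<sigma> j (B (k * M + i) k)"
    define b2 where "b2 = \<sigma> j' (B (k' * M + i') k')"
    have yb: "y * b1 = b1 * y" "y * b2 = b2 * y" unfolding b1_def b2_def using lt kap by (auto intro: yB)
    have yb1: "y * b1\<^sup>\<bullet> = b1\<^sup>\<bullet> * y" using arg_cong[OF yb(1), of asq_star] y by simp
    have y3: "b1\<^sup>\<bullet> * (y * t) = y * (b1\<^sup>\<bullet> * t)" for t
      using yb1 by (simp flip: mult.assoc)
    have "(y * g \<iota>)\<^sup>\<bullet> * (y * g \<iota>') = x i * (b1\<^sup>\<bullet> * (y * (y * (b2 * (x i')\<^sup>\<bullet>))))"
      by (simp add: \<iota> g_def b1_def b2_def y mult.assoc)
    then have eq: "(y * g \<iota>)\<^sup>\<bullet> * (y * g \<iota>') = x i * (y * y) * (b1\<^sup>\<bullet> * b2) * (x i')\<^sup>\<bullet>"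
      by (simp only: y3 mult.assoc)
    show ?thesis
    proof (cases "\<iota> = \<iota>'")
      case True
      then have "b1\<^sup>\<bullet> * b2 = \<sigma> j (u k)"
        using lt kap by (simp add: \<iota> b1_def b2_def B_star_mult(1))
      moreover have "x i * (y * y) * \<sigma> j (u k) * (x i)\<^sup>\<bullet> = x i * (y * y) * (x i)\<^sup>\<bullet> * \<sigma> j (u k)"
        using xu[of j k i] lt by (simp add: mult.assoc)
      moreover have "i' = i" using True \<iota> by simp
      ultimately have "(y * g \<iota>)\<^sup>\<bullet> * (y * g \<iota>') = x i * (y * y) * (x i)\<^sup>\<bullet> * \<sigma> j (u k)"
        unfolding eq by simp
      then show ?thesis using True by (simp only: \<iota>) simp
    next
      case False
      have "\<not> (j = j' \<and> k * M + i = k' * M + i')"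
      proof
        assume *: "j = j' \<and> k * M + i = k' * M + i'"
        then have "(k * M + i) div M = (k' * M + i') div M" "(k * M + i) mod M = (k' * M + i') mod M" by simp_all
        moreover have "(k * M + i) div M = k" "(k * M + i) mod M = i" if "i < M" for k i
          by (use that in simp_all)
        ultimately have "k = k'" "i = i'" using lt by metis+
        then show False using * False by (simp add: \<iota>)
      qed
      then have "b1\<^sup>\<bullet> * b2 = 0" unfolding b1_def b2_def using lt kap by (intro B_star_mult(2)) auto
      then show ?thesis using False unfolding eq by simp
    qed
  qed
  have fin: "finite I" by (simp add: I_def)
  have yb: "y * b = (\<Sum>\<iota>\<in>I. y * g \<iota>)" by (simp add: b_def sum_distrib_left)
  have "(y * b)\<^sup>\<bullet> * (y * b) = (\<Sum>\<iota>\<in>I. \<Sum>\<iota>'\<in>I. (y * g \<iota>)\<^sup>\<bullet> * (y * g \<iota>'))"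
    unfolding yb asq_star_sum by (rule sum_product)
  also have "\<dots> = (\<Sum>\<iota>\<in>I. case \<iota> of (j, k, i) \<Rightarrow> (x i * (y * y) * (x i)\<^sup>\<bullet>) * \<sigma> j (u k))"
  proof (rule sum.cong)
    fix \<iota> assume \<iota>: "\<iota> \<in> I"
    have "(\<Sum>\<iota>'\<in>I. (y * g \<iota>)\<^sup>\<bullet> * (y * g \<iota>')) = (\<Sum>\<iota>'\<in>I. if \<iota> = \<iota>' then
        (case \<iota> of (j, k, i) \<Rightarrow> (x i * (y * y) * (x i)\<^sup>\<bullet>) * \<sigma> j (u k)) else 0)"
      by (intro sum.cong refl prod \<iota>)
    then show "(\<Sum>\<iota>'\<in>I. (y * g \<iota>)\<^sup>\<bullet> * (y * g \<iota>')) =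
        (case \<iota> of (j, k, i) \<Rightarrow> (x i * (y * y) * (x i)\<^sup>\<bullet>) * \<sigma> j (u k))"
      using fin \<iota> by (simp only: sum.delta' if_True)
  qed simp
  also have "\<dots> = (\<Sum>j<R. \<Sum>k<H. \<Sum>i<M. (x i * (y * y) * (x i)\<^sup>\<bullet>) * \<sigma> j (u k))"
    by (simp add: I_def sum.cartesian_product split_def)
  also have "\<dots> = (\<Sum>j<R. \<Sum>k<H. \<sigma> j (u k))" by (simp only: one mult_1_left flip: sum_distrib_right)
  finally have bb: "(y * b)\<^sup>\<bullet> * (y * b) = (\<Sum>j<R. \<Sum>k<H. \<sigma> j (u k))" .
  \<comment> \<open>Orthogonality of \<open>y\<close> and \<open>z\<close> removes the mixed terms,
    so the two parts of the remainder add without interference.\<close>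
  have "z\<^sup>\<bullet> * y = 0" using arg_cong[OF yz, of asq_star] y by simp
  then have zy: "z\<^sup>\<bullet> * (y * b) = 0" "(y * b)\<^sup>\<bullet> * z = 0" using yz y by (simp_all add: mult.assoc) (simp flip: mult.assoc)
  have "(z + y * b)\<^sup>\<bullet> * (z + y * b) = z\<^sup>\<bullet> * z + z\<^sup>\<bullet> * (y * b) + (y * b)\<^sup>\<bullet> * z + (y * b)\<^sup>\<bullet> * (y * b)"
    by (simp only: asq_star_add distrib_left distrib_right add_ac)
  also have "\<dots> = 1 - (\<Sum>j<R. \<sigma> j P)" unfolding zy bb z sum_sigma_e by simp
  finally show ?thesis by blast
qed

end

subsection \<open>Lifting projections\<close>

lemma Bseq_cs_projection: "(\<And>n. cs_projection (X n)) \<Longrightarrow> Bseq X"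
  unfolding Bseq_iff_norm_le using norm_cs_projection_le by blast

lemma Bseq_cs_unitary: "(\<And>n. cs_unitary (X n)) \<Longrightarrow> Bseq X"
  unfolding Bseq_iff_norm_le using norm_cs_unitary_mult(1)[of _ 1]
  by (metis mult.right_neutral norm_one order_refl)

text \<open>Induction keeps orthogonality exact: a representative of the next projection is
  symmetrised and compressed by the complement \<open>q n\<close> of those already lifted, and a
  genuine projection is then found under \<open>q n\<close>.\<close>

lemma lift_orthogonal_projections:
  fixes g :: "nat \<Rightarrow> 'a::cstar_algebra asq"
  assumes "\<And>i. i < N \<Longrightarrow> (g i)\<^sup>\<bullet> = g i" "\<And>i. i < N \<Longrightarrow> g i * g i = g i"
    "\<And>i j. i < N \<Longrightarrow> j < N \<Longrightarrow> i \<noteq> j \<Longrightarrow> g i * g j = 0"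
  shows "\<exists>f. (\<forall>i<N. \<forall>n. cs_projection (f i n)) \<and>
    (\<forall>i<N. \<forall>j<N. i \<noteq> j \<longrightarrow> (\<forall>n. f i n * f j n = 0)) \<and> (\<forall>i<N. asq_of (f i) = g i)"
  using assms
proof (induction N)
  case (Suc N)
  obtain f where f: "\<And>i n. i < N \<Longrightarrow> cs_projection (f i n)"
    "\<And>i j n. i < N \<Longrightarrow> j < N \<Longrightarrow> i \<noteq> j \<Longrightarrow> f i n * f j n = 0"
    "\<And>i. i < N \<Longrightarrow> asq_of (f i) = g i"
  proof -
    have "\<exists>f. (\<forall>i<N. \<forall>n. cs_projection (f i n)) \<and>
      (\<forall>i<N. \<forall>j<N. i \<noteq> j \<longrightarrow> (\<forall>n. f i n * f j n = 0)) \<and> (\<forall>i<N. asq_of (f i) = g i)"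
      by (rule Suc.IH) (auto intro: Suc.prems)
    then show ?thesis using that by metis
  qed
  define q where "q n = 1 - (\<Sum>i<N. f i n)" for n
  have q: "cs_projection (q n)" for n
    unfolding q_def by (intro cs_projection_complement cs_projection_sum) (auto intro: f)
  have q': "(q n)\<^sup>\<star> = q n" "q n * q n = q n" for n using q[of n] by (simp_all add: cs_projection_def)
  have fq: "f i n * q n = 0" "q n * f i n = 0" if "i < N" for i n
  proof -
    have "f i n * (\<Sum>j<N. f j n) = (\<Sum>j<N. if i = j then f i n else 0)"
      unfolding sum_distrib_left using f(1)[OF that, of n] f(2)[OF that, of _ n]
      by (intro sum.cong) (auto simp: cs_projection_def)
    moreover have "(\<Sum>j<N. f j n) * f i n = (\<Sum>j<N. if i = j then f i n else 0)"
      unfolding sum_distrib_right using f(1)[OF that, of n] f(2)[OF _ that, of _ n]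
      by (intro sum.cong) (auto simp: cs_projection_def)
    ultimately show "f i n * q n = 0" "q n * f i n = 0"
      using that by (simp_all add: q_def right_diff_distrib left_diff_distrib)
  qed
  obtain X where X: "Bseq X" "g N = asq_of X" by (rule asq_exhaust)
  define A where "A n = q n * ((1/2) *\<^sub>R (X n + (X n)\<^sup>\<star>)) * q n" for n
  have Bf: "Bseq (f i)" if "i < N" for i using f(1)[OF that] by (rule Bseq_cs_projection)
  have Bq: "Bseq q" using q by (rule Bseq_cs_projection)
  have BX: "Bseq (\<lambda>n. (1/2) *\<^sub>R (X n + (X n)\<^sup>\<star>))" by (intro Bseq_scale Bseq_plus Bseq_cs_star X)
  have BA: "Bseq A" unfolding A_def by (intro Bseq_times Bq BX)
  have "asq_of q = 1 - (\<Sum>i<N. g i)"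
  proof -
    have BS: "Bseq (\<lambda>n. \<Sum>i<N. f i n)" by (rule Bseq_sum) (simp add: Bf)
    have "asq_of (\<lambda>n. \<Sum>i<N. f i n) = (\<Sum>i<N. asq_of (f i))"
      by (rule asq_of_sum[symmetric]) (simp add: Bf)
    then show ?thesis using asq_of_diff[OF _ BS, of "\<lambda>_. 1"] f(3)
      by (simp add: q_def[abs_def] asq_one_eq)
  qed
  moreover have "asq_of (\<lambda>n. (1/2) *\<^sub>R (X n + (X n)\<^sup>\<star>)) = g N"
  proof -
    have "asq_of (\<lambda>n. (1/2) *\<^sub>R (X n + (X n)\<^sup>\<star>)) = (1/2) *\<^sub>R (asq_of X + (asq_of X)\<^sup>\<bullet>)"
      using X(1) by (simp add: asq_of_star asq_of_add asq_of_scaleR Bseq_plus Bseq_cs_star)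
    also have "\<dots> = g N" using X(2)[symmetric] Suc.prems(1)[of N] by (simp flip: scaleR_2)
    finally show ?thesis .
  qed
  moreover have "asq_of A = asq_of q * asq_of (\<lambda>n. (1/2) *\<^sub>R (X n + (X n)\<^sup>\<star>)) * asq_of q"
    unfolding A_def[abs_def] asq_of_mult[OF Bq BX] asq_of_mult[OF Bseq_times[OF Bq BX] Bq] ..
  moreover have "(1 - (\<Sum>i<N. g i)) * g N = g N" "g N * (1 - (\<Sum>i<N. g i)) = g N"
    using Suc.prems(3)[of _ N] Suc.prems(3)[of N]
    by (simp_all add: left_diff_distrib right_diff_distrib sum_distrib_left sum_distrib_right)
  ultimately have gA: "asq_of A = g N" by simp
  have A: "(A n)\<^sup>\<star> = A n" "q n * A n = A n" "A n * q n = A n" for n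
    by (simp_all add: A_def q' mult.assoc add.commute) (simp_all add: q' flip: mult.assoc)
  have "asq_of (\<lambda>n. A n * A n) = asq_of A"
    using Suc.prems(2)[of N] gA BA by (simp flip: asq_of_mult)
  then have lim: "(\<lambda>n. A n * A n - A n) \<longlonglongrightarrow> 0" using BA by (simp add: asq_of_eq_iff Bseq_times)
  \<comment> \<open>For the finitely many indices at which \<open>A n\<close> is not yet nearly
    idempotent, the projection 0 is used, which does not affect the class.\<close>
  define good where "good n \<longleftrightarrow> norm (A n * A n - A n) \<le> 1/8" for n
  have "\<forall>n. \<exists>p. cs_projection p \<and> q n * p = p \<and> p * q n = p \<and>
      (good n \<longrightarrow> norm (p - A n) \<le> 8 * norm (A n * A n - A n))"
  proof
    fix n
    show "\<exists>p. cs_projection p \<and> q n * p = p \<and> p * q n = p \<and>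
      (good n \<longrightarrow> norm (p - A n) \<le> 8 * norm (A n * A n - A n))"
    proof (cases "good n")
      case True
      then show ?thesis using exists_projection_near[OF q A] unfolding good_def by blast
    qed (auto intro!: exI[of _ 0])
  qed
  then obtain h where h: "\<And>n. cs_projection (h n)" "\<And>n. q n * h n = h n" "\<And>n. h n * q n = h n"
      "\<And>n. good n \<Longrightarrow> norm (h n - A n) \<le> 8 * norm (A n * A n - A n)" by metis
  have "eventually (\<lambda>n. norm (A n * A n - A n) < 1/8) sequentially"
    by (rule order_tendstoD(2)[OF tendsto_norm_zero[OF lim]]) simp
  then have ev: "eventually (\<lambda>n. norm (h n - A n) \<le> 8 * norm (A n * A n - A n)) sequentially"
    by (rule eventually_mono) (auto intro!: h(4) simp: good_def)
  have "(\<lambda>n. 8 * norm (A n * A n - A n)) \<longlonglongrightarrow> 0"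
    using tendsto_mult_left[OF tendsto_norm_zero[OF lim], of 8] by simp
  then have "(\<lambda>n. h n - A n) \<longlonglongrightarrow> 0" by (rule Lim_null_comparison[OF ev])
  then have gh: "asq_of h = g N" 
    using BA Bseq_cs_projection[OF h(1)] by (simp flip: gA add: asq_of_eq_iff)
  have fh: "f i n * h n = 0" "h n * f i n = 0" if "i < N" for i n
    using fq[OF that, of n] h(2,3)[of n] by (metis mult.assoc mult_zero_left mult_zero_right)+
  show ?case
    by (rule exI[of _ "f(N := h)"]) (auto simp: less_Suc_eq f h gh fh)
qed simp

subsection \<open>Orthogonal elements below a positive element\<close>

text \<open>Compressing x f x <= x g x by f gives (f x f)^2 <= f x g x f, and the right side is
  small because f nearly commutes with x and f g = 0. Thus f x f, and with it f x, is small.\<close>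

lemma norm_compress_le:
  fixes x f g :: "'a::cstar_algebra"
  assumes x: "x\<^sup>\<star> = x" and f: "cs_projection f" and g: "cs_projection g" and fg: "f * g = 0"
    and comm: "norm (f * x - x * f) \<le> \<delta>" and pos: "pos (x * g * x - x * f * x)"
  shows "norm (f * x) \<le> sqrt (norm x * \<delta>) + \<delta>"
proof -
  have f': "f\<^sup>\<star> = f" "f * f = f" and g': "g\<^sup>\<star> = g" "g * g = g"
    using f g by (simp_all add: cs_projection_def)
  have nf: "norm f \<le> 1" "norm g \<le> 1" using f g by (simp_all add: norm_cs_projection_le)
  obtain k where k: "k\<^sup>\<star> = k" "k * k = x * g * x - x * f * x" using pos_sqrt[OF pos] by blast
  define y where "y = f * x * f"
  have y: "y\<^sup>\<star> = y" by (simp add: y_def f' x mult.assoc)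
  have "y\<^sup>\<star> * y = f * (x * f * x) * f"
    unfolding y by (simp add: y_def mult.assoc) (simp add: f' flip: mult.assoc)
  moreover have "(k * f)\<^sup>\<star> * (k * f) = f * (k * k) * f"
    by (simp only: cs_star_mult k(1) f'(1) mult.assoc)
  ultimately have eq: "y\<^sup>\<star> * y + (k * f)\<^sup>\<star> * (k * f) = f * (x * g * x) * f"
    unfolding k(2) by (simp add: right_diff_distrib left_diff_distrib)
  have "norm (y\<^sup>\<star> * y) \<le> norm (y\<^sup>\<star> * y + (k * f)\<^sup>\<star> * (k * f))"
    by (intro norm_le_add_pos pos_star_mult)
  then have "(norm y)\<^sup>2 \<le> norm (f * (x * g * x) * f)" by (simp only: eq cs_cstar_identity)
  also have "f * (x * g * x) * f = (f * x - x * f) * g * x * f" using fg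
    by (simp add: left_diff_distrib mult.assoc)
  also have "norm \<dots> \<le> norm (f * x - x * f) * norm g * norm x * norm f"
    by (intro order_trans[OF norm_mult_ineq] mult_right_mono order_refl norm_ge_zero)
  also have "\<dots> \<le> \<delta> * 1 * norm x * 1"
    using nf comm order_trans[OF norm_ge_zero comm] by (intro mult_mono) auto
  finally have "(norm y)\<^sup>2 \<le> norm x * \<delta>" by (simp add: mult.commute)
  then have ny: "norm y \<le> sqrt (norm x * \<delta>)" by (rule real_le_rsqrt)
  have "f * x = y + f * (f * x - x * f)" by (simp add: y_def right_diff_distrib f' flip: mult.assoc)
  then have "norm (f * x) \<le> norm y + norm (f * (f * x - x * f))" by (metis norm_triangle_ineq)
  also have "norm (f * (f * x - x * f)) \<le> 1 * \<delta>"
    using nf comm by (intro order_trans[OF norm_mult_ineq] mult_mono) auto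
  finally show ?thesis using ny by simp
qed

text \<open>For a Rokhlin pair \<open>e\<^sub>0\<close>, \<open>e\<^sub>1\<close> that nearly commutes with \<open>x\<close>, the element \<open>x (e\<^sub>0 - e\<^sub>1) x\<close> has nonzero
  positive and negative parts.\<close>

lemma exists_orthogonal_pair:
  fixes x :: "'a::cstar_algebra" and \<alpha> :: "'a \<Rightarrow> 'a"
  assumes simple: "cs_simple TYPE('a)" and \<alpha>: "cs_automorphism \<alpha>" and rok: "tracial_rokhlin \<alpha>"
    and x: "cs_positive x" "x \<noteq> 0" and not_le: "\<not> cs_subeq 1 x"
  shows "\<exists>x' y c c'. cs_positive x' \<and> x' \<noteq> 0 \<and> y\<^sup>\<star> = y \<and> y \<noteq> 0 \<and> y * x' = 0 \<and> x' = x * c' \<and> y = x * c"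
proof -
  have x': "x\<^sup>\<star> = x" using x(1) by (auto simp: cs_positive_def)
  obtain m and a b :: "nat \<Rightarrow> 'a" where ab: "1 = (\<Sum>i<m. a i * x * b i)"
    using simple_one_eq_sum[OF simple x(2)] by blast
  \<comment> \<open>These constants bound a projection e that commutes up to \<delta> with the
    \<open>a i\<close>: inserting the decomposition of 1 gives norm e <= \<delta> L + K norm(e
    x).\<close>
  define K where "K = (\<Sum>i<m. norm (a i) * norm (b i))"
  define L where "L = (\<Sum>i<m. norm x * norm (b i))"
  define S where "S = L + K * sqrt (norm x) + K"
  have KL: "K \<ge> 0" "L \<ge> 0" by (auto simp: K_def L_def intro: sum_nonneg)
  then have S0: "S \<ge> 0" by (simp add: S_def)
  define t where "t = 1 / (2 + S)"
  have t: "0 < t" "t < 1" "t * S < 1" using S0 by (auto simp: t_def field_simps)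
  \<comment> \<open>A square, so that sqrt(norm x \<delta>) is linear in t and the whole estimate is
    at most t S < 1.\<close>
  define \<delta> where "\<delta> = t * t"
  have "t * t < 1 * 1" using t by (intro mult_strict_mono) auto
  then have d: "0 < \<delta>" "\<delta> < 1" using t by (auto simp: \<delta>_def)
  have dt: "\<delta> \<le> t" using t by (simp add: \<delta>_def mult_left_le)
  have small: "\<delta> * L + K * (sqrt (norm x * \<delta>) + \<delta>) < 1"
  proof -
    have "sqrt (norm x * \<delta>) = sqrt (norm x) * t" using t by (simp add: real_sqrt_mult \<delta>_def)
    then have "\<delta> * L + K * (sqrt (norm x * \<delta>) + \<delta>) \<le> t * L + K * (sqrt (norm x) * t + t)"
      using dt KL t d by (intro add_mono mult_mono) auto
    also have "\<dots> = t * S" by (simp add: S_def algebra_simps)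
    finally show ?thesis using t by simp
  qed
  have "finite (insert x (a ` {..<m})) \<and> \<delta> > 0 \<and> cs_positive x \<and> x \<noteq> 0" using d x by simp
  from rok[unfolded tracial_rokhlin_def, rule_format, OF this, of 1]
  obtain e where e: "\<And>j. j \<le> 1 \<Longrightarrow> cs_projection (e j)"
    "\<And>i j. i \<le> 1 \<Longrightarrow> j \<le> 1 \<Longrightarrow> i \<noteq> j \<Longrightarrow> e i * e j = 0"
    "\<And>j. j < 1 \<Longrightarrow> norm (\<alpha> (e j) - e (Suc j)) < \<delta>"
    "\<And>j z. j \<le> 1 \<Longrightarrow> z \<in> insert x (a ` {..<m}) \<Longrightarrow> norm (e j * z - z * e j) < \<delta>"
    "cs_subeq (1 - (\<Sum>j\<le>(1::nat). e j)) x"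
    by (metis (no_types, lifting))
  have sum_e: "(\<Sum>j\<le>(1::nat). e j) = e 0 + e 1" by (simp add: atMost_Suc)
  have close: "norm (\<alpha> (e 0) - e 1) < 1" using e(3)[of 0] d by simp
  \<comment> \<open>As \<alpha> is isometric, one of the two projections vanishes only together with
    the other; both vanishing would make 1 subequivalent to \<open>x\<close>.\<close>
  have nz: "e 0 \<noteq> 0" "e 1 \<noteq> 0"
  proof -
    have "e 1 = 0" if "e 0 = 0"
      using close that cs_projection_eq_0[OF e(1)[of 1]] by (simp add: cs_automorphism_zero[OF \<alpha>])
    moreover have "e 0 = 0" if "e 1 = 0"
      using close that cs_projection_eq_0[OF e(1)[of 0]] by (simp add: cs_automorphism_norm[OF \<alpha>])
    moreover have "\<not> (e 0 = 0 \<and> e 1 = 0)" using e(5) not_le by (auto simp: sum_e)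
    ultimately show "e 0 \<noteq> 0" "e 1 \<noteq> 0" by auto
  qed
  have large: "\<not> norm (e j * x) \<le> sqrt (norm x * \<delta>) + \<delta>" if j: "j \<le> 1" "e j \<noteq> 0" for j
  proof
    assume le: "norm (e j * x) \<le> sqrt (norm x * \<delta>) + \<delta>"
    have ej: "e j = (\<Sum>i<m. (e j * a i - a i * e j) * x * b i + a i * (e j * x) * b i)"
      using arg_cong[OF ab, of "\<lambda>z. e j * z"] by (simp add: sum_distrib_left algebra_simps)
    have "norm (e j) \<le> (\<Sum>i<m. norm ((e j * a i - a i * e j) * x * b i + a i * (e j * x) * b i))"
      using norm_sum[of "\<lambda>i. (e j * a i - a i * e j) * x * b i + a i * (e j * x) * b i" "{..<m}"]
      by (simp only: ej[symmetric])
    also have "\<dots> \<le> (\<Sum>i<m. \<delta> * (norm x * norm (b i)) + norm (a i) * norm (b i) * norm (e j * x))"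
    proof (rule sum_mono, rule norm_triangle_mono)
      fix i assume i: "i \<in> {..<m}"
      have "norm ((e j * a i - a i * e j) * x * b i) \<le> norm (e j * a i - a i * e j) * norm x * norm (b i)"
        by (intro order_trans[OF norm_mult_ineq] mult_right_mono order_refl norm_ge_zero)
      also have "\<dots> \<le> \<delta> * norm x * norm (b i)"
        using e(4)[OF j(1), of "a i"] i by (intro mult_right_mono) auto
      finally show "norm ((e j * a i - a i * e j) * x * b i) \<le> \<delta> * (norm x * norm (b i))"
        by (simp add: mult.assoc)
      have "norm (a i * (e j * x) * b i) \<le> norm (a i) * norm (e j * x) * norm (b i)"
        by (intro order_trans[OF norm_mult_ineq] mult_right_mono order_refl norm_ge_zero)
      then show "norm (a i * (e j * x) * b i) \<le> norm (a i) * norm (b i) * norm (e j * x)"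
        by (simp add: mult_ac)
    qed
    also have "\<dots> = \<delta> * L + K * norm (e j * x)"
      by (simp add: sum.distrib K_def L_def sum_distrib_left sum_distrib_right)
    also have "\<dots> \<le> \<delta> * L + K * (sqrt (norm x * \<delta>) + \<delta>)"
      using le KL by (intro add_left_mono mult_left_mono) auto
    finally have "norm (e j) < 1" using small by simp
    then show False using cs_projection_eq_0[OF e(1)[OF j(1)]] j(2) by simp
  qed
  define h where "h = x * (e 0 - e 1) * x"
  have e': "(e 0)\<^sup>\<star> = e 0" "(e 1)\<^sup>\<star> = e 1" using e(1)[of 0] e(1)[of 1] by (simp_all add: cs_projection_def)
  have h: "h\<^sup>\<star> = h" using e' by (simp add: h_def x' mult.assoc)
  obtain r where r: "pos r" "r\<^sup>\<star> = r" "r * r = h * h" "r * h = h * r"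
    using absolute_value[OF h] by blast
  define p where "p = r + h"
  define n where "n = r - h"
  have pn: "p\<^sup>\<star> = p" "n\<^sup>\<star> = n" "p * h = h * p" "n * h = h * n" "n * p = 0"
    using r h by (auto simp: p_def n_def algebra_simps)
  have ex: "norm (e j * x - x * e j) \<le> \<delta>" if "j \<le> 1" for j using e(4)[OF that, of x] by simp
  have e01: "cs_projection (e 0)" "cs_projection (e 1)" "e 0 * e 1 = 0" "e 1 * e 0 = 0"
    by (rule e(1) e(2); simp)+
  have p0: "p \<noteq> 0"
  proof
    assume "p = 0"
    then have "pos (- h)" using r(1) by (simp add: p_def add_eq_0_iff2)
    then have "pos (x * e 1 * x - x * e 0 * x)" by (simp add: h_def left_diff_distrib right_diff_distrib)
    then have "norm (e 0 * x) \<le> sqrt (norm x * \<delta>) + \<delta>"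
      by (rule norm_compress_le[OF x' e01(1-3) ex[OF zero_le_one]])
    then show False using large[of 0] nz by simp
  qed
  have n0: "n \<noteq> 0"
  proof
    assume "n = 0"
    then have "pos h" using r(1) by (simp add: n_def)
    then have "pos (x * e 0 * x - x * e 1 * x)" by (simp add: h_def left_diff_distrib right_diff_distrib)
    then have "norm (e 1 * x) \<le> sqrt (norm x * \<delta>) + \<delta>"
      by (rule norm_compress_le[OF x' e01(2,1,4) ex[OF order_refl]])
    then show False using large[of 1] nz by simp
  qed
  have pp: "p * p = 2 *\<^sub>R (h * p)" "n * n = - (2 *\<^sub>R (h * n))"
    using r(3,4) by (simp_all add: p_def n_def scaleR_2 algebra_simps)
  have ph: "p * h \<noteq> 0"
  proof
    assume "p * h = 0"
    then have "p\<^sup>\<star> * p = 0" using pp pn by simp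
    then show False using p0 by (simp only: cs_star_mult_eq_0)
  qed
  \<comment> \<open>The factors \<open>h\<close> place both elements in the right ideal of x. They
    do not destroy them: \<open>h\<close> multiplies \<open>p\<close> to half of p^2 and
    \<open>n\<close> to minus half of n^2.\<close>
  define x1 where "x1 = (p * h)\<^sup>\<star> * (p * h)"
  define y where "y = h * n * h"
  have "y = (1/4) *\<^sub>R (n * n * n)"
  proof -
    have hn: "h * n = (- 1/2) *\<^sub>R (n * n)" by (simp add: pp)
    have "y = h * (h * n)" by (simp add: y_def pn mult.assoc)
    also have "\<dots> = h * ((- 1/2) *\<^sub>R (n * n))" by (simp only: hn)
    also have "\<dots> = (- 1/2) *\<^sub>R ((h * n) * n)" by (simp add: mult.assoc)
    also have "\<dots> = (1/4) *\<^sub>R (n * n * n)" unfolding hn by simp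
    finally show ?thesis .
  qed
  moreover have "n * n * n \<noteq> 0"
  proof
    assume "n * n * n = 0"
    then have "(n * n)\<^sup>\<star> * (n * n) = 0" by (simp add: pn flip: mult.assoc)
    then have "n * n = 0" unfolding cs_star_mult_eq_0 .
    then show False using n0 cs_star_mult_eq_0[of n] by (simp add: pn)
  qed
  ultimately have y0: "y \<noteq> 0" by simp
  have "x1 \<noteq> 0" using ph by (simp only: x1_def cs_star_mult_eq_0 not_False_eq_True)
  moreover have "cs_positive x1" unfolding cs_positive_def x1_def by blast
  moreover have "y\<^sup>\<star> = y" by (simp add: y_def pn h mult.assoc)
  moreover have "y * x1 = 0"
  proof -
    have nh: "n * (h * t) = h * (n * t)" for t using pn(4) by (simp flip: mult.assoc)
    have "y * x1 = h * (n * (h * (h * (p * (p * h)))))" by (simp only: y_def x1_def cs_star_mult pn(1) h mult.assoc)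
    also have "\<dots> = h * (h * (h * (n * p * (p * h))))" by (simp only: nh mult.assoc)
    also have "\<dots> = 0" by (simp add: pn(5))
    finally show ?thesis .
  qed
  moreover have "x1 = x * ((e 0 - e 1) * x * p * p * h)" 
    by (simp only: x1_def cs_star_mult pn(1) h) (simp only: h_def mult.assoc)
  moreover have "y = x * ((e 0 - e 1) * x * n * h)" 
    by (simp only: y_def) (simp only: h_def mult.assoc)
  ultimately show ?thesis using y0 by blast
qed

subsection \<open>Towers with a unitary that moves the bottom rung\<close>

text \<open>If \<open>\<alpha>\<^sup>R\<close> is the limit of the \<open>Ad u\<^sub>n\<close>, then \<open>w = u\<^sub>m\<^sup>\<star> u\<^sub>n\<close> nearly commutes with \<open>G\<close> for large \<open>m\<close>, \<open>n\<close>.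
  Choosing \<open>m\<close> before and \<open>n\<close> after the tower, which is made to commute with \<open>u\<^sub>m\<close>, we get
  \<open>w e\<^sub>0 w\<^sup>\<star> \<approx> u\<^sub>m\<^sup>\<star> \<alpha>\<^sup>R(e\<^sub>0) u\<^sub>m \<approx> e\<^sub>R\<close>.\<close>

lemma tower_approx:
  fixes \<alpha> :: "'a::cstar_algebra \<Rightarrow> 'a"
  assumes \<alpha>: "cs_automorphism \<alpha>" and rok: "tracial_rokhlin \<alpha>" and inner: "cs_approx_inner (\<alpha> ^^ R)"
    and R: "R < N" and G: "finite G" and x: "cs_positive x" "x \<noteq> 0" and d: "\<delta> > 0"
  shows "\<exists>e w z. (\<forall>j<N. cs_projection (e j)) \<and> (\<forall>i<N. \<forall>j<N. i \<noteq> j \<longrightarrow> e i * e j = 0) \<and>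
      (\<forall>j<N. norm ((\<alpha> ^^ j) (e 0) - e j) \<le> real N * \<delta>) \<and> (\<forall>j<N. \<forall>g\<in>G. norm (e j * g - g * e j) \<le> \<delta>) \<and>
      cs_unitary w \<and> (\<forall>j<N. \<forall>g\<in>G. norm ((\<alpha> ^^ j) w * g - g * (\<alpha> ^^ j) w) \<le> 2 * \<delta>) \<and>
      norm (w * e 0 * w\<^sup>\<star> - (\<alpha> ^^ R) (e 0)) \<le> (2 * real N + 2) * \<delta> \<and>
      z\<^sup>\<star> * z = 1 - (\<Sum>j<N. e j) \<and> z * z\<^sup>\<star> \<in> cs_hered x"
proof -
  define \<beta> where "\<beta> = \<alpha> ^^ R"
  have \<alpha>j: "cs_automorphism (\<alpha> ^^ j)" for j by (rule cs_automorphism_funpow[OF \<alpha>])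
  \<comment> \<open>Pulling \<open>G\<close> back by the powers of \<alpha> makes all translates of
    \<open>w\<close>, not only \<open>w\<close> itself, nearly commute with
    \<open>G\<close>.\<close>
  define G' where "G' = (\<Union>j<N. inv (\<alpha> ^^ j) ` G)"
  have G': "finite G'" using G by (simp add: G'_def)
  obtain u where u: "\<And>n. cs_unitary (u n)" "\<And>a. (\<lambda>n. u n * a * (u n)\<^sup>\<star>) \<longlonglongrightarrow> \<beta> a"
    using inner unfolding cs_approx_inner_def \<beta>_def by blast
  have ev: "eventually (\<lambda>n. \<forall>a\<in>S. norm (u n * a * (u n)\<^sup>\<star> - \<beta> a) < \<delta>) sequentially"
    if "finite S" for S
    unfolding eventually_ball_finite_distrib[OF that]
    using order_tendstoD(2)[OF tendsto_norm_zero[OF LIM_zero[OF u(2)]] d] by blast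
  obtain m where m: "\<And>a. a \<in> G' \<Longrightarrow> norm (u m * a * (u m)\<^sup>\<star> - \<beta> a) < \<delta>"
    using eventually_happens[OF ev[OF G']] by auto
  have "finite (insert (u m) G) \<and> \<delta> > 0 \<and> cs_positive x \<and> x \<noteq> 0" using G d x by simp
  from rok[unfolded tracial_rokhlin_def, rule_format, OF this, of "N - 1"]
  obtain e where e: "\<And>j. j \<le> N - 1 \<Longrightarrow> cs_projection (e j)"
    "\<And>i j. i \<le> N - 1 \<Longrightarrow> j \<le> N - 1 \<Longrightarrow> i \<noteq> j \<Longrightarrow> e i * e j = 0"
    "\<And>j. j < N - 1 \<Longrightarrow> norm (\<alpha> (e j) - e (Suc j)) < \<delta>"
    "\<And>j g. j \<le> N - 1 \<Longrightarrow> g \<in> insert (u m) G \<Longrightarrow> norm (e j * g - g * e j) < \<delta>"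
    "cs_subeq (1 - (\<Sum>j\<le>N - 1. e j)) x"
    by (metis (no_types, lifting))
  obtain n where n: "\<And>a. a \<in> insert (e 0) G' \<Longrightarrow> norm (u n * a * (u n)\<^sup>\<star> - \<beta> a) < \<delta>"
    using eventually_happens[OF ev[of "insert (e 0) G'"]] G' by auto
  obtain z where z: "1 - (\<Sum>j\<le>N - 1. e j) = z\<^sup>\<star> * z" "z * z\<^sup>\<star> \<in> cs_hered x"
    using e(5) unfolding cs_subeq_def by blast
  have "{..N - 1} = {..<N}" using R by auto
  then have z': "z\<^sup>\<star> * z = 1 - (\<Sum>j<N. e j)" using z(1) by simp
  define w where "w = (u m)\<^sup>\<star> * u n"
  have w: "cs_unitary w" unfolding w_def by (intro cs_unitary_mult cs_unitary_star u)
  have um: "(u m)\<^sup>\<star> * u m = 1" "u m * (u m)\<^sup>\<star> = 1" "cs_unitary (u m)" "cs_unitary ((u m)\<^sup>\<star>)"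
    using u(1)[of m] cs_unitary_star by (auto simp: cs_unitary_def)
  have conj: "norm ((u m)\<^sup>\<star> * a * u m - b) = norm (a - u m * b * (u m)\<^sup>\<star>)" for a b
  proof -
    have "u m * ((u m)\<^sup>\<star> * a * u m - b) * (u m)\<^sup>\<star> = (u m * (u m)\<^sup>\<star>) * a * (u m * (u m)\<^sup>\<star>) - u m * b * (u m)\<^sup>\<star>"
      by (simp add: algebra_simps)
    then have "u m * ((u m)\<^sup>\<star> * a * u m - b) * (u m)\<^sup>\<star> = a - u m * b * (u m)\<^sup>\<star>" by (simp only: um) simp
    then show ?thesis using um by (metis norm_cs_unitary_mult)
  qed
  have wa: "norm (w * a * w\<^sup>\<star> - (u m)\<^sup>\<star> * \<beta> a * u m) < \<delta>" if "a \<in> insert (e 0) G'" for a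
  proof -
    have "w * a * w\<^sup>\<star> - (u m)\<^sup>\<star> * \<beta> a * u m = (u m)\<^sup>\<star> * (u n * a * (u n)\<^sup>\<star> - \<beta> a) * u m"
      by (simp add: w_def algebra_simps)
    then show ?thesis using n[OF that] um(3,4) by simp
  qed
  have wg: "norm (w * g - g * w) \<le> 2 * \<delta>" if "g \<in> G'" for g
  proof -
    have "norm ((u m)\<^sup>\<star> * \<beta> g * u m - g) < \<delta>"
      using m[OF that] norm_minus_commute[of "\<beta> g"] by (simp only: conj)
    then have "norm ((w * g * w\<^sup>\<star> - (u m)\<^sup>\<star> * \<beta> g * u m) + ((u m)\<^sup>\<star> * \<beta> g * u m - g)) \<le> \<delta> + \<delta>"
      using wa[of g] that by (intro norm_triangle_mono) auto
    moreover have "(w * g * w\<^sup>\<star> - g) * w = w * g * (w\<^sup>\<star> * w) - g * w" by (simp add: algebra_simps)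
    then have "(w * g * w\<^sup>\<star> - g) * w = w * g - g * w" using w by (simp add: cs_unitary_def)
    then have "norm (w * g - g * w) = norm (w * g * w\<^sup>\<star> - g)" using w by (metis norm_cs_unitary_mult(2))
    ultimately show ?thesis by simp
  qed
  have ej: "norm ((\<alpha> ^^ j) (e 0) - e j) \<le> real j * \<delta>" if "j < N" for j
    using that
  proof (induction j)
    case (Suc j)
    have "(\<alpha> ^^ Suc j) (e 0) - e (Suc j) = \<alpha> ((\<alpha> ^^ j) (e 0) - e j) + (\<alpha> (e j) - e (Suc j))"
      by (simp add: cs_automorphism_diff[OF \<alpha>])
    then have "norm ((\<alpha> ^^ Suc j) (e 0) - e (Suc j)) \<le> norm ((\<alpha> ^^ j) (e 0) - e j) + norm (\<alpha> (e j) - e (Suc j))"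
      by (metis norm_triangle_ineq cs_automorphism_norm[OF \<alpha>])
    moreover have "j < N - 1" using Suc.prems by simp
    ultimately show ?case using Suc.IH Suc.prems e(3)[of j] by (simp add: algebra_simps)
  qed simp
  have jN: "real j * \<delta> \<le> real N * \<delta>" if "j < N" for j using that d by simp
  \<comment> \<open>The constant collects \<delta> from \<open>u n\<close>, N \<delta> + \<delta>
    from reaching \<open>e R\<close> and moving it past \<open>u m\<close>, and N \<delta> for
    returning from \<open>e R\<close> to \<beta>(e 0).\<close>
  have we: "norm (w * e 0 * w\<^sup>\<star> - \<beta> (e 0)) \<le> (2 * real N + 2) * \<delta>"
  proof -
    have 1: "norm (\<beta> (e 0) - e R) \<le> real N * \<delta>" using ej[OF R] jN[OF R] by (simp add: \<beta>_def)
    have "(e R * u m - u m * e R) * (u m)\<^sup>\<star> = e R * (u m * (u m)\<^sup>\<star>) - u m * e R * (u m)\<^sup>\<star>"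
      by (simp add: algebra_simps)
    then have "(e R * u m - u m * e R) * (u m)\<^sup>\<star> = e R - u m * e R * (u m)\<^sup>\<star>" by (simp only: um) simp
    then have "norm (e R - u m * e R * (u m)\<^sup>\<star>) = norm (e R * u m - u m * e R)"
      using um by (metis norm_cs_unitary_mult(2))
    then have 2: "norm (e R - u m * e R * (u m)\<^sup>\<star>) \<le> \<delta>" using e(4)[of R "u m"] R by (simp add: Suc_leI less_imp_le le_diff_conv2)
    have "norm ((\<beta> (e 0) - e R) + (e R - u m * e R * (u m)\<^sup>\<star>)) \<le> real N * \<delta> + \<delta>"
      using 1 2 by (rule norm_triangle_mono)
    then have 3: "norm ((u m)\<^sup>\<star> * \<beta> (e 0) * u m - e R) \<le> real N * \<delta> + \<delta>" by (simp add: conj)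
    have "norm ((w * e 0 * w\<^sup>\<star> - (u m)\<^sup>\<star> * \<beta> (e 0) * u m) + (((u m)\<^sup>\<star> * \<beta> (e 0) * u m - e R) + (e R - \<beta> (e 0))))
        \<le> \<delta> + ((real N * \<delta> + \<delta>) + real N * \<delta>)"
      using wa[of "e 0"] 1 3 by (intro norm_triangle_mono) (auto simp: norm_minus_commute)
    then show ?thesis by (simp add: algebra_simps)
  qed
  have wj: "norm ((\<alpha> ^^ j) w * g - g * (\<alpha> ^^ j) w) \<le> 2 * \<delta>" if "j < N" "g \<in> G" for j g
  proof -
    define g' where "g' = inv (\<alpha> ^^ j) g"
    have "g' \<in> G'" using that by (auto simp: G'_def g'_def)
    have "(\<alpha> ^^ j) g' = g" using cs_automorphism_bij[OF \<alpha>j[of j]]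
      by (simp add: g'_def bij_def surj_f_inv_f)
    then have "(\<alpha> ^^ j) w * g - g * (\<alpha> ^^ j) w = (\<alpha> ^^ j) (w * g' - g' * w)"
      by (simp add: cs_automorphism_diff[OF \<alpha>j] cs_automorphism_mult[OF \<alpha>j])
    then show ?thesis using wg[OF \<open>g' \<in> G'\<close>] by (simp add: cs_automorphism_norm[OF \<alpha>j])
  qed
  show ?thesis
  proof (rule exI[of _ e], rule exI[of _ w], rule exI[of _ z], intro conjI allI impI ballI)
    show "norm ((\<alpha> ^^ j) (e 0) - e j) \<le> real N * \<delta>" if "j < N" for j
      using ej[OF that] jN[OF that] by simp
    show "norm (w * e 0 * w\<^sup>\<star> - (\<alpha> ^^ R) (e 0)) \<le> (2 * real N + 2) * \<delta>" using we by (simp add: \<beta>_def)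
  qed (use e z' z(2) w wj in \<open>auto intro!: less_imp_le\<close>)
qed

text \<open>Errors bounded by a constant times 1 / (k + 1) vanish in the quotient, so the relations
  become exact. \<open>Z\<close> stays a sequence of elements because membership in the hereditary
  subalgebra must be retained at every index.\<close>

lemma tower_in_sequence_algebra:
  fixes \<alpha> :: "'a::cstar_algebra \<Rightarrow> 'a"
  assumes \<alpha>: "cs_automorphism \<alpha>" and rok: "tracial_rokhlin \<alpha>" and inner: "cs_approx_inner (\<alpha> ^^ R)"
    and R: "R < N" and G: "finite G" and x: "cs_positive x" "x \<noteq> 0"
  shows "\<exists>E w Z. E\<^sup>\<bullet> = E \<and> E * E = E \<and>
      (\<forall>i<N. \<forall>j<N. i \<noteq> j \<longrightarrow> asq_map (\<alpha> ^^ i) E * asq_map (\<alpha> ^^ j) E = 0) \<and>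
      w\<^sup>\<bullet> * w = 1 \<and> w * w\<^sup>\<bullet> = 1 \<and> w * E * w\<^sup>\<bullet> = asq_map (\<alpha> ^^ R) E \<and>
      (\<forall>i<N. \<forall>g\<in>G. asq_const g * asq_map (\<alpha> ^^ i) E = asq_map (\<alpha> ^^ i) E * asq_const g) \<and>
      (\<forall>i<N. \<forall>g\<in>G. asq_const g * asq_map (\<alpha> ^^ i) w = asq_map (\<alpha> ^^ i) w * asq_const g) \<and>
      Bseq Z \<and> (asq_of Z)\<^sup>\<bullet> * asq_of Z = 1 - (\<Sum>i<N. asq_map (\<alpha> ^^ i) E) \<and>
      (\<forall>n. cs_projection ((Z n)\<^sup>\<star> * Z n) \<and> Z n * (Z n)\<^sup>\<star> \<in> cs_hered x)"
proof -
  define \<delta> where "\<delta> k = 1 / real (Suc k)" for k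
  have \<delta>: "\<delta> k > 0" for k by (simp add: \<delta>_def)
  have \<delta>_lim: "(\<lambda>k. C * \<delta> k) \<longlonglongrightarrow> 0" for C
    using tendsto_mult_left[OF LIMSEQ_inverse_real_of_nat, of C] by (simp add: \<delta>_def inverse_eq_divide)
  have null: "f \<longlonglongrightarrow> 0" if "\<And>k. norm (f k) \<le> C * \<delta> k" for f :: "nat \<Rightarrow> 'a" and C
    using that by (intro Lim_null_comparison[OF _ \<delta>_lim[of C]]) auto
  have \<alpha>j: "cs_automorphism (\<alpha> ^^ j)" for j by (rule cs_automorphism_funpow[OF \<alpha>])
  define Q where "Q k e w z \<longleftrightarrow> (\<forall>j<N. cs_projection (e j)) \<and> (\<forall>i<N. \<forall>j<N. i \<noteq> j \<longrightarrow> e i * e j = 0) \<and>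
      (\<forall>j<N. norm ((\<alpha> ^^ j) (e 0) - e j) \<le> real N * \<delta> k) \<and> (\<forall>j<N. \<forall>g\<in>G. norm (e j * g - g * e j) \<le> \<delta> k) \<and>
      cs_unitary w \<and> (\<forall>j<N. \<forall>g\<in>G. norm ((\<alpha> ^^ j) w * g - g * (\<alpha> ^^ j) w) \<le> 2 * \<delta> k) \<and>
      norm (w * e 0 * w\<^sup>\<star> - (\<alpha> ^^ R) (e 0)) \<le> (2 * real N + 2) * \<delta> k \<and>
      z\<^sup>\<star> * z = 1 - (\<Sum>j<N. e j) \<and> z * z\<^sup>\<star> \<in> cs_hered x" for k e w z
  have "\<forall>k. \<exists>e w z. Q k e w z"
    unfolding Q_def using tower_approx[OF \<alpha> rok inner R G x \<delta>] by blast
  then obtain e W Z where "\<And>k. Q k (e k) (W k) (Z k)" by metis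
  then have e: "\<And>k j. j < N \<Longrightarrow> cs_projection (e k j)"
    "\<And>k i j. i < N \<Longrightarrow> j < N \<Longrightarrow> i \<noteq> j \<Longrightarrow> e k i * e k j = 0"
    "\<And>k j. j < N \<Longrightarrow> norm ((\<alpha> ^^ j) (e k 0) - e k j) \<le> real N * \<delta> k"
    "\<And>k j g. j < N \<Longrightarrow> g \<in> G \<Longrightarrow> norm (e k j * g - g * e k j) \<le> 1 * \<delta> k"
    and W: "\<And>k. cs_unitary (W k)"
    "\<And>k j g. j < N \<Longrightarrow> g \<in> G \<Longrightarrow> norm ((\<alpha> ^^ j) (W k) * g - g * (\<alpha> ^^ j) (W k)) \<le> 2 * \<delta> k"
    "\<And>k. norm (W k * e k 0 * (W k)\<^sup>\<star> - (\<alpha> ^^ R) (e k 0)) \<le> (2 * real N + 2) * \<delta> k"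
    and Z: "\<And>k. (Z k)\<^sup>\<star> * Z k = 1 - (\<Sum>j<N. e k j)" "\<And>k. Z k * (Z k)\<^sup>\<star> \<in> cs_hered x"
    unfolding Q_def mult_1_left by blast+
  define E where "E = asq_of (\<lambda>k. e k 0)"
  define w where "w = asq_of W"
  have Be: "Bseq (\<lambda>k. e k j)" if "j < N" for j using e(1)[OF that] by (rule Bseq_cs_projection)
  have N: "0 < N" using R by simp
  have BW: "Bseq W" using W(1) by (rule Bseq_cs_unitary)
  have BWs: "Bseq (\<lambda>k. (W k)\<^sup>\<star>)" by (rule Bseq_cs_star[OF BW])
  have Ej: "asq_map (\<alpha> ^^ j) E = asq_of (\<lambda>k. e k j)" if "j < N" for j
    unfolding E_def asq_of_map[OF \<alpha>j Be[OF N]]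
    using null[OF e(3)[OF that]] Bseq_cs_automorphism[OF \<alpha>j Be[OF N]] Be[OF that]
    by (subst asq_of_eq_iff)
  have wj: "asq_map (\<alpha> ^^ j) w = asq_of (\<lambda>k. (\<alpha> ^^ j) (W k))" for j
    unfolding w_def by (rule asq_of_map[OF \<alpha>j BW])
  have BWj: "Bseq (\<lambda>k. (\<alpha> ^^ j) (W k))" for j by (rule Bseq_cs_automorphism[OF \<alpha>j BW])
  have proj: "cs_projection ((Z k)\<^sup>\<star> * Z k)" for k
    unfolding Z(1) by (intro cs_projection_complement cs_projection_sum) (auto intro: e)
  have BZ: "Bseq Z"
  proof -
    have "norm (Z k) \<le> 1" for k
    proof -
      have "(norm (Z k))\<^sup>2 \<le> 1" using norm_cs_projection_le[OF proj[of k]] by (simp only: cs_cstar_identity)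
      then show ?thesis by (simp add: power_le_one_iff)
    qed
    then show ?thesis unfolding Bseq_iff_norm_le by blast
  qed
  have "E\<^sup>\<bullet> = E" "E * E = E"
    unfolding E_def using e(1)[OF N] Be[OF N]
    by (simp_all add: asq_of_star asq_of_mult cs_projection_def)
  moreover have "asq_map (\<alpha> ^^ i) E * asq_map (\<alpha> ^^ j) E = 0" if "i < N" "j < N" "i \<noteq> j" for i j
    using that by (simp add: Ej asq_of_mult Be e(2) asq_zero_eq)
  moreover have "w\<^sup>\<bullet> * w = 1" "w * w\<^sup>\<bullet> = 1"
    unfolding w_def using W(1) BW BWs by (simp_all add: asq_of_star asq_of_mult cs_unitary_def asq_one_eq)
  moreover have "w * E * w\<^sup>\<bullet> = asq_map (\<alpha> ^^ R) E"
  proof -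
    have "w * E * w\<^sup>\<bullet> = asq_of (\<lambda>k. W k * e k 0 * (W k)\<^sup>\<star>)"
      unfolding w_def E_def using BW BWs Be[OF N] by (simp add: asq_of_star asq_of_mult Bseq_times)
    also have "\<dots> = asq_of (\<lambda>k. (\<alpha> ^^ R) (e k 0))"
      using null[OF W(3)] BW BWs Be[OF N] Bseq_cs_automorphism[OF \<alpha>j Be[OF N], of R]
      by (subst asq_of_eq_iff) (auto intro: Bseq_times)
    also have "\<dots> = asq_map (\<alpha> ^^ R) E" unfolding E_def by (rule asq_of_map[OF \<alpha>j Be[OF N], symmetric])
    finally show ?thesis .
  qed
  moreover have "asq_const g * asq_map (\<alpha> ^^ i) E = asq_map (\<alpha> ^^ i) E * asq_const g"
    if "i < N" "g \<in> G" for i g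
  proof -
    have "asq_of (\<lambda>k. e k i * g) = asq_of (\<lambda>k. g * e k i)"
      using null[OF e(4)[OF that]] Be[OF that(1)] by (subst asq_of_eq_iff) (auto intro!: Bseq_times)
    then show ?thesis using Be[OF that(1)] by (simp add: Ej[OF that(1)] asq_const_eq asq_of_mult)
  qed
  moreover have "asq_const g * asq_map (\<alpha> ^^ i) w = asq_map (\<alpha> ^^ i) w * asq_const g"
    if "i < N" "g \<in> G" for i g
  proof -
    have "asq_of (\<lambda>k. (\<alpha> ^^ i) (W k) * g) = asq_of (\<lambda>k. g * (\<alpha> ^^ i) (W k))"
      using null[OF W(2)[OF that]] BWj by (subst asq_of_eq_iff) (auto intro!: Bseq_times)
    then show ?thesis using BWj by (simp add: wj asq_const_eq asq_of_mult)
  qed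
  moreover have "(asq_of Z)\<^sup>\<bullet> * asq_of Z = 1 - (\<Sum>i<N. asq_map (\<alpha> ^^ i) E)"
  proof -
    have "(asq_of Z)\<^sup>\<bullet> * asq_of Z = asq_of (\<lambda>k. 1 - (\<Sum>j<N. e k j))"
      using BZ by (simp add: asq_of_star asq_of_mult Bseq_cs_star Z(1))
    also have "\<dots> = 1 - asq_of (\<lambda>k. \<Sum>j<N. e k j)"
      unfolding asq_one_eq by (rule asq_of_diff[symmetric]) (auto intro!: Bseq_sum Be)
    also have "asq_of (\<lambda>k. \<Sum>j<N. e k j) = (\<Sum>j<N. asq_of (\<lambda>k. e k j))"
      by (rule asq_of_sum[symmetric]) (simp add: Be)
    also have "\<dots> = (\<Sum>j<N. asq_map (\<alpha> ^^ j) E)" by (simp add: Ej)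
    finally show ?thesis .
  qed
  ultimately show ?thesis using BZ proj Z(2) by blast
qed

section \<open>Rotation angles and partial isometries below x\<close>

lemma slow_rotation:
  assumes "\<eta> > 0"
  obtains H and c s :: "nat \<Rightarrow> real" where "H > 0" "\<And>k. (c k)\<^sup>2 + (s k)\<^sup>2 = 1" "c 0 = 1" "s 0 = 0"
    "\<And>k. H \<le> Suc k \<Longrightarrow> c k = 0" "\<And>k. H \<le> Suc k \<Longrightarrow> s k = 1"
    "\<And>k. ((s k)\<^sup>2 - (s (Suc k))\<^sup>2)\<^sup>2 + (s k * c k - s (Suc k) * c (Suc k))\<^sup>2 \<le> \<eta>"
proof -
  \<comment> \<open>The angle runs from 0 to pi / 2 in m steps of size at most 2 / m. As m > 4 /
    \<eta> and m >= 1, also m^2 >= 4 / \<eta>, which bounds the squared step by \<eta>.\<close>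
  obtain m :: nat where m: "real m > 4 / \<eta> + 1" using reals_Archimedean2 by blast
  then have m1: "real m \<ge> 1" using assms by (smt (verit) divide_nonneg_pos)
  define \<theta> where "\<theta> k = real (min k m) / real m * (pi / 2)" for k
  have diff: "\<bar>\<theta> k - \<theta> (Suc k)\<bar> \<le> 2 / real m" for k
  proof -
    have "\<theta> k - \<theta> (Suc k) = (real (min k m) - real (min (Suc k) m)) * (pi / 2 / real m)"
      by (simp add: \<theta>_def algebra_simps diff_divide_distrib)
    then have "\<bar>\<theta> k - \<theta> (Suc k)\<bar> = \<bar>real (min k m) - real (min (Suc k) m)\<bar> * (pi / 2 / real m)"
      using m1 by (simp add: abs_mult)
    also have "\<dots> \<le> 1 * (2 / real m)"
    proof (rule mult_mono)
      show "pi / 2 / real m \<le> 2 / real m" using pi_less_4 by (intro divide_right_mono) auto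
    qed (auto simp: min_def)
    finally show ?thesis by simp
  qed
  have small: "(2 / real m)\<^sup>2 \<le> \<eta>"
  proof -
    have "4 / \<eta> \<le> real m * real m"
      using m mult_right_mono[OF m1, of "real m"] by linarith
    then show ?thesis using assms m1 by (simp add: field_simps power2_eq_square)
  qed
  \<comment> \<open>The left side is the square of the distance between the rank one projections at
    angles a and b, which is the sine of a - b.\<close>
  have est: "((sin a)\<^sup>2 - (sin b)\<^sup>2)\<^sup>2 + (sin a * cos a - sin b * cos b)\<^sup>2 \<le> (a - b)\<^sup>2" for a b :: real
  proof -
    have 1: "(sin a)\<^sup>2 - (sin b)\<^sup>2 = sin (a + b) * sin (a - b)"
    proof -
      have "sin (a + b) * sin (a - b) = (sin a)\<^sup>2 * (cos b)\<^sup>2 - (cos a)\<^sup>2 * (sin b)\<^sup>2"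
        unfolding sin_add sin_diff by (simp add: algebra_simps power2_eq_square)
      also have "\<dots> = (sin a)\<^sup>2 - (sin b)\<^sup>2" unfolding cos_squared_eq by (simp add: algebra_simps)
      finally show ?thesis by simp
    qed
    have 2: "sin a * cos a - sin b * cos b = cos (a + b) * sin (a - b)"
    proof -
      have "cos (a + b) * sin (a - b) = sin a * cos a * (cos b)\<^sup>2 - (cos a)\<^sup>2 * (sin b * cos b)
          - (sin a)\<^sup>2 * (sin b * cos b) + sin a * cos a * (sin b)\<^sup>2"
        unfolding cos_add sin_diff by (simp add: algebra_simps power2_eq_square)
      also have "\<dots> = sin a * cos a - sin b * cos b" unfolding cos_squared_eq by (simp add: algebra_simps)
      finally show ?thesis by simp
    qed
    have "((sin a)\<^sup>2 - (sin b)\<^sup>2)\<^sup>2 + (sin a * cos a - sin b * cos b)\<^sup>2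
        = ((sin (a + b))\<^sup>2 + (cos (a + b))\<^sup>2) * (sin (a - b))\<^sup>2"
      unfolding 1 2 by (simp only: power_mult_distrib distrib_right)
    also have "\<dots> = (sin (a - b))\<^sup>2" by simp
    also have "\<dots> \<le> (a - b)\<^sup>2" using abs_sin_x_le_abs_x[of "a - b"] by (simp add: abs_le_square_iff)
    finally show ?thesis .
  qed
  show ?thesis
  proof (rule that[of "Suc m" "\<lambda>k. cos (\<theta> k)" "\<lambda>k. sin (\<theta> k)"])
    show "((sin (\<theta> k))\<^sup>2 - (sin (\<theta> (Suc k)))\<^sup>2)\<^sup>2
        + (sin (\<theta> k) * cos (\<theta> k) - sin (\<theta> (Suc k)) * cos (\<theta> (Suc k)))\<^sup>2 \<le> \<eta>" for k
    proof -
      have "(\<theta> k - \<theta> (Suc k))\<^sup>2 \<le> (2 / real m)\<^sup>2" using diff[of k] m1 by (simp add: abs_le_square_iff[symmetric])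
      then show ?thesis using est[of "\<theta> k" "\<theta> (Suc k)"] small by linarith
    qed
    have \<theta>: "\<theta> k = pi / 2" if "Suc m \<le> Suc k" for k using that m1 by (simp add: \<theta>_def min_def)
    show "cos (\<theta> k) = 0" "sin (\<theta> k) = 1" if "Suc m \<le> Suc k" for k
      unfolding \<theta>[OF that] by simp_all
  qed (simp_all add: \<theta>_def)
qed

text \<open>From Z = Z Z* Z, membership of Z Z* in the right ideal, and annihilation by y, are
  inherited by \<open>Z\<close> itself.\<close>

lemma partial_isometry_in_closure:
  fixes x Z c :: "'a::cstar_algebra"
  assumes proj: "cs_projection (Z\<^sup>\<star> * Z)" and hered: "Z * Z\<^sup>\<star> \<in> cs_hered (x * c)"
  shows "Z \<in> closure (range ((*) x))" and "y * (x * c) = 0 \<Longrightarrow> y * Z = 0"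
proof -
  have "(Z - Z * (Z\<^sup>\<star> * Z))\<^sup>\<star> * (Z - Z * (Z\<^sup>\<star> * Z))
      = Z\<^sup>\<star> * Z - Z\<^sup>\<star> * Z * (Z\<^sup>\<star> * Z) - (Z\<^sup>\<star> * Z * (Z\<^sup>\<star> * Z) - Z\<^sup>\<star> * Z * (Z\<^sup>\<star> * Z) * (Z\<^sup>\<star> * Z))"
    by (simp add: right_diff_distrib left_diff_distrib mult.assoc)
  also have "\<dots> = 0" using proj unfolding cs_projection_def by simp
  finally have Z: "Z = Z * Z\<^sup>\<star> * Z" unfolding cs_star_mult_eq_0 by (simp add: mult.assoc)
  have "cs_hered (x * c) \<subseteq> closure (range ((*) x))"
    unfolding cs_hered_def by (rule closure_mono) (auto simp: mult.assoc)
  then have "Z * Z\<^sup>\<star> \<in> closure (range ((*) x))" using hered by blast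
  then have "Z * Z\<^sup>\<star> * Z \<in> closure (range ((*) x))" by (rule closure_right_ideal)
  then show "Z \<in> closure (range ((*) x))" using Z by simp
  assume 0: "y * (x * c) = 0"
  obtain f where f: "\<And>n::nat. f n \<in> {x * c * v * (x * c) | v. True}" "f \<longlonglongrightarrow> Z * Z\<^sup>\<star>"
    using hered unfolding cs_hered_def closure_sequential by blast
  have "y * f n = 0" for n
  proof -
    obtain v where "f n = x * c * v * (x * c)" using f(1)[of n] by blast
    then have "y * f n = y * (x * c) * v * (x * c)" by (simp add: mult.assoc)
    then show ?thesis using 0 by simp
  qed
  moreover have "(\<lambda>n. y * f n) \<longlonglongrightarrow> y * (Z * Z\<^sup>\<star>)" by (intro tendsto_intros f(2))
  ultimately have "y * (Z * Z\<^sup>\<star>) = 0" by (simp add: LIMSEQ_const_iff)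
  then have "y * (Z * Z\<^sup>\<star> * Z) = 0" by (simp flip: mult.assoc)
  then show "y * Z = 0" using Z by simp
qed

section \<open>Assembly of the cyclic tower\<close>

theorem theorem3p4:
  fixes \<alpha> :: "'a::cstar_algebra \<Rightarrow> 'a" and r :: nat
  assumes "cs_separable TYPE('a)"
    and "cs_simple TYPE('a)"
    and "TR_le_1 TYPE('a)"
    and "cs_automorphism \<alpha>"
    and "r \<ge> 1"
    and "cs_approx_inner (\<alpha> ^^ r)"
    and "tracial_rokhlin \<alpha>"
  shows "tracial_cyclic_rokhlin \<alpha>"
  unfolding tracial_cyclic_rokhlin_def
proof (intro allI impI)
  note simple = assms(2) and \<alpha> = assms(4) and rok = assms(7)
  fix F :: "'a set" and \<epsilon> :: real and n :: nat and x :: 'a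
  assume *: "finite F \<and> 0 < \<epsilon> \<and> cs_positive x \<and> x \<noteq> 0"
  then have F: "finite F" and \<epsilon>: "\<epsilon> > 0" and x: "cs_positive x" "x \<noteq> 0" by auto
  show "\<exists>e. (\<forall>j\<le>n. cs_projection (e j)) \<and> (\<forall>i\<le>n. \<forall>j\<le>n. i \<noteq> j \<longrightarrow> e i * e j = 0) \<and>
      (\<forall>j\<le>n. norm (\<alpha> (e j) - e (if j = n then 0 else Suc j)) < \<epsilon>) \<and>
      (\<forall>j\<le>n. \<forall>a\<in>F. norm (e j * a - a * e j) < \<epsilon>) \<and> cs_subeq (1 - (\<Sum>j\<le>n. e j)) x"
  proof (cases "cs_subeq 1 x")
    case True
    then show ?thesis
      by (intro exI[of _ "\<lambda>_. 0"]) (auto simp: \<epsilon> cs_automorphism_zero[OF \<alpha>])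
  next
    case False
    have xs: "x\<^sup>\<star> = x" using x(1) by (auto simp: cs_positive_def)
    obtain x' y c1 c2 where x': "cs_positive x'" "x' \<noteq> 0" "x' = x * c1"
      and y: "y\<^sup>\<star> = y" "y \<noteq> 0" "y * x' = 0" "y = x * c2"
      using exists_orthogonal_pair[OF simple \<alpha> rok x False] by metis
    obtain M and a :: "nat \<Rightarrow> 'a" where a: "1 = (\<Sum>i<M. a i * (y * y) * (a i)\<^sup>\<star>)"
      using simple_one_eq_sum_conj[OF simple y(2,1)] by blast
    define d where "d = Suc n"
    define R where "R = r * d"
    have R0: "R > 0" using assms(5) by (simp add: R_def d_def)
    \<comment> \<open>The certificate is lifted with an additional error \<eta>, and 2 \<eta> is
      still below \<epsilon>^2.\<close>
    define \<eta> where "\<eta> = \<epsilon>\<^sup>2 / 4"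
    have \<eta>: "\<eta> > 0" using \<epsilon> by (simp add: \<eta>_def)
    obtain H and c s :: "nat \<Rightarrow> real" where rot: "H > 0" "\<And>k. (c k)\<^sup>2 + (s k)\<^sup>2 = 1" "c 0 = 1" "s 0 = 0"
      "\<And>k. H \<le> Suc k \<Longrightarrow> c k = 0" "\<And>k. H \<le> Suc k \<Longrightarrow> s k = 1"
      "\<And>k. ((s k)\<^sup>2 - (s (Suc k))\<^sup>2)\<^sup>2 + (s k * c k - s (Suc k) * c (Suc k))\<^sup>2 \<le> \<eta>"
      using slow_rotation[OF \<eta>] by blast
    \<comment> \<open>At least H, so that the two rotated ends do not overlap, and large enough to
      give each of the H remainder pieces in a residue class M rungs of its own.\<close>
    define C where "C = H + H * M"
    define T where "T = C + H"
    have inner: "cs_approx_inner (\<alpha> ^^ R)"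
      using cs_approx_inner_funpow[OF assms(6), of n] by (simp only: R_def d_def funpow_mult)
    have "1 < T" using rot(1) by (simp add: T_def C_def)
    then have RN: "R < R * T" using R0 by simp
    define G0 where "G0 = insert y (a ` {..<M} \<union> F)"
    define G where "G = G0 \<union> cs_star ` G0"
    have G: "finite G" using F by (simp add: G_def G0_def)
    have Gs: "g\<^sup>\<star> \<in> G" if "g \<in> G0" for g using that by (simp add: G_def)
    have G0: "g \<in> G" if "g \<in> G0" for g using that by (simp add: G_def)
    obtain E w Z where E: "E\<^sup>\<bullet> = E" "E * E = E"
      "\<And>i j. i < R * T \<Longrightarrow> j < R * T \<Longrightarrow> i \<noteq> j \<Longrightarrow> asq_map (\<alpha> ^^ i) E * asq_map (\<alpha> ^^ j) E = 0"
      and w: "w\<^sup>\<bullet> * w = 1" "w * w\<^sup>\<bullet> = 1" "w * E * w\<^sup>\<bullet> = asq_map (\<alpha> ^^ R) E"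
      and comm: "\<And>i g. i < R * T \<Longrightarrow> g \<in> G \<Longrightarrow> asq_const g * asq_map (\<alpha> ^^ i) E = asq_map (\<alpha> ^^ i) E * asq_const g"
        "\<And>i g. i < R * T \<Longrightarrow> g \<in> G \<Longrightarrow> asq_const g * asq_map (\<alpha> ^^ i) w = asq_map (\<alpha> ^^ i) w * asq_const g"
      and Z: "Bseq Z" "(asq_of Z)\<^sup>\<bullet> * asq_of Z = 1 - (\<Sum>i<R * T. asq_map (\<alpha> ^^ i) E)"
        "\<And>k. cs_projection ((Z k)\<^sup>\<star> * Z k)" "\<And>k. Z k * (Z k)\<^sup>\<star> \<in> cs_hered x'"
      using tower_in_sequence_algebra[OF \<alpha> rok inner RN G x'(1,2)] by metis
    interpret matrix_tower \<alpha> R T H C E w c s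
      by unfold_locales (use \<alpha> R0 rot E w in \<open>auto simp: C_def T_def\<close>)
    have comm_E: "asq_const g * \<sigma> i (matrix_tower.E \<alpha> R E w k l) = \<sigma> i (matrix_tower.E \<alpha> R E w k l) * asq_const g"
      if "g \<in> G0" "i < R" "k < T" "l < T" for g i k l
      by (rule commute_sigma_E)
        (use that comm G0 Gs in \<open>simp_all add: \<sigma>_def flip: asq_const_star\<close>)
    have comm_P: "asq_const g * \<sigma> i P = \<sigma> i P * asq_const g" if g: "g \<in> F" and i: "i < R" for g i
    proof -
      have "g \<in> G0" using g by (simp add: G0_def)
      note cE = comm_E[OF this i]
      have "asq_const g * \<sigma> i (p k) = \<sigma> i (p k) * asq_const g" if "k < C" for k
        using that cE by (simp add: p_def sigma_simps distrib_left distrib_right T_def)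
      then show ?thesis by (simp add: P_def sigma_sum sum_distrib_left sum_distrib_right)
    qed
    have "\<exists>b. (asq_of Z + asq_const y * b)\<^sup>\<bullet> * (asq_of Z + asq_const y * b) = 1 - (\<Sum>j<R. \<sigma> j P)"
    proof (rule remainder[where x = "\<lambda>i. asq_const (a i)" and M = M])
      show "(asq_const y)\<^sup>\<bullet> = asq_const y" by (simp only: asq_const_star[symmetric] y(1))
      have "y * Z k = 0" for k
        using partial_isometry_in_closure(2)[OF Z(3), of k x c1 y] Z(4)[of k] y(3) by (simp add: x'(3))
      then show "asq_const y * asq_of Z = 0"
        using Z(1) by (simp add: asq_const_eq asq_of_mult asq_zero_eq)
      show "(asq_of Z)\<^sup>\<bullet> * asq_of Z = 1 - (\<Sum>i<R * T. \<sigma> i E)" by (simp add: Z(2) \<sigma>_def)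
      show "(\<Sum>i<M. asq_const (a i) * (asq_const y * asq_const y) * (asq_const (a i))\<^sup>\<bullet>) = 1"
        using arg_cong[OF a, of asq_const] by simp
      show "H * M \<le> T" by (simp add: T_def C_def)
    qed (rule comm_E; simp add: G0_def)+
    then obtain b where b: "(asq_of Z + asq_const y * b)\<^sup>\<bullet> * (asq_of Z + asq_const y * b) = 1 - (\<Sum>j<R. \<sigma> j P)"
      by blast
    obtain b' where b': "Bseq b'" "b = asq_of b'" by (rule asq_exhaust)
    \<comment> \<open>Both summands lie in the closed right ideal of x: \<open>Z k\<close> because
      it comes from x', and the other because \<open>y\<close> does.\<close>
    define Y where "Y k = Z k + y * b' k" for k
    have BY: "Bseq Y" unfolding Y_def by (intro Bseq_plus Bseq_times Z b') simp
    have Y: "asq_of Y = asq_of Z + asq_const y * b"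
      unfolding b' asq_const_eq using Z(1) b'(1)
      by (simp add: Y_def[abs_def] asq_of_mult asq_of_add Bseq_times)
    have Y_closure: "Y k \<in> closure (range ((*) x))" for k
    proof -
      have "Z k \<in> closure (range ((*) x))"
        using partial_isometry_in_closure(1)[OF Z(3)] Z(4) unfolding x'(3) by blast
      then show ?thesis using closure_right_ideal_add[of "Z k" x "c2 * b' k"] by (simp add: Y_def y(4) mult.assoc)
    qed
    \<comment> \<open>The sum of the translates of \<open>P\<close> whose index is congruent to i
      modulo d; the r summands exhaust the indices below R = r d.\<close>
    define g where "g i = (\<Sum>l<r. \<sigma> (i + d * l) P)" for i
    have d0: "d > 0" by (simp add: d_def)
    have idx: "i + d * l < R" if "i < d" "l < r" for i l
    proof -
      have "i + d * l < d * Suc l" using that by simp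
      also have "\<dots> \<le> d * r" using that by (intro mult_le_mono2) simp
      finally show ?thesis by (simp add: R_def mult.commute)
    qed
    have idx_inj: "i = j \<and> l = l'" if "i + d * l = j + d * l'" "i < d" "j < d" for i j l l'
    proof -
      have "(i + d * l) mod d = i" "(i + d * l) div d = l" if "i < d" for i l
        using that by simp_all
      then show ?thesis using that by metis
    qed
    have g_mult: "g i * g j = (if i = j then g i else 0)" if ij: "i < d" "j < d" for i j
    proof -
      have "g i * g j = (\<Sum>l<r. \<Sum>l'<r. \<sigma> (i + d * l) P * \<sigma> (j + d * l') P)"
        unfolding g_def by (rule sum_product)
      also have "\<dots> = (\<Sum>l<r. \<Sum>l'<r. if l = l' then (if i = j then \<sigma> (i + d * l) P else 0) else 0)"
      proof (intro sum.cong refl)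
        fix l l' assume l: "l \<in> {..<r}" "l' \<in> {..<r}"
        show "\<sigma> (i + d * l) P * \<sigma> (j + d * l') P = (if l = l' then (if i = j then \<sigma> (i + d * l) P else 0) else 0)"
        proof (cases "i = j \<and> l = l'")
          case True
          then show ?thesis by (simp add: P_idem flip: sigma_mult)
        next
          case False
          then have "\<sigma> (i + d * l) P * \<sigma> (j + d * l') P = 0"
            using idx_inj[of i l j l'] ij l by (intro sigma_P_orth idx) auto
          then show ?thesis using False by auto
        qed
      qed
      also have "\<dots> = (if i = j then g i else 0)" by (simp add: g_def)
      finally show ?thesis .
    qed
    have g_star: "(g i)\<^sup>\<bullet> = g i" for i by (simp add: g_def P_star flip: sigma_star)
    have sum_g: "(\<Sum>i<d. g i) = (\<Sum>j<R. \<sigma> j P)"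
    proof -
      have "(\<Sum>j<R. \<sigma> j P) = (\<Sum>l<r. \<Sum>j=l * d..<l * d + d. \<sigma> j P)"
        using sum.nat_group[of "\<lambda>j. \<sigma> j P" d r] by (simp add: R_def)
      also have "\<dots> = (\<Sum>l<r. \<Sum>i<d. \<sigma> (i + d * l) P)"
      proof (rule sum.cong)
        fix l
        show "(\<Sum>j=l * d..<l * d + d. \<sigma> j P) = (\<Sum>i<d. \<sigma> (i + d * l) P)"
          using sum.shift_bounds_nat_ivl[of "\<lambda>j. \<sigma> j P" 0 "l * d" d]
          by (simp add: lessThan_atLeast0 add.commute mult.commute)
      qed simp
      also have "\<dots> = (\<Sum>i<d. g i)" unfolding g_def by (rule sum.swap)
      finally show ?thesis by simp
    qed
    have map_P: "asq_map \<alpha> (\<sigma> j P) = \<sigma> (Suc j) P" for j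
    proof -
      have "\<sigma> (Suc 0) = asq_map \<alpha>" by (simp add: \<sigma>_def)
      then show ?thesis using sigma_sigma[of "Suc 0" j P] by simp
    qed
    have map_g: "asq_map \<alpha> (g i) = g (Suc i)" for i
      by (simp add: g_def asq_map_sum[OF \<alpha>] map_P)
    \<comment> \<open>After d steps the sum returns to itself except at its two ends, so the cyclic
      defect is that of \<open>P\<close> under \<alpha>^R alone, whatever the size of r.\<close>
    have g_wrap: "g d - g 0 = \<sigma> R P - P"
    proof -
      have "(\<Sum>l<r. \<sigma> (d * l) P) + \<sigma> (d * r) P = \<sigma> (d * 0) P + (\<Sum>l<r. \<sigma> (d * Suc l) P)"
        using sum.lessThan_Suc_shift[of "\<lambda>l. \<sigma> (d * l) P" r] by (simp only: sum.lessThan_Suc)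
      then have "g 0 + \<sigma> R P = P + g d"
        by (simp add: g_def R_def sigma_0 mult.commute)
      then show ?thesis by (simp add: algebra_simps)
    qed
    have "\<exists>f. (\<forall>i<d. \<forall>k. cs_projection (f i k)) \<and>
      (\<forall>i<d. \<forall>j<d. i \<noteq> j \<longrightarrow> (\<forall>k. f i k * f j k = 0)) \<and> (\<forall>i<d. asq_of (f i) = g i)"
      by (rule lift_orthogonal_projections) (simp_all add: g_star g_mult)
    then obtain f where f: "\<And>i k. i < d \<Longrightarrow> cs_projection (f i k)"
      "\<And>i j k. i < d \<Longrightarrow> j < d \<Longrightarrow> i \<noteq> j \<Longrightarrow> f i k * f j k = 0" "\<And>i. i < d \<Longrightarrow> asq_of (f i) = g i"
      by metis
    have Bf: "Bseq (f i)" if "i < d" for i using f(1)[OF that] by (rule Bseq_cs_projection)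
    have B\<alpha>f: "Bseq (\<lambda>k. \<alpha> (f i k))" if "i < d" for i by (rule Bseq_cs_automorphism[OF \<alpha> Bf[OF that]])
    have \<alpha>f: "asq_of (\<lambda>k. \<alpha> (f i k)) = g (Suc i)" if "i < d" for i
      using asq_of_map[OF \<alpha> Bf[OF that]] by (simp add: f(3)[OF that] map_g)
    have small: "eventually (\<lambda>k. norm (X k) < e) sequentially" if "X \<longlonglongrightarrow> 0" "e > 0" for X :: "nat \<Rightarrow> 'a" and e
      using order_tendstoD(2)[OF tendsto_norm_zero[OF that(1)]] that(2) by blast
    have ev1: "eventually (\<lambda>k. \<forall>i\<in>{..<n}. norm (\<alpha> (f i k) - f (Suc i) k) < \<epsilon>) sequentially"
      unfolding eventually_ball_finite_distrib[OF finite_lessThan]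
    proof
      fix i assume "i \<in> {..<n}"
      then have i: "i < d" "Suc i < d" by (auto simp: d_def)
      then have "asq_of (\<lambda>k. \<alpha> (f i k)) = asq_of (f (Suc i))" by (simp add: \<alpha>f f(3))
      then have "(\<lambda>k. \<alpha> (f i k) - f (Suc i) k) \<longlonglongrightarrow> 0" using B\<alpha>f[OF i(1)] Bf[OF i(2)] asq_of_eq_iff by blast
      then show "eventually (\<lambda>k. norm (\<alpha> (f i k) - f (Suc i) k) < \<epsilon>) sequentially" using \<epsilon> by (rule small)
    qed
    have ev2: "eventually (\<lambda>k. (norm (\<alpha> (f n k) - f 0 k))\<^sup>2 \<le> \<eta> + \<eta>) sequentially"
    proof -
      have nd: "n < d" by (simp add: d_def)
      have "asq_of (\<lambda>k. \<alpha> (f n k) - f 0 k) = \<sigma> R P - P"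
        using asq_of_diff[OF B\<alpha>f[OF nd] Bf[OF d0]] \<alpha>f[OF nd] f(3)[OF d0] g_wrap by (simp add: d_def)
      moreover obtain z where "of_real \<eta> - (\<sigma> R P - P)\<^sup>\<bullet> * (\<sigma> R P - P) = (\<Sum>k<H. (z k)\<^sup>\<bullet> * z k)"
        using defect_certificate[OF rot(7)] by blast
      ultimately have "of_real \<eta> - (asq_of (\<lambda>k. \<alpha> (f n k) - f 0 k))\<^sup>\<bullet> * asq_of (\<lambda>k. \<alpha> (f n k) - f 0 k)
          = (\<Sum>k<H. (z k)\<^sup>\<bullet> * z k)" by simp
      then show ?thesis
        by (rule asq_norm_le) (use \<eta> B\<alpha>f[OF nd] Bf[OF d0] in \<open>auto intro: Bseq_minus\<close>)
    qed
    have ev3: "eventually (\<lambda>k. \<forall>i\<in>{..<d}. \<forall>a\<in>F. norm (f i k * a - a * f i k) < \<epsilon>) sequentially"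
      unfolding eventually_ball_finite_distrib[OF finite_lessThan] eventually_ball_finite_distrib[OF F]
    proof (intro ballI)
      fix i a assume "i \<in> {..<d}" and a: "a \<in> F"
      then have i: "i < d" by simp
      have "asq_const a * g i = g i * asq_const a"
        using idx[OF i] by (simp add: g_def sum_distrib_left sum_distrib_right comm_P[OF a])
      then have "asq_of (\<lambda>k. f i k * a) = asq_of (\<lambda>k. a * f i k)"
        using Bf[OF i] by (simp add: asq_const_eq asq_of_mult f(3)[OF i, symmetric])
      then have "(\<lambda>k. f i k * a - a * f i k) \<longlonglongrightarrow> 0"
        using Bf[OF i] by (subst (asm) asq_of_eq_iff) (auto intro!: Bseq_times)
      then show "eventually (\<lambda>k. norm (f i k * a - a * f i k) < \<epsilon>) sequentially" using \<epsilon> by (rule small)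
    qed
    have ev4: "eventually (\<lambda>k. norm ((Y k)\<^sup>\<star> * Y k - (1 - (\<Sum>i<d. f i k))) < 1) sequentially"
    proof -
      have BS: "Bseq (\<lambda>k. \<Sum>i<d. f i k)" by (rule Bseq_sum) (simp add: Bf)
      have "asq_of (\<lambda>k. \<Sum>i<d. f i k) = (\<Sum>i<d. g i)"
        using asq_of_sum[of "{..<d}" f] Bf f(3) by simp
      then have "asq_of (\<lambda>k. 1 - (\<Sum>i<d. f i k)) = 1 - (\<Sum>j<R. \<sigma> j P)"
        using asq_of_diff[OF _ BS, of "\<lambda>_. 1"] by (simp add: asq_one_eq sum_g)
      also have "\<dots> = asq_of (\<lambda>k. (Y k)\<^sup>\<star> * Y k)"
        using b BY by (simp add: Y[symmetric] asq_of_star asq_of_mult Bseq_cs_star)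
      finally have "(\<lambda>k. (Y k)\<^sup>\<star> * Y k - (1 - (\<Sum>i<d. f i k))) \<longlonglongrightarrow> 0"
        using BY BS asq_of_eq_iff[of "\<lambda>k. (Y k)\<^sup>\<star> * Y k" "\<lambda>k. 1 - (\<Sum>i<d. f i k)"]
        by (simp add: Bseq_times Bseq_cs_star Bseq_minus)
      then show ?thesis by (rule small) simp
    qed
    obtain k where k: "\<And>i. i < n \<Longrightarrow> norm (\<alpha> (f i k) - f (Suc i) k) < \<epsilon>"
      "(norm (\<alpha> (f n k) - f 0 k))\<^sup>2 \<le> \<eta> + \<eta>"
      "\<And>i a. i < d \<Longrightarrow> a \<in> F \<Longrightarrow> norm (f i k * a - a * f i k) < \<epsilon>"
      "norm ((Y k)\<^sup>\<star> * Y k - (1 - (\<Sum>i<d. f i k))) < 1"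
      using eventually_happens[OF eventually_conj[OF eventually_conj[OF ev1 ev2] eventually_conj[OF ev3 ev4]]]
      by auto
    have "\<eta> + \<eta> < \<epsilon>\<^sup>2" using \<epsilon> by (simp add: \<eta>_def)
    then have wrap: "norm (\<alpha> (f n k) - f 0 k) < \<epsilon>"
      using k(2) \<epsilon> by (intro power2_less_imp_less[of _ \<epsilon>]) auto
    have le_n: "{..n} = {..<d}" by (auto simp: d_def)
    \<comment> \<open>The complement of the lifted projections is itself a projection, so distance
      less than 1 from \<open>(Y k)\<^sup>\<star> * Y k\<close> already gives exact
      subequivalence.\<close>
    have "cs_projection (\<Sum>i<d. f i k)" by (rule cs_projection_sum) (auto intro: f)
    then have "cs_subeq (1 - (\<Sum>i<d. f i k)) x"
      using cs_subeq_of_near[OF xs cs_projection_complement Y_closure k(4)] by blast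
    then show ?thesis
      by (intro exI[of _ "\<lambda>i. f i k"]) (auto simp: le_n less_Suc_eq_le d_def intro!: f k wrap)
  qed
qed

end
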